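(* Let $\alpha\geq\beta\geq-\frac12$ with $\alpha\neq-\frac12$, let $p\in[1,2)$ and $q=\frac{p}{p-1}$ (with $q=\infty$ if $p=1$). Define $$\Omega_p=\bigl\{\lambda=\xi+i\eta\in\mathbb{C}:\ |\eta|<\bigl(\tfrac2p-1\bigr)\rho\bigr\}.$$ (1) If $\lambda\in\Omega_p$, then $G_\lambda\in L^q(\mathbb{R},d\mu)$. (2) If $f\in L^p(\mathbb{R},d\mu)$, then $\mathcal{H}f(\lambda)$ is well-defined and holomorphic in $\lambda\in\Omega_p$, and $|\mathcal{H}f(\lambda)|\leq\|f\|_{L^p(\mathbb{R},d\mu)}\|G_\lambda\|_{L^q(\mathbb{R},d\mu)}$ for all $\lambda\in\Omega_p$. (3) There exists a constant $c_p<\infty$ such that $\|\mathcal{H}f\|_{L^q(\mathbb{R},d\nu)}\leq c_p\|f\|_{L^p(\mathbb{R},d\mu)}$ for every $f\in L^p(\mathbb{R},d\mu)$.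
   Context: Put $\rho=\alpha+\beta+1$. The Jacobi functions are $\varphi_\lambda^{(\alpha,\beta)}(x)={}_2F_1\bigl(\frac{\rho+i\lambda}{2},\frac{\rho-i\lambda}{2};\alpha+1;-\sinh^2x\bigr)$. For $\lambda\in\mathbb{C}$, the Opdam hypergeometric function is $G_\lambda(x)=\varphi_\lambda^{(\alpha,\beta)}(x)-\frac{1}{\rho-i\lambda}\frac{d}{dx}\varphi_\lambda^{(\alpha,\beta)}(x)$, $x\in\mathbb{R}$ (extended by continuity to $\lambda=-i\rho$); it satisfies $TG_\lambda=i\lambda G_\lambda$, $G_\lambda(0)=1$, where $Tf(x)=f'(x)+[(2\alpha+1)\coth x+(2\beta+1)\tanh x]\frac{f(x)-f(-x)}{2}-\rho f(-x)$. Measures: $d\mu(x)=A(|x|)\,dx$ with $A(x)=(\sinh x)^{2\alpha+1}(\cosh x)^{2\beta+1}$, and $d\nu(\lambda)=\kappa\bigl(1-\frac{\rho}{i\lambda}\bigr)\frac{d\lambda}{8\pi|\mathbf{c}(\lambda)|^2}$ on $\mathbb{R}$, where $\mathbf{c}(\lambda)=\frac{\Gamma(\alpha+1)2^{\rho-i\lambda}\Gamma(i\lambda)}{\Gamma(\frac{\rho+i\lambda}{2})\Gamma(\frac{\alpha-\beta+1+i\lambda}{2})}$ and $\kappa>0$ is the normalizing constant (depending only on $\alpha,\beta$) for which $g\mapsto\int_{\mathbb{R}}g(\lambda)G_\lambda(x)\,d\nu(\lambda)$ inverts $\mathcal{H}$ on $C_c^\infty(\mathbb{R})$. Since $\nu$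 has a complex density, the spaces $L^q(\mathbb{R},d\nu)$ and their norms are taken with respect to $|\nu|$. The Cherednik--Opdam transform is $\mathcal{H}f(\lambda)=\int_{\mathbb{R}}f(x)G_\lambda(-x)\,d\mu(x)$. *)

theory Defs
  imports "HOL-Complex_Analysis.Complex_Analysis" "HOL-Probability.Essential_Supremum"
begin

(* Principal branch of the Gauss hypergeometric function: continuation of the Gauss series from
   the origin along the segment to z, through a domain S that is star-shaped about 0.
   For z outside [1, infinity) such an S exists, and the value depends neither on S nor on F
   (see hyp2F1_unique). *)
definition hyp2F1 :: "complex \<Rightarrow> complex \<Rightarrow> complex \<Rightarrow> complex \<Rightarrow> complex" where
  "hyp2F1 a b c z = (THE w. \<exists>S F. open S \<and> z \<in> S \<and> (\<forall>u\<in>S. closed_segment 0 u \<subseteq> S) \<and>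
      F holomorphic_on S \<and>
      (\<forall>\<^sub>F u in nhds 0. F u = eval_fps (fps_hypergeo [a, b] [c] 1) u) \<and> w = F z)"

lemma hyp2F1_unique:
  assumes "open S" "z \<in> S" "\<And>u. u \<in> S \<Longrightarrow> closed_segment 0 u \<subseteq> S" "F holomorphic_on S"
    and "\<forall>\<^sub>F u in nhds 0. F u = eval_fps (fps_hypergeo [a, b] [c] 1) u"
  shows "hyp2F1 a b c z = F z"
  unfolding hyp2F1_def
proof (rule the_equality)
  show "\<exists>S G. open S \<and> z \<in> S \<and> (\<forall>u\<in>S. closed_segment 0 u \<subseteq> S) \<and> G holomorphic_on S \<and>
      (\<forall>\<^sub>F u in nhds 0. G u = eval_fps (fps_hypergeo [a, b] [c] 1) u) \<and> F z = G z"
    using assms by blast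
next
  fix w
  assume "\<exists>S G. open S \<and> z \<in> S \<and> (\<forall>u\<in>S. closed_segment 0 u \<subseteq> S) \<and> G holomorphic_on S \<and>
      (\<forall>\<^sub>F u in nhds 0. G u = eval_fps (fps_hypergeo [a, b] [c] 1) u) \<and> w = G z"
  then obtain T G where G: "open T" "z \<in> T" "\<And>u. u \<in> T \<Longrightarrow> closed_segment 0 u \<subseteq> T"
      "G holomorphic_on T" "w = G z"
      "\<forall>\<^sub>F u in nhds 0. G u = eval_fps (fps_hypergeo [a, b] [c] 1) u"
    by blast
  define D where "D = S \<inter> T"
  have op: "open D" and zD: "z \<in> D" using assms G by (auto simp: D_def)
  have star: "closed_segment 0 u \<subseteq> D" if "u \<in> D" for u
    using that assms(3) G(3) by (auto simp: D_def)
  have 0: "0 \<in> D" using star[OF zD] by auto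
  have "starlike D" unfolding starlike_def using 0 star by blast
  then have conn: "connected D" by (rule starlike_imp_connected)
  have "\<forall>\<^sub>F u in nhds 0. F u = G u \<and> u \<in> D"
    using assms(5) G(6) eventually_nhds_in_open[OF op 0] by eventually_elim auto
  then obtain U where U: "open U" "0 \<in> U" "\<And>u. u \<in> U \<Longrightarrow> F u = G u \<and> u \<in> D"
    unfolding eventually_nhds by blast
  have "F z = G z"
  proof (rule analytic_continuation_open[where s = U and s' = D and f = F and g = G])
    show "F holomorphic_on D" "G holomorphic_on D"
      using assms(4) G(4) by (auto simp: D_def intro: holomorphic_on_subset)
  qed (use U op conn zD in auto)
  then show "w = F z" using G by simp
qed

definition jacobi_rho :: "real \<Rightarrow> real \<Rightarrow> real" where
  "jacobi_rho \<alpha> \<beta> = \<alpha> + \<beta> + 1"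

definition jacobi_fun :: "real \<Rightarrow> real \<Rightarrow> complex \<Rightarrow> real \<Rightarrow> complex" where
  "jacobi_fun \<alpha> \<beta> l x =
     hyp2F1 ((of_real (jacobi_rho \<alpha> \<beta>) + \<i> * l) / 2) ((of_real (jacobi_rho \<alpha> \<beta>) - \<i> * l) / 2)
       (of_real (\<alpha> + 1)) (of_real (- (sinh x)\<^sup>2))"

definition opdam_G_generic :: "real \<Rightarrow> real \<Rightarrow> complex \<Rightarrow> real \<Rightarrow> complex" where
  "opdam_G_generic \<alpha> \<beta> l x = jacobi_fun \<alpha> \<beta> l x
     - 1 / (of_real (jacobi_rho \<alpha> \<beta>) - \<i> * l) * vector_derivative (jacobi_fun \<alpha> \<beta> l) (at x)"

definition opdam_G :: "real \<Rightarrow> real \<Rightarrow> complex \<Rightarrow> real \<Rightarrow> complex" where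
  "opdam_G \<alpha> \<beta> l x =
     (if l = - \<i> * of_real (jacobi_rho \<alpha> \<beta>) then Lim (at l) (\<lambda>m. opdam_G_generic \<alpha> \<beta> m x)
      else opdam_G_generic \<alpha> \<beta> l x)"

definition jacobi_weight :: "real \<Rightarrow> real \<Rightarrow> real \<Rightarrow> real" where
  "jacobi_weight \<alpha> \<beta> x = sinh x powr (2 * \<alpha> + 1) * cosh x powr (2 * \<beta> + 1)"

definition jacobi_mu :: "real \<Rightarrow> real \<Rightarrow> real measure" where
  "jacobi_mu \<alpha> \<beta> = density lborel (\<lambda>x. ennreal (jacobi_weight \<alpha> \<beta> \<bar>x\<bar>))"

definition cherednik_opdam :: "real \<Rightarrow> real \<Rightarrow> (real \<Rightarrow> complex) \<Rightarrow> complex \<Rightarrow> complex" where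
  "cherednik_opdam \<alpha> \<beta> f l = (LINT x|jacobi_mu \<alpha> \<beta>. f x * opdam_G \<alpha> \<beta> l (- x))"

definition jacobi_c :: "real \<Rightarrow> real \<Rightarrow> complex \<Rightarrow> complex" where
  "jacobi_c \<alpha> \<beta> l =
     Gamma (of_real (\<alpha> + 1)) * 2 powr (of_real (jacobi_rho \<alpha> \<beta>) - \<i> * l) * Gamma (\<i> * l)
     / (Gamma ((of_real (jacobi_rho \<alpha> \<beta>) + \<i> * l) / 2) * Gamma ((of_real (\<alpha> - \<beta> + 1) + \<i> * l) / 2))"

(* At the null point l = 0 the quotient is a totalised 0. *)
definition opdam_density :: "real \<Rightarrow> real \<Rightarrow> real \<Rightarrow> real \<Rightarrow> complex" where
  "opdam_density \<alpha> \<beta> k l =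
     of_real k * (1 - of_real (jacobi_rho \<alpha> \<beta>) / (\<i> * of_real l))
     / of_real (8 * pi * (cmod (jacobi_c \<alpha> \<beta> (of_real l)))\<^sup>2)"

definition test_function :: "(real \<Rightarrow> complex) \<Rightarrow> bool" where
  "test_function f \<longleftrightarrow>
     (\<forall>n. ((\<lambda>g x. vector_derivative g (at x)) ^^ n) f differentiable_on UNIV) \<and>
     compact (closure {x. f x \<noteq> 0})"

definition opdam_kappa :: "real \<Rightarrow> real \<Rightarrow> real" where
  "opdam_kappa \<alpha> \<beta> = (THE k. k > 0 \<and>
     (\<forall>f x. test_function f \<longrightarrow>
        has_bochner_integral lborel
          (\<lambda>l. cherednik_opdam \<alpha> \<beta> f (of_real l) * opdam_G \<alpha> \<beta> (of_real l) x * opdam_density \<alpha> \<beta> k l)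
          (f x)))"

(* The total variation measure of the complex measure nu. *)
definition opdam_nu_abs :: "real \<Rightarrow> real \<Rightarrow> real measure" where
  "opdam_nu_abs \<alpha> \<beta> =
     density lborel (\<lambda>l. ennreal (cmod (opdam_density \<alpha> \<beta> (opdam_kappa \<alpha> \<beta>) l)))"

definition Lp_norm :: "ennreal \<Rightarrow> 'a measure \<Rightarrow> ('a \<Rightarrow> complex) \<Rightarrow> ennreal" where
  "Lp_norm q M f =
     (if q = \<infinity> then esssup M (\<lambda>x. ennreal (cmod (f x)))
      else let I = (\<integral>\<^sup>+x. ennreal (cmod (f x) powr enn2real q) \<partial>M)
           in if I = \<infinity> then \<infinity> else ennreal (enn2real I powr (1 / enn2real q)))"

definition Lp_space :: "ennreal \<Rightarrow> 'a measure \<Rightarrow> ('a \<Rightarrow> complex) set" where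
  "Lp_space q M = {f \<in> borel_measurable M. Lp_norm q M f < \<infinity>}"

definition opdam_strip :: "real \<Rightarrow> real \<Rightarrow> real \<Rightarrow> complex set" where
  "opdam_strip \<alpha> \<beta> p = {l. \<bar>Im l\<bar> < (2 / p - 1) * jacobi_rho \<alpha> \<beta>}"

end

theory Submission
  imports Defs "HOL-Real_Asymp.Real_Asymp" "HOL-Probability.Probability"
begin

text \<open>On the strip, the system satisfied by \<open>\<phi>\<close> and \<open>\<phi>'\<close> is nearly triangular at infinity, and an
  energy argument gives \<open>\<bar>G\<^sub>l x\<bar> \<le> C exp (- s \<bar>x\<bar>)\<close> locally uniformly in \<open>l\<close>, for every
  \<open>s < \<rho> - \<bar>Im l\<bar>\<close>; since the volume grows like \<open>exp (2 \<rho> \<bar>x\<bar>)\<close>, this puts \<open>G\<^sub>l\<close> into \<open>L\<^sup>q\<close>, and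
  differentiation under the integral gives holomorphy. For real \<open>l\<close> the energy
  \<open>\<bar>\<phi>'\<bar>\<^sup>2 + (l\<^sup>2 + \<rho>\<^sup>2) \<bar>\<phi>\<bar>\<^sup>2\<close> decreases in \<open>x > 0\<close>, whence \<open>\<bar>G\<^sub>l\<bar> \<le> 2\<close>.

  The Hausdorff--Young inequality needs neither the inversion formula nor the value of \<open>\<kappa>\<close>. The
  frequencies \<open>\<bar>l\<bar> \<le> 1\<close> have finite \<open>\<bar>\<nu>\<bar>\<close>-measure and are covered by Hoelder. For \<open>\<bar>l\<bar> \<ge> 1\<close> the
  density of \<open>\<bar>\<nu>\<bar>\<close> is at most a multiple of \<open>\<bar>l\<bar> powr (2 \<alpha> + 1)\<close>, and Marcinkiewicz interpolation
  between \<open>L\<^sup>1 \<rightarrow> L\<^sup>\<infinity>\<close> and \<open>L\<^sup>2 \<rightarrow> L\<^sup>2\<close> applies. For the \<open>L\<^sup>2\<close> bound, \<open>u = sqrt A \<phi>\<close> solves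
  \<open>u'' = (V - l\<^sup>2) u\<close> with \<open>V = O(1 / x\<^sup>2)\<close>, so \<open>l powr (\<alpha> + 1/2) u\<close> is a combination of
  \<open>exp (\<plusminus> i l x)\<close> up to an error \<open>O(1 / (1 + l x))\<close>: the exponentials are handled by
  Plancherel's inequality and the error by Schur's test. The odd part of \<open>G\<^sub>l\<close> is a Jacobi
  function with parameters \<open>(\<alpha> + 1, \<beta> + 1)\<close>.\<close>

section \<open>The Gauss hypergeometric function\<close>

text \<open>The arguments \<open>- (sinh x)\<^sup>2\<close> leave the disc of convergence of the
  Gauss series. Pfaff's substitution z / (z - 1) maps the half-plane Re z < 1/2 into the unit disc,
  so one convergent series serves all x; the analysis in x then rests on the differential equation,
  and energy inequalities replace connection formulas and expansions at infinity. The
  \<open>L2\<close> bound must keep the exact power of l in the weight. The scale x = 1/l separates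
  two regimes: below it \<phi> is at most 1 and sqrt A is at most of order x powr (\<alpha> + 1/2);
  above it the potential integrates to O(l), which the factor 1/l of variation of constants absorbs.
  For l < 1 the scale 1/l lies where sqrt A grows exponentially, hence the separate low range. The
  same power must come out of the Plancherel density, where convexity of ln (1 + (y/t)^2) and the
  reflection formula replace Stirling's formula. The odd part of G carries an extra factor of size
  l, which is exactly what the shift from \<alpha> to \<alpha> + 1 compensates.\<close>

abbreviation gauss_fps :: "complex \<Rightarrow> complex \<Rightarrow> complex \<Rightarrow> complex fps" where
  "gauss_fps a b c \<equiv> fps_hypergeo [a, b] [c] 1"

lemma gauss_fps_nth:
  "fps_nth (gauss_fps a b c) n = pochhammer a n * pochhammer b n / (pochhammer c n * fact n)"
  by simp

lemma pochhammer_mono_real: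
  fixes x y :: real
  assumes "0 \<le> x" "x \<le> y"
  shows "pochhammer x n \<le> pochhammer y n"
  unfolding pochhammer_prod using assms by (intro prod_mono) auto

lemma norm_pochhammer_le: "norm (pochhammer (a::complex) n) \<le> pochhammer (norm a) n"
  unfolding pochhammer_prod prod_norm[symmetric]
  by (intro prod_mono) (auto intro: order_trans[OF norm_triangle_ineq])

text \<open>The coefficients of the Gauss series with both upper parameters M. They dominate those
  of all series with upper parameters of modulus at most M, which is the uniformity that holomorphy
  in the parameters requires.\<close>

definition gauss_majorant :: "real \<Rightarrow> real \<Rightarrow> nat \<Rightarrow> real" where
  "gauss_majorant M c n = pochhammer M n * pochhammer M n / (pochhammer c n * fact n)"

lemma norm_gauss_coeff_le:
  assumes "norm a \<le> M" "norm b \<le> M" "c > 0"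
  shows "norm (pochhammer a n * pochhammer b n / (pochhammer (complex_of_real c) n * fact n))
      \<le> gauss_majorant M c n"
proof -
  have M: "M \<ge> 0" using assms(1) norm_ge_zero[of a] by linarith
  have c: "norm (pochhammer (complex_of_real c) n) = pochhammer c n"
    using pochhammer_pos[OF \<open>c > 0\<close>, of n] by (simp add: pochhammer_of_real)
  have "norm (pochhammer a n) \<le> pochhammer M n" "norm (pochhammer b n) \<le> pochhammer M n"
    using assms norm_pochhammer_le pochhammer_mono_real norm_ge_zero order_trans by meson+
  then show ?thesis
    unfolding gauss_majorant_def norm_mult norm_divide c norm_fact
    using pochhammer_pos[OF \<open>c > 0\<close>, of n]
    by (intro divide_right_mono mult_mono) (auto intro: order_trans[OF norm_ge_zero])
qed

lemma summable_gauss_majorant: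
  assumes M: "M > 0" and c: "c > 0" and r: "0 \<le> r" "r < 1"
  shows "summable (\<lambda>n. gauss_majorant M c n * r ^ n)"
proof -
  obtain s where s: "r < s" "s < 1" using dense r by blast
  have "(\<lambda>n. (M + real n)\<^sup>2 * r / ((c + real n) * (1 + real n))) \<longlonglongrightarrow> r"
    using M c r by real_asymp
  then have "\<forall>\<^sub>F n in sequentially. (M + real n)\<^sup>2 * r / ((c + real n) * (1 + real n)) < s"
    by (rule order_tendstoD) (use s in auto)
  then obtain N where N: "\<And>n. n \<ge> N \<Longrightarrow> (M + real n)\<^sup>2 * r / ((c + real n) * (1 + real n)) < s"
    by (auto simp: eventually_sequentially)
  show ?thesis
  proof (rule summable_ratio_test[where c = s and N = N])
    fix n assume n: "n \<ge> N"
    have nn: "gauss_majorant M c n * r ^ n \<ge> 0"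
      unfolding gauss_majorant_def using M c r by (simp add: pochhammer_nonneg pochhammer_pos)
    have "gauss_majorant M c (Suc n) * r ^ Suc n
        = gauss_majorant M c n * r ^ n * ((M + real n)\<^sup>2 * r / ((c + real n) * (1 + real n)))"
      unfolding gauss_majorant_def pochhammer_Suc using c
      by (simp add: power2_eq_square mult_ac add_ac)
    also have "\<dots> \<le> gauss_majorant M c n * r ^ n * s"
      using N[OF n] nn by (intro mult_left_mono) auto
    finally show "norm (gauss_majorant M c (Suc n) * r ^ Suc n) \<le> s * norm (gauss_majorant M c n * r ^ n)"
      using nn M c r by (simp add: gauss_majorant_def pochhammer_nonneg mult_ac)
  qed (use s in auto)
qed

lemma gauss_conv_radius:
  assumes c: "c > 0"
  shows "fps_conv_radius (gauss_fps a b (of_real c)) \<ge> 1"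
  unfolding fps_conv_radius_def
proof (rule conv_radius_geI_ex')
  fix r :: real assume r: "0 < r" "ereal r < 1"
  define M where "M = max 1 (max (norm a) (norm b))"
  have M: "M > 0" "norm a \<le> M" "norm b \<le> M" by (auto simp: M_def)
  show "summable (\<lambda>n. fps_nth (gauss_fps a b (of_real c)) n * of_real r ^ n)"
  proof (rule summable_comparison_test'[OF summable_gauss_majorant[of M c r]])
    show "norm (fps_nth (gauss_fps a b (of_real c)) n * of_real r ^ n) \<le> gauss_majorant M c n * r ^ n" for n
      unfolding gauss_fps_nth norm_mult[of "_ / _"] 
      using norm_gauss_coeff_le[OF M(2,3) c, of n] r 
      by (intro mult_mono) (auto simp: norm_power intro: order_trans[OF norm_ge_zero])
  qed (use M c r in auto)
qed

text \<open>Checked coefficientwise: \<open>z / (z - 1)\<close> is \<open>- z\<close> times the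
  binomial series \<open>Q 1\<close>, its powers are again binomial series up to a monomial, and the
  coefficient of order m becomes a terminating sum that the Chu-Vandermonde identity
  evaluates.\<close>

lemma gauss_Pfaff_fps:
  assumes c: "c > 0"
  shows "(\<lambda>z. (1 - z) powr (- a) * eval_fps (gauss_fps a (of_real c - b) (of_real c)) (z / (z - 1)))
           has_fps_expansion gauss_fps a b (of_real c)"
proof -
  let ?c = "complex_of_real c"
  define H where "H = gauss_fps a (?c - b) ?c"
  \<comment> \<open>\<open>Q d\<close> is the expansion of (1 - z) powr (- d). The law
    \<open>Q d * Q e = Q (d + e)\<close> makes the powers of the inner series explicit.\<close>
  define Q where "Q = (\<lambda>d::complex. fps_binomial (- d) oo (- fps_X))"
  have Q_nth: "fps_nth (Q d) n = pochhammer d n / fact n" for d n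
  proof -
    have e: "(- fps_X) = fps_const (-1) * (fps_X :: complex fps)" by (simp add: fps_eq_iff)
    show ?thesis
      unfolding Q_def e fps_compose_linear by (simp add: gbinomial_pochhammer flip: power_mult_distrib)
  qed
  have Q_mult: "Q d * Q e = Q (d + e)" for d e
    unfolding Q_def by (subst fps_compose_mult_distrib[symmetric]) (auto simp flip: fps_binomial_add_mult)
  have Q_pow: "Q 1 ^ n = Q (of_nat n)" for n
    by (induction n) (simp_all add: Q_mult, simp add: fps_eq_iff Q_nth pochhammer_0_left)
  have expQ: "(\<lambda>z. (1 - z) powr (- d)) has_fps_expansion Q d" for d
  proof -
    have "((\<lambda>x. (1 + x) powr (- d)) \<circ> (\<lambda>z. - z)) has_fps_expansion Q d"
      unfolding Q_def by (intro has_fps_expansion_compose has_fps_expansion_binomial_complex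
        has_fps_expansion_minus has_fps_expansion_fps_X) auto
    then show ?thesis by (simp add: o_def)
  qed
  have "(\<lambda>z. - z * (1 - z) powr (- 1)) has_fps_expansion (- fps_X * Q 1)"
    by (intro has_fps_expansion_mult has_fps_expansion_minus has_fps_expansion_fps_X expQ)
  also have "?this \<longleftrightarrow> (\<lambda>z. z / (z - 1)) has_fps_expansion (- fps_X * Q 1)"
  proof (rule has_fps_expansion_cong)
    have "\<forall>\<^sub>F z in nhds 0. z \<in> ball (0::complex) 1" by (intro eventually_nhds_in_open) auto
    then show "\<forall>\<^sub>F z in nhds (0::complex). - z * (1 - z) powr (- 1) = z / (z - 1)"
    proof eventually_elim
      case (elim z)
      then have "z \<noteq> 1" by auto
      then have "(1 - z) powr (- 1) = inverse (1 - z)"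
        by (simp add: powr_minus)
      moreover have "z / (z - 1) = - z * inverse (1 - z)"
        using \<open>z \<noteq> 1\<close> by (simp add: field_simps)
      ultimately show ?case by simp
    qed
  qed auto
  finally have expg: "(\<lambda>z. z / (z - 1)) has_fps_expansion (- fps_X * Q 1)" .
  have "eval_fps H has_fps_expansion H"
    unfolding H_def
    by (intro eval_fps_has_fps_expansion less_le_trans[OF _ gauss_conv_radius[OF c]]) simp
  then have "(eval_fps H \<circ> (\<lambda>z. z / (z - 1))) has_fps_expansion (H oo (- fps_X * Q 1))"
    using expg by (intro has_fps_expansion_compose) auto
  then have main: "(\<lambda>z. (1 - z) powr (- a) * eval_fps H (z / (z - 1)))
      has_fps_expansion (Q a * (H oo (- fps_X * Q 1)))"
    by (intro has_fps_expansion_mult expQ) (simp add: o_def)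
  have nz: "pochhammer ?c n \<noteq> 0" for n
    using pochhammer_pos[OF c, of n] by (simp add: pochhammer_of_real)
  have "Q a * (H oo (- fps_X * Q 1)) = gauss_fps a b ?c"
  proof (rule fps_ext)
    fix m
    let ?g = "- fps_X * Q 1"
    have g0: "fps_nth ?g 0 = 0" by simp
    have pw: "?g ^ i = fps_const ((-1) ^ i) * (fps_X ^ i * Q (of_nat i))" for i
    proof -
      have "?g ^ i = (-1) ^ i * (fps_X ^ i * Q 1 ^ i)"
        using power_minus[of "fps_X * Q 1" i] by (simp add: power_mult_distrib mult_ac)
      also have "(-1) ^ i = fps_const ((-1::complex) ^ i)"
        by (simp flip: fps_const_power add: fps_const_neg)
      finally show ?thesis by (simp add: Q_pow)
    qed
    \<comment> \<open>The i-th power of the inner series starts at order i, so the inner sum may run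
      to m for every k; the index range becomes a square and the sums can be exchanged.\<close>
    have zero: "fps_nth (?g ^ i) k = 0" if "k < i" for i k
      unfolding pw using that by (simp add: fps_X_power_mult_nth)
    have "fps_nth (Q a * (H oo ?g)) m = (\<Sum>k=0..m. fps_nth (Q a) (m - k) * fps_nth (H oo ?g) k)"
      by (subst mult.commute, subst fps_mult_nth) (simp add: mult_ac)
    also have "\<dots> = (\<Sum>k=0..m. fps_nth (Q a) (m - k) * (\<Sum>i=0..m. fps_nth H i * fps_nth (?g ^ i) k))"
    proof (intro sum.cong refl arg_cong2[where f = "(*)"])
      fix k assume "k \<in> {0..m}"
      then show "fps_nth (H oo ?g) k = (\<Sum>i=0..m. fps_nth H i * fps_nth (?g ^ i) k)"
        unfolding fps_compose_nth by (intro sum.mono_neutral_left) (auto intro!: zero simp del: mult_minus_left)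
    qed
    also have "\<dots> = (\<Sum>i=0..m. fps_nth H i * (\<Sum>k=0..m. fps_nth (?g ^ i) k * fps_nth (Q a) (m - k)))"
      by (simp add: sum_distrib_left mult_ac) (rule sum.swap)
    also have "\<dots> = (\<Sum>i=0..m. fps_nth H i * fps_nth (?g ^ i * Q a) m)"
      by (simp add: fps_mult_nth)
    also have "\<dots> = (\<Sum>i=0..m. fps_nth H i * ((-1) ^ i * (pochhammer (a + of_nat i) (m - i) / fact (m - i))))"
    proof (intro sum.cong refl arg_cong2[where f = "(*)"])
      fix i assume i: "i \<in> {0..m}"
      have "?g ^ i * Q a = fps_const ((-1) ^ i) * (fps_X ^ i * Q (a + of_nat i))"
        unfolding pw using Q_mult[of "of_nat i" a] by (simp add: mult.assoc add.commute)
      then show "fps_nth (?g ^ i * Q a) m = (-1) ^ i * (pochhammer (a + of_nat i) (m - i) / fact (m - i))"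
        using i by (simp add: fps_X_power_mult_nth Q_nth)
    qed
    \<comment> \<open>The sign and the factor 1 / fact (m - i) are absorbed into the Pochhammer
      symbol of - m, which brings the sum to Chu-Vandermonde form.\<close>
    also have "\<dots> = (\<Sum>i=0..m. pochhammer a m / fact m * (pochhammer (?c - b) i * pochhammer (- of_nat m) i / (of_nat (fact i) * pochhammer ?c i)))"
    proof (intro sum.cong refl)
      fix i assume i: "i \<in> {0..m}"
      have p1: "pochhammer a m = pochhammer a i * pochhammer (a + of_nat i) (m - i)"
        using i by (intro pochhammer_product) auto
      have "of_nat (fact m) = of_nat (m choose i) * (of_nat (fact i) * of_nat (fact (m - i)) :: complex)"
        using binomial_fact_lemma[of i m] i by (metis atLeastAtMost_iff mult.commute of_nat_mult)
      then have p2': "fact m = of_nat (m choose i) * fact i * (fact (m - i) :: complex)" by simp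
      have "(of_nat m gchoose i) = (-1) ^ i * pochhammer (- of_nat m :: complex) i / fact i"
        by (rule gbinomial_pochhammer)
      then have "of_nat (m choose i) * fact i = (-1) ^ i * pochhammer (- of_nat m :: complex) i"
        by (simp add: binomial_gbinomial)
      then have p2: "pochhammer (- of_nat m :: complex) i = (-1) ^ i * (of_nat (m choose i) * fact i)"
        by (metis (no_types, lifting) mult.assoc mult_1 power_mult_distrib minus_one_mult_self power_one minus_mult_minus)
      show "fps_nth H i * ((-1) ^ i * (pochhammer (a + of_nat i) (m - i) / fact (m - i)))
         = pochhammer a m / fact m * (pochhammer (?c - b) i * pochhammer (- of_nat m) i / (of_nat (fact i) * pochhammer ?c i))"
        unfolding H_def gauss_fps_nth p1 p2 p2' using nz[of i] i
        by (simp add: divide_simps)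
    qed
    also have "\<dots> = pochhammer a m / fact m * (pochhammer b m / pochhammer ?c m)"
    proof (subst sum_distrib_left[symmetric], subst Vandermonde_pochhammer)
      show "\<forall>i\<in>{0..<m}. ?c \<noteq> - of_nat i"
      proof
        fix i assume "i \<in> {0..<m}"
        have "?c \<noteq> of_real (- real i)" unfolding of_real_eq_iff using c by linarith
        then show "?c \<noteq> - of_nat i" by simp
      qed
    qed simp
    also have "\<dots> = fps_nth (gauss_fps a b ?c) m" unfolding gauss_fps_nth by simp
    finally show "fps_nth (Q a * (H oo ?g)) m = fps_nth (gauss_fps a b ?c) m" .
  qed
  with main show ?thesis by (simp add: H_def)
qed

section \<open>Continuation of the Gauss series to a half-plane\<close>

lemma gauss_hol:
  assumes c: "c > 0"
  shows "eval_fps (gauss_fps a b (of_real c)) holomorphic_on ball 0 1"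
proof (rule holomorphic_on_eval_fps)
  show "ball 0 1 \<subseteq> eball 0 (fps_conv_radius (gauss_fps a b (of_real c)))"
    by (rule ball_eball_mono) (use gauss_conv_radius[OF c] in \<open>simp flip: one_ereal_def\<close>)
qed

text \<open>The points closer to 0 than to 1: there the transformed argument z / (z - 1) lies in the
  unit disc. The set contains every \<open>- (sinh x)\<^sup>2\<close> and, being convex, is
  star-shaped about 0.\<close>

definition gauss_domain :: "complex set" where
  "gauss_domain = {z. Re z < 1 / 2}"

lemma open_gauss_domain: "open gauss_domain"
  unfolding gauss_domain_def by (rule open_halfspace_Re_lt)

lemma zero_in_gauss_domain: "0 \<in> gauss_domain"
  by (simp add: gauss_domain_def)

lemma convex_gauss_domain: "convex gauss_domain"
  unfolding gauss_domain_def by (rule convex_halfspace_Re_lt)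

lemma gauss_domain_quotient: "z \<in> gauss_domain \<Longrightarrow> norm (z / (z - 1)) < 1"
proof -
  assume "z \<in> gauss_domain"
  then have z: "Re z < 1 / 2" by (simp add: gauss_domain_def)
  then have "z \<noteq> 1" by auto
  have "(norm z)\<^sup>2 < (norm (z - 1))\<^sup>2"
    unfolding cmod_power2 using z by (simp add: power2_eq_square algebra_simps)
  then have "norm z < norm (z - 1)" by (rule power2_less_imp_less) simp
  with \<open>z \<noteq> 1\<close> show ?thesis by (simp add: norm_divide)
qed

lemma one_notin_gauss_domain: "1 \<notin> gauss_domain"
  by (simp add: gauss_domain_def)

lemma gauss_domain_not_nonpos: "z \<in> gauss_domain \<Longrightarrow> 1 - z \<notin> \<real>\<^sub>\<le>\<^sub>0"
  by (auto simp: gauss_domain_def complex_nonpos_Reals_iff)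

text \<open>The right-hand side is holomorphic on the whole half-plane and has the Gauss series as
  its germ at 0, so \<open>hyp2F1_unique\<close> identifies it with the continuation.\<close>

lemma hyp2F1_Pfaff:
  assumes c: "c > 0" and z: "z \<in> gauss_domain"
  shows "hyp2F1 a b (of_real c) z =
    (1 - z) powr (- a) * eval_fps (gauss_fps a (of_real c - b) (of_real c)) (z / (z - 1))"
proof (rule hyp2F1_unique[OF open_gauss_domain z])
  fix u assume "u \<in> gauss_domain"
  then show "closed_segment 0 u \<subseteq> gauss_domain"
    using convex_contains_segment convex_gauss_domain zero_in_gauss_domain by blast
next
  have *: "(\<lambda>z. eval_fps (gauss_fps a (of_real c - b) (of_real c)) (z / (z - 1))) holomorphic_on gauss_domain"
    by (rule holomorphic_on_compose_gen[OF _ gauss_hol[OF c], unfolded o_def])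
       (use one_notin_gauss_domain in \<open>auto intro!: holomorphic_intros gauss_domain_quotient\<close>)
  show "(\<lambda>z. (1 - z) powr (- a) * eval_fps (gauss_fps a (of_real c - b) (of_real c)) (z / (z - 1)))
      holomorphic_on gauss_domain"
    by (intro holomorphic_intros *) (auto simp: gauss_domain_not_nonpos)
  show "\<forall>\<^sub>F u in nhds 0. (1 - u) powr (- a) * eval_fps (gauss_fps a (of_real c - b) (of_real c)) (u / (u - 1))
      = eval_fps (gauss_fps a b (of_real c)) u"
    using gauss_Pfaff_fps[OF c, of a b] by (auto simp: has_fps_expansion_def eq_commute)
qed

lemma hyp2F1_has_fps_expansion:
  assumes c: "c > 0"
  shows "hyp2F1 a b (of_real c) has_fps_expansion gauss_fps a b (of_real c)"
proof -
  have "\<forall>\<^sub>F z in nhds 0. z \<in> gauss_domain"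
    by (intro eventually_nhds_in_open open_gauss_domain zero_in_gauss_domain)
  then have "\<forall>\<^sub>F z in nhds 0. (1 - z) powr (- a) *
      eval_fps (gauss_fps a (of_real c - b) (of_real c)) (z / (z - 1)) = hyp2F1 a b (of_real c) z"
    by eventually_elim (simp add: hyp2F1_Pfaff[OF c])
  from has_fps_expansion_cong[OF this refl] gauss_Pfaff_fps[OF c, of a b] show ?thesis by simp
qed

lemma hyp2F1_holomorphic:
  assumes c: "c > 0"
  shows "hyp2F1 a b (of_real c) holomorphic_on gauss_domain"
proof -
  have *: "(\<lambda>z. eval_fps (gauss_fps a (of_real c - b) (of_real c)) (z / (z - 1))) holomorphic_on gauss_domain"
    by (rule holomorphic_on_compose_gen[OF _ gauss_hol[OF c], unfolded o_def])
       (use one_notin_gauss_domain in \<open>auto intro!: holomorphic_intros gauss_domain_quotient\<close>)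
  have "(\<lambda>z. (1 - z) powr (- a) * eval_fps (gauss_fps a (of_real c - b) (of_real c)) (z / (z - 1)))
      holomorphic_on gauss_domain"
    by (intro holomorphic_intros *) (auto simp: gauss_domain_not_nonpos)
  then show ?thesis
    by (rule holomorphic_transform) (simp add: hyp2F1_Pfaff[OF c])
qed

lemma hyp2F1_0: "c > 0 \<Longrightarrow> hyp2F1 a b (of_real c) 0 = 1"
  using has_fps_expansion_imp_0_eq_fps_nth_0[OF hyp2F1_has_fps_expansion] by fastforce

lemma hyp2F1_commute: "hyp2F1 a b c z = hyp2F1 b a c z"
proof -
  have "gauss_fps a b c = gauss_fps b a c" by (simp add: fps_eq_iff mult.commute)
  then show ?thesis unfolding hyp2F1_def by simp
qed

text \<open>Reduces identities between functions on the half-plane to identities between formal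
  power series; the derivative formula and the differential equation below are obtained this
  way.\<close>

lemma gauss_domain_eqI:
  assumes "f holomorphic_on gauss_domain" "g holomorphic_on gauss_domain"
    and "f has_fps_expansion F" "g has_fps_expansion F" "z \<in> gauss_domain"
  shows "f z = g z"
proof -
  have "\<forall>\<^sub>F z in nhds 0. f z = g z"
    using assms(3,4) by (auto simp: has_fps_expansion_def elim: eventually_elim2)
  then have "\<forall>\<^sub>F z in nhds 0. f z = g z \<and> z \<in> gauss_domain"
    using eventually_nhds_in_open[OF open_gauss_domain zero_in_gauss_domain]
    by eventually_elim auto
  then obtain U where U: "open U" "0 \<in> U" "\<And>u. u \<in> U \<Longrightarrow> f u = g u \<and> u \<in> gauss_domain"
    unfolding eventually_nhds by blast
  show ?thesis
    by (rule analytic_continuation_open[of U gauss_domain f g z])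
       (use U assms open_gauss_domain convex_connected[OF convex_gauss_domain] in auto)
qed

lemma hyp2F1_deriv:
  assumes c: "c > 0" and z: "z \<in> gauss_domain"
  shows "deriv (hyp2F1 a b (of_real c)) z = a * b / of_real c * hyp2F1 (a + 1) (b + 1) (of_real (c + 1)) z"
proof (rule gauss_domain_eqI[OF _ _ _ _ z])
  have c1: "c + 1 > 0" using c by simp
  have e: "fps_deriv (gauss_fps a b (of_real c)) =
      fps_const (a * b / of_real c) * gauss_fps (a + 1) (b + 1) (of_real (c + 1))"
  proof (rule fps_ext)
    fix n
    have "pochhammer (complex_of_real (c + 1)) n \<noteq> 0"
      using pochhammer_pos[OF c1, of n] unfolding pochhammer_of_real by simp
    moreover have "fact n + fact n * of_nat n \<noteq> (0 :: complex)"
      by (metis fact_Suc fact_nonzero mult.commute of_nat_Suc ring_class.ring_distribs(1) mult_1_right)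
    ultimately show "fps_nth (fps_deriv (gauss_fps a b (of_real c))) n =
      fps_nth (fps_const (a * b / of_real c) * gauss_fps (a + 1) (b + 1) (of_real (c + 1))) n"
      using c by (simp add: pochhammer_rec divide_simps del: of_nat_Suc) (simp add: algebra_simps)
  qed
  show "deriv (hyp2F1 a b (of_real c)) holomorphic_on gauss_domain"
    by (intro holomorphic_deriv hyp2F1_holomorphic c open_gauss_domain)
  show "(\<lambda>z. a * b / of_real c * hyp2F1 (a + 1) (b + 1) (of_real (c + 1)) z) holomorphic_on gauss_domain"
    by (intro holomorphic_intros hyp2F1_holomorphic c1)
  show "deriv (hyp2F1 a b (of_real c)) has_fps_expansion fps_deriv (gauss_fps a b (of_real c))"
    by (intro has_fps_expansion_deriv hyp2F1_has_fps_expansion c)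
  show "(\<lambda>z. a * b / of_real c * hyp2F1 (a + 1) (b + 1) (of_real (c + 1)) z) has_fps_expansion
      fps_deriv (gauss_fps a b (of_real c))"
    unfolding e by (intro has_fps_expansion_cmult_left hyp2F1_has_fps_expansion c1)
qed

text \<open>In terms of coefficients the equation is the two-term recurrence \<open>S\<close> of the
  Gauss series.\<close>

lemma hyp2F1_ode:
  fixes a b :: complex
  assumes c: "c > 0" and z: "z \<in> gauss_domain"
  defines "F \<equiv> hyp2F1 a b (of_real c)"
  shows "z * (1 - z) * deriv (deriv F) z + (of_real c - (a + b + 1) * z) * deriv F z = a * b * F z"
proof (rule gauss_domain_eqI[OF _ _ _ _ z])
  define P where "P = gauss_fps a b (of_real c)"
  have F: "F holomorphic_on gauss_domain" unfolding F_def by (intro hyp2F1_holomorphic c)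
  have FP: "F has_fps_expansion P" unfolding F_def P_def by (intro hyp2F1_has_fps_expansion c)
  have e: "fps_X * (1 - fps_X) * fps_deriv (fps_deriv P) +
      (fps_const (of_real c) - fps_const (a + b + 1) * fps_X) * fps_deriv P = fps_const (a * b) * P"
  proof (rule fps_ext)
    fix n
    have cn: "complex_of_real c + of_nat n \<noteq> 0"
      using c by (metis add_pos_nonneg of_nat_0_le_iff of_real_add of_real_eq_0_iff of_real_of_nat_eq less_irrefl)
    have nz: "pochhammer (complex_of_real c) n \<noteq> 0"
      using pochhammer_pos[OF c, of n] unfolding pochhammer_of_real by simp
    have S: "of_nat (Suc n) * (of_real c + of_nat n) * fps_nth P (Suc n) = (a + of_nat n) * (b + of_nat n) * fps_nth P n"
      unfolding P_def gauss_fps_nth pochhammer_Suc fact_Suc using nz cn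
      by (simp add: divide_simps del: of_nat_Suc)
    have "fps_nth (fps_X * (1 - fps_X) * fps_deriv (fps_deriv P) +
      (fps_const (of_real c) - fps_const (a + b + 1) * fps_X) * fps_deriv P) n
      = fps_nth (fps_X * fps_deriv (fps_deriv P)) n - fps_nth (fps_X * (fps_X * fps_deriv (fps_deriv P))) n
        + of_real c * fps_nth (fps_deriv P) n - (a + b + 1) * fps_nth (fps_X * fps_deriv P) n"
      by (simp add: algebra_simps)
    also have "fps_nth (fps_X * fps_deriv (fps_deriv P)) n = of_nat n * of_nat (Suc n) * fps_nth P (Suc n)"
      by (cases n) (simp_all del: of_nat_Suc)
    also have "fps_nth (fps_X * (fps_X * fps_deriv (fps_deriv P))) n = of_nat n * (of_nat n - 1) * fps_nth P n"
      by (cases n; cases "n - 1") auto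
    also have "fps_nth (fps_X * fps_deriv P) n = of_nat n * fps_nth P n"
      by (cases n) (simp_all del: of_nat_Suc)
    also have "fps_nth (fps_deriv P) n = of_nat (Suc n) * fps_nth P (Suc n)" by simp
    also have "of_nat n * of_nat (Suc n) * fps_nth P (Suc n) - of_nat n * (of_nat n - 1) * fps_nth P n +
       of_real c * (of_nat (Suc n) * fps_nth P (Suc n)) - (a + b + 1) * (of_nat n * fps_nth P n)
      = of_nat (Suc n) * (of_real c + of_nat n) * fps_nth P (Suc n) - of_nat n * (of_nat n + a + b) * fps_nth P n"
      by (simp add: algebra_simps)
    also have "\<dots> = fps_nth (fps_const (a * b) * P) n" unfolding S by (simp add: algebra_simps)
    finally show "fps_nth (fps_X * (1 - fps_X) * fps_deriv (fps_deriv P) +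
      (fps_const (of_real c) - fps_const (a + b + 1) * fps_X) * fps_deriv P) n = fps_nth (fps_const (a * b) * P) n" .
  qed
  show "(\<lambda>z. z * (1 - z) * deriv (deriv F) z + (of_real c - (a + b + 1) * z) * deriv F z) holomorphic_on gauss_domain"
    by (intro holomorphic_intros holomorphic_deriv F open_gauss_domain)
  show "(\<lambda>z. a * b * F z) holomorphic_on gauss_domain"
    by (intro holomorphic_intros F)
  show "(\<lambda>z. z * (1 - z) * deriv (deriv F) z + (of_real c - (a + b + 1) * z) * deriv F z)
      has_fps_expansion fps_const (a * b) * P"
    unfolding e[symmetric] by (intro fps_expansion_intros FP)
  show "(\<lambda>z. a * b * F z) has_fps_expansion fps_const (a * b) * P"
    by (intro fps_expansion_intros FP)
qed

text \<open>The Pfaff-transformed series is a locally uniform limit of entire functions of the parameters.\<close>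

lemma hyp2F1_holomorphic_param:
  assumes c: "c > 0" and z: "z \<in> gauss_domain"
    and A: "A holomorphic_on UNIV" and B: "B holomorphic_on UNIV"
  shows "(\<lambda>l. hyp2F1 (A l) (B l) (of_real c) z) holomorphic_on UNIV"
proof -
  define w where "w = z / (z - 1)"
  have w: "norm w < 1" unfolding w_def by (rule gauss_domain_quotient[OF z])
  let ?t = "\<lambda>n l. fps_nth (gauss_fps (A l) (of_real c - B l) (of_real c)) n * w ^ n"
  have nz: "pochhammer (complex_of_real c) n \<noteq> 0" for n
    using pochhammer_pos[OF c, of n] unfolding pochhammer_of_real by simp
  have "(\<lambda>l. eval_fps (gauss_fps (A l) (of_real c - B l) (of_real c)) w) holomorphic_on UNIV"
  proof (rule holomorphic_uniform_sequence[where f = "\<lambda>N l. \<Sum>n<N. ?t n l"])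
    fix N
    show "(\<lambda>l. \<Sum>n<N. ?t n l) holomorphic_on UNIV"
      unfolding gauss_fps_nth pochhammer_prod
      using nz by (intro holomorphic_intros A B) (auto simp: pochhammer_prod)
  next
    fix x :: complex
    have "compact (A ` cball x 1)" "compact (B ` cball x 1)"
      using A B by (auto intro!: compact_continuous_image holomorphic_on_imp_continuous_on
          intro: holomorphic_on_subset)
    then obtain M1 M2 where "\<And>l. l \<in> cball x 1 \<Longrightarrow> norm (A l) \<le> M1" "\<And>l. l \<in> cball x 1 \<Longrightarrow> norm (B l) \<le> M2"
      by (metis (no_types, lifting) bounded_iff compact_imp_bounded image_eqI)
    \<comment> \<open>One bound on the unit disc about \<open>x\<close> for both upper parameters
      \<open>A l\<close> and \<open>c - B l\<close> of the transformed series.\<close>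
    moreover define M where "M = 1 + \<bar>c\<bar> + \<bar>M1\<bar> + \<bar>M2\<bar>"
    moreover have "norm (of_real c - B l) \<le> \<bar>c\<bar> + norm (B l)" for l
      by (rule order_trans[OF norm_triangle_ineq4]) simp
    ultimately have M: "M > 0" "\<And>l. l \<in> cball x 1 \<Longrightarrow> norm (A l) \<le> M"
      "\<And>l. l \<in> cball x 1 \<Longrightarrow> norm (of_real c - B l) \<le> M"
      by (auto simp: M_def) (smt (verit, best))+
    have "uniform_limit (cball x 1) (\<lambda>N l. \<Sum>n<N. ?t n l) (\<lambda>l. suminf (\<lambda>n. ?t n l)) sequentially"
    proof (rule Weierstrass_m_test)
      show "summable (\<lambda>n. gauss_majorant M c n * norm w ^ n)"
        by (rule summable_gauss_majorant) (use M c w in auto)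
      show "norm (?t n l) \<le> gauss_majorant M c n * norm w ^ n" if "l \<in> cball x 1" for n l
        unfolding gauss_fps_nth norm_mult[of "_ / _"] norm_power
        by (intro mult_right_mono norm_gauss_coeff_le M that c) auto
    qed
    then show "\<exists>d>0. cball x d \<subseteq> UNIV \<and> uniform_limit (cball x d) (\<lambda>N l. \<Sum>n<N. ?t n l)
        (\<lambda>l. eval_fps (gauss_fps (A l) (of_real c - B l) (of_real c)) w) sequentially"
      unfolding eval_fps_def by (intro exI[of _ 1]) auto
  qed auto
  moreover have "1 - z \<noteq> 0" using z by (auto simp: gauss_domain_def)
  ultimately show ?thesis
    unfolding hyp2F1_Pfaff[OF c z] w_def[symmetric] powr_def
    using A by (auto intro!: holomorphic_intros)
qed

section \<open>Jacobi functions\<close>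

text \<open>Closed form of the derivative of \<open>jacobi_fun\<close> in x: differentiating the
  Gauss series raises its three parameters by 1, which is the passage to (\<alpha> + 1, \<beta> +
  1). In this form oddness in x and holomorphy in l are visible, and the odd part of G is ready for
  a second use of the same estimates.\<close>

definition jacobi_fun' :: "real \<Rightarrow> real \<Rightarrow> complex \<Rightarrow> real \<Rightarrow> complex" where
  "jacobi_fun' \<alpha> \<beta> l x = - of_real (sinh (2 * x) / (4 * (\<alpha> + 1)))
     * (of_real ((jacobi_rho \<alpha> \<beta>)\<^sup>2) + l\<^sup>2) * jacobi_fun (\<alpha> + 1) (\<beta> + 1) l x"

text \<open>Logarithmic derivative A'/A of the weight.\<close>

definition jacobi_drift :: "real \<Rightarrow> real \<Rightarrow> real \<Rightarrow> real" where
  "jacobi_drift \<alpha> \<beta> x = (2 * \<alpha> + 1) * (cosh x / sinh x) + (2 * \<beta> + 1) * (sinh x / cosh x)"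

lemma neg_sinh_sq_in_gauss_domain: "complex_of_real (- (sinh x)\<^sup>2) \<in> gauss_domain"
proof -
  have "- (sinh x)\<^sup>2 < (1 / 2 :: real)" using zero_le_power2[of "sinh x"] by linarith
  then show ?thesis unfolding gauss_domain_def by (simp only: mem_Collect_eq Re_complex_of_real)
qed

lemma jacobi_param_mult:
  "((of_real r + \<i> * l) / 2) * ((of_real r - \<i> * l) / 2) = (of_real (r\<^sup>2) + l\<^sup>2) / (4::complex)"
  by (simp add: field_simps power2_eq_square)

lemma jacobi_fun_uminus: "jacobi_fun \<alpha> \<beta> (- l) x = jacobi_fun \<alpha> \<beta> l x"
  unfolding jacobi_fun_def by (subst hyp2F1_commute) simp

lemma jacobi_fun_even: "jacobi_fun \<alpha> \<beta> l (- x) = jacobi_fun \<alpha> \<beta> l x"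
  by (simp add: jacobi_fun_def)

lemma jacobi_fun'_odd: "jacobi_fun' \<alpha> \<beta> l (- x) = - jacobi_fun' \<alpha> \<beta> l x"
  by (simp add: jacobi_fun'_def jacobi_fun_even)

lemma jacobi_fun_0: "\<alpha> > -1 \<Longrightarrow> jacobi_fun \<alpha> \<beta> l 0 = 1"
  unfolding jacobi_fun_def by (simp del: of_real_add add: hyp2F1_0)

lemma jacobi_fun'_0: "jacobi_fun' \<alpha> \<beta> l 0 = 0"
  by (simp add: jacobi_fun'_def)

context
  fixes \<alpha> \<beta> :: real and l :: complex and F :: "complex \<Rightarrow> complex"
  assumes al: "\<alpha> > -1"
  defines "F \<equiv> hyp2F1 ((of_real (jacobi_rho \<alpha> \<beta>) + \<i> * l) / 2) ((of_real (jacobi_rho \<alpha> \<beta>) - \<i> * l) / 2) (of_real (\<alpha> + 1))"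
begin

lemma F_hol: "F holomorphic_on gauss_domain"
  unfolding F_def using al by (intro hyp2F1_holomorphic) simp

lemma jacobi_fun_eq: "jacobi_fun \<alpha> \<beta> l x = F (of_real (- (sinh x)\<^sup>2))"
  by (simp add: jacobi_fun_def F_def)

lemma jacobi_fun'_eq:
  "jacobi_fun' \<alpha> \<beta> l x = of_real (- 2 * sinh x * cosh x) * deriv F (of_real (- (sinh x)\<^sup>2))"
proof -
  let ?r = "complex_of_real (jacobi_rho \<alpha> \<beta>)"
  have 1: "(?r + \<i> * l) / 2 + 1 = (of_real (jacobi_rho (\<alpha> + 1) (\<beta> + 1)) + \<i> * l) / 2"
    and 2: "(?r - \<i> * l) / 2 + 1 = (of_real (jacobi_rho (\<alpha> + 1) (\<beta> + 1)) - \<i> * l) / 2"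
    by (simp_all add: jacobi_rho_def field_simps)
  have D: "deriv F (of_real (- (sinh x)\<^sup>2)) = (?r + \<i> * l) / 2 * ((?r - \<i> * l) / 2) / of_real (\<alpha> + 1) *
      jacobi_fun (\<alpha> + 1) (\<beta> + 1) l x"
    unfolding F_def jacobi_fun_def 1[symmetric] 2[symmetric]
    by (rule hyp2F1_deriv[OF _ neg_sinh_sq_in_gauss_domain]) (use al in simp)
  have "complex_of_real (\<alpha> + 1) \<noteq> 0" unfolding of_real_eq_0_iff using al by simp
  then show ?thesis unfolding D unfolding jacobi_param_mult jacobi_fun'_def sinh_double
      of_real_divide of_real_mult of_real_minus of_real_numeral
    by (simp add: divide_simps del: of_real_add)
qed

lemma compose_sinh_sq:
  assumes "H holomorphic_on gauss_domain"
  shows "((\<lambda>x. H (of_real (- (sinh x)\<^sup>2))) has_vector_derivative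
     of_real (- 2 * sinh x * cosh x) * deriv H (of_real (- (sinh x)\<^sup>2))) (at x)"
proof -
  have "((\<lambda>x. complex_of_real (- (sinh x)\<^sup>2)) has_vector_derivative of_real (- 2 * sinh x * cosh x)) (at x)"
    by (rule has_vector_derivative_of_real) (auto intro!: derivative_eq_intros simp: has_real_derivative_iff_has_vector_derivative[symmetric])
  moreover have "(H has_field_derivative deriv H (of_real (- (sinh x)\<^sup>2))) (at (of_real (- (sinh x)\<^sup>2)))"
    using assms open_gauss_domain neg_sinh_sq_in_gauss_domain by (intro holomorphic_derivI)
  ultimately show ?thesis
    using field_vector_diff_chain_at by (fastforce simp: o_def)
qed

lemma jacobi_fun_has_vector_derivative_aux:
  "(jacobi_fun \<alpha> \<beta> l has_vector_derivative jacobi_fun' \<alpha> \<beta> l x) (at x)"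
  using compose_sinh_sq[OF F_hol, of x] unfolding jacobi_fun_eq[abs_def] jacobi_fun'_eq .

text \<open>The hypergeometric equation after the substitution z = - (sinh x)^2, that is \<phi>'' +
  drift \<phi>' + (\<rho>^2 + l^2) \<phi> = 0. The point 0 is excluded because of the pole of
  coth.\<close>

lemma jacobi_fun'_has_vector_derivative_aux:
  assumes "x \<noteq> 0"
  shows "(jacobi_fun' \<alpha> \<beta> l has_vector_derivative
    - of_real (jacobi_drift \<alpha> \<beta> x) * jacobi_fun' \<alpha> \<beta> l x
    - (of_real ((jacobi_rho \<alpha> \<beta>)\<^sup>2) + l\<^sup>2) * jacobi_fun \<alpha> \<beta> l x) (at x)"
proof -
  let ?s = "complex_of_real (sinh x)" and ?c = "complex_of_real (cosh x)" and ?z = "complex_of_real (- (sinh x)\<^sup>2)"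
  let ?r = "complex_of_real (jacobi_rho \<alpha> \<beta>)"
  have cs: "?c\<^sup>2 = ?s\<^sup>2 + 1"
    unfolding of_real_power[symmetric] cosh_square_eq by simp
  have ode: "?z * (1 - ?z) * deriv (deriv F) ?z + (of_real (\<alpha> + 1) - (?r + 1) * ?z) * deriv F ?z = (?r\<^sup>2 + l\<^sup>2) / 4 * F ?z"
    using hyp2F1_ode[OF _ neg_sinh_sq_in_gauss_domain[of x], where c = "\<alpha> + 1" and a = "(?r + \<i> * l) / 2" and b = "(?r - \<i> * l) / 2"] al
    unfolding F_def[symmetric] jacobi_param_mult by (simp add: add_divide_distrib[symmetric])
  have "(jacobi_fun' \<alpha> \<beta> l has_vector_derivative
     of_real (- 2 * sinh x * cosh x) * (of_real (- 2 * sinh x * cosh x) * deriv (deriv F) ?z) +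
     of_real (- 2 * (cosh x * cosh x + sinh x * sinh x)) * deriv F ?z) (at x)"
    unfolding jacobi_fun'_eq[abs_def]
  proof (rule has_vector_derivative_mult)
    show "((\<lambda>x. complex_of_real (- 2 * sinh x * cosh x)) has_vector_derivative of_real (- 2 * (cosh x * cosh x + sinh x * sinh x))) (at x)"
      by (rule has_vector_derivative_of_real)
        (auto intro!: derivative_eq_intros simp: has_real_derivative_iff_has_vector_derivative[symmetric] algebra_simps)
    show "((\<lambda>x. deriv F (of_real (- (sinh x)\<^sup>2))) has_vector_derivative of_real (- 2 * sinh x * cosh x) * deriv (deriv F) ?z) (at x)"
      by (intro compose_sinh_sq holomorphic_deriv F_hol open_gauss_domain)
  qed
  moreover have "of_real (- 2 * sinh x * cosh x) * (of_real (- 2 * sinh x * cosh x) * deriv (deriv F) ?z) +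
     of_real (- 2 * (cosh x * cosh x + sinh x * sinh x)) * deriv F ?z =
    - of_real (jacobi_drift \<alpha> \<beta> x) * jacobi_fun' \<alpha> \<beta> l x
    - (of_real ((jacobi_rho \<alpha> \<beta>)\<^sup>2) + l\<^sup>2) * jacobi_fun \<alpha> \<beta> l x" (is "?L = ?R")
  proof -
    have s0: "?s \<noteq> 0" "?c \<noteq> 0" using assms by auto
    have c2: "?c * ?c = ?s * ?s + 1" using cs by (simp add: power2_eq_square)
    define d1 d2 where "d1 = deriv F ?z" and "d2 = deriv (deriv F) ?z"
    have z: "?z = - (?s * ?s)" by (simp add: power2_eq_square)
    have r: "?r = of_real \<alpha> + of_real \<beta> + 1" by (simp add: jacobi_rho_def)
    have "of_real (jacobi_drift \<alpha> \<beta> x) * jacobi_fun' \<alpha> \<beta> l x =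
        - 2 * ((2 * of_real \<alpha> + 1) * (?c * ?c) + (2 * of_real \<beta> + 1) * (?s * ?s)) * d1"
      unfolding jacobi_drift_def jacobi_fun'_eq d1_def using s0 by (simp add: field_simps)
    moreover have "(of_real ((jacobi_rho \<alpha> \<beta>)\<^sup>2) + l\<^sup>2) * jacobi_fun \<alpha> \<beta> l x =
       4 * (- (?s * ?s) * (1 + ?s * ?s) * d2 + (of_real \<alpha> + 1 + (of_real \<alpha> + of_real \<beta> + 2) * (?s * ?s)) * d1)"
      using ode unfolding jacobi_fun_eq of_real_power[of "jacobi_rho \<alpha> \<beta>"] d1_def[symmetric] d2_def[symmetric] unfolding r z
      by simp (simp add: algebra_simps)
    moreover have "?L = 4 * ((?s * ?s) * (?c * ?c)) * d2 - 2 * (?c * ?c + ?s * ?s) * d1"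
      unfolding d1_def d2_def by (simp add: algebra_simps)
    ultimately show ?thesis unfolding c2 by (simp only: minus_mult_left[symmetric]) (simp add: algebra_simps)
  qed
  ultimately show ?thesis by simp
qed

end

lemmas jacobi_fun_has_vector_derivative = jacobi_fun_has_vector_derivative_aux
lemmas jacobi_fun'_has_vector_derivative = jacobi_fun'_has_vector_derivative_aux

lemma vector_derivative_jacobi_fun:
  "\<alpha> > -1 \<Longrightarrow> vector_derivative (jacobi_fun \<alpha> \<beta> l) (at x) = jacobi_fun' \<alpha> \<beta> l x"
  by (rule vector_derivative_at) (rule jacobi_fun_has_vector_derivative)

lemma jacobi_fun_holomorphic: "\<alpha> > -1 \<Longrightarrow> (\<lambda>l. jacobi_fun \<alpha> \<beta> l x) holomorphic_on UNIV"
  unfolding jacobi_fun_def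
  by (intro hyp2F1_holomorphic_param neg_sinh_sq_in_gauss_domain holomorphic_intros) auto

lemma jacobi_fun'_holomorphic: "\<alpha> > -1 \<Longrightarrow> (\<lambda>l. jacobi_fun' \<alpha> \<beta> l x) holomorphic_on UNIV"
  unfolding jacobi_fun'_def by (intro holomorphic_intros jacobi_fun_holomorphic) auto

lemma continuous_on_jacobi_fun: "\<alpha> > -1 \<Longrightarrow> continuous_on A (jacobi_fun \<alpha> \<beta> l)"
  using jacobi_fun_has_vector_derivative
  by (meson continuous_at_imp_continuous_on has_vector_derivative_continuous)

lemma continuous_on_jacobi_fun': "\<alpha> > -1 \<Longrightarrow> continuous_on A (jacobi_fun' \<alpha> \<beta> l)"
  unfolding jacobi_fun'_def by (intro continuous_intros continuous_on_jacobi_fun) auto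

lemma opdam_G_eq:
  assumes "\<alpha> > -1" "l \<noteq> - \<i> * of_real (jacobi_rho \<alpha> \<beta>)"
  shows "opdam_G \<alpha> \<beta> l x = jacobi_fun \<alpha> \<beta> l x - jacobi_fun' \<alpha> \<beta> l x / (of_real (jacobi_rho \<alpha> \<beta>) - \<i> * l)"
  using assms by (simp add: opdam_G_def opdam_G_generic_def vector_derivative_jacobi_fun)

section \<open>Energy estimates\<close>

lemma has_real_derivative_norm_sq:
  fixes f :: "real \<Rightarrow> 'a::real_inner"
  assumes "(f has_vector_derivative f') (at x)"
  shows "((\<lambda>x. (norm (f x))\<^sup>2) has_real_derivative 2 * (f x \<bullet> f')) (at x)"
proof -
  have "((\<lambda>x. f x \<bullet> f x) has_derivative (\<lambda>h. f x \<bullet> (h *\<^sub>R f') + (h *\<^sub>R f') \<bullet> f x)) (at x)"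
    using assms unfolding has_vector_derivative_def by (intro has_derivative_inner)
  then show ?thesis
    unfolding has_field_derivative_def power2_norm_eq_inner
    by (rule has_derivative_eq_rhs) (auto simp: inner_commute algebra_simps)
qed

lemma gronwall_real:
  fixes f :: "real \<Rightarrow> real"
  assumes "a \<le> b" "continuous_on {a..b} f"
    and "\<And>x. a < x \<Longrightarrow> x < b \<Longrightarrow> (f has_real_derivative f' x) (at x)"
    and "\<And>x. a < x \<Longrightarrow> x < b \<Longrightarrow> f' x \<le> k * f x"
  shows "f b \<le> f a * exp (k * (b - a))"
proof (cases "a = b")
  case False
  then have "a < b" using assms by simp
  have "f b * exp (- k * b) \<le> f a * exp (- k * a)"
  proof (rule DERIV_nonpos_imp_decreasing_open[OF \<open>a \<le> b\<close>])
    fix x assume x: "a < x" "x < b"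
    have "((\<lambda>x. f x * exp (- k * x)) has_real_derivative (f' x - k * f x) * exp (- k * x)) (at x)"
      by (rule derivative_eq_intros assms(3)[OF x] refl)+ (simp add: algebra_simps)
    moreover have "(f' x - k * f x) * exp (- k * x) \<le> 0"
      using assms(4)[OF x] by (intro mult_nonpos_nonneg) auto
    ultimately show "\<exists>y. ((\<lambda>x. f x * exp (- k * x)) has_real_derivative y) (at x) \<and> y \<le> 0" by blast
  qed (intro continuous_intros assms)
  then have "f b * exp (- k * b) * exp (k * b) \<le> f a * exp (- k * a) * exp (k * b)"
    by (intro mult_right_mono) auto
  then show ?thesis by (simp add: mult.assoc flip: exp_add) (simp add: algebra_simps)
qed simp

lemma coth_minus_one_le:
  fixes x :: real
  assumes "x > 0"
  shows "0 \<le> cosh x / sinh x - 1" "cosh x / sinh x - 1 \<le> 1 / (x * (1 + x))"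
proof -
  have s: "sinh x > 0" using assms by simp
  have "cosh x / sinh x - 1 = exp (- x) / sinh x"
    using s by (simp add: field_simps sinh_def cosh_def)
  also have "\<dots> = 2 / (exp (2 * x) - 1)"
  proof -
    have "exp (2 * x) = exp x * exp x" by (simp flip: exp_add)
    then show ?thesis using assms unfolding sinh_def by (simp add: field_simps exp_minus)
  qed
  finally have e: "cosh x / sinh x - 1 = 2 / (exp (2 * x) - 1)" .
  have "exp (2 * x) \<ge> 1 + 2 * x + (2 * x)\<^sup>2 / 2"
    using exp_lower_Taylor_quadratic[of "2 * x"] assms by simp
  then have "exp (2 * x) - 1 \<ge> 2 * (x * (1 + x))" by (simp add: power2_eq_square algebra_simps)
  moreover have y: "x * (1 + x) > 0" using assms by simp
  ultimately show "0 \<le> cosh x / sinh x - 1" "cosh x / sinh x - 1 \<le> 1 / (x * (1 + x))"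
    unfolding e using frac_le[of 2 2 "2 * (x * (1 + x))" "exp (2 * x) - 1"]
    using assms by (simp_all add: mult_divide_mult_cancel_left)
qed

text \<open>Since 2 sinh cosh \<le> sinh^2 + cosh^2, that is tanh + coth \<ge> 2, the bound for coth
  serves for tanh as well.\<close>

lemma one_minus_tanh_le:
  fixes x :: real
  assumes "x > 0"
  shows "0 \<le> 1 - sinh x / cosh x" "1 - sinh x / cosh x \<le> 1 / (x * (1 + x))"
proof -
  have s: "sinh x > 0" "cosh x > 0" using assms by auto
  show "0 \<le> 1 - sinh x / cosh x" using sinh_le_cosh_real[of x] s by simp
  have "1 - sinh x / cosh x \<le> cosh x / sinh x - 1"
  proof -
    have "2 * (sinh x * cosh x) \<le> cosh x * cosh x + sinh x * sinh x"
      using sum_squares_bound[of "sinh x" "cosh x"] by (simp add: power2_eq_square algebra_simps)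
    then show ?thesis using s by (simp add: field_simps)
  qed
  then show "1 - sinh x / cosh x \<le> 1 / (x * (1 + x))" using coth_minus_one_le(2)[OF assms] by linarith
qed

text \<open>The strict inequality \<open>alpha\<close> is what \<alpha> \<ge> \<beta> \<ge> - 1/2
  and \<alpha> \<noteq> - 1/2 amount to; it gives \<rho> > 0. The parameters form a locale because
  the \<open>L2\<close> estimates are instantiated a second time at (\<alpha> + 1, \<beta> +
  1).\<close>

locale jacobi_params =
  fixes \<alpha> \<beta> :: real
  assumes beta: "\<beta> \<ge> - 1 / 2" and alpha_beta: "\<alpha> \<ge> \<beta>" and alpha: "\<alpha> > - 1 / 2"
begin

abbreviation "\<rho> \<equiv> jacobi_rho \<alpha> \<beta>"
abbreviation "\<phi> \<equiv> jacobi_fun \<alpha> \<beta>"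
abbreviation "\<phi>' \<equiv> jacobi_fun' \<alpha> \<beta>"
abbreviation "drift \<equiv> jacobi_drift \<alpha> \<beta>"

lemma alpha1: "\<alpha> > -1" using alpha by simp

lemma rho_pos: "\<rho> > 0" using beta alpha by (simp add: jacobi_rho_def)

lemma two_rho: "2 * \<rho> = (2 * \<alpha> + 1) + (2 * \<beta> + 1)" by (simp add: jacobi_rho_def)

lemma phi_deriv: "(\<phi> l has_vector_derivative \<phi>' l x) (at x)"
  by (rule jacobi_fun_has_vector_derivative[OF alpha1])

lemma phi'_deriv: "x > 0 \<Longrightarrow> (\<phi>' l has_vector_derivative
    - of_real (drift x) * \<phi>' l x - (of_real (\<rho>\<^sup>2) + l\<^sup>2) * \<phi> l x) (at x)"
  by (rule jacobi_fun'_has_vector_derivative[OF alpha1]) simp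

lemma cont_phi: "continuous_on A (\<phi> l)" and cont_phi': "continuous_on A (\<phi>' l)"
  using continuous_on_jacobi_fun[OF alpha1] continuous_on_jacobi_fun'[OF alpha1] by auto

lemma phi_0: "\<phi> l 0 = 1" by (rule jacobi_fun_0[OF alpha1])

lemma drift_nonneg: "x > 0 \<Longrightarrow> drift x \<ge> 0"
  unfolding jacobi_drift_def using alpha beta
  by (intro add_nonneg_nonneg[of "(2 * \<alpha> + 1) * _"] mult_nonneg_nonneg) auto

text \<open>One expression records both the simple pole at 0 and a decay of order x^(-2) at
  infinity; both are needed for the bound x^(-2) on \<open>pot\<close>.\<close>

lemma drift_diff:
  assumes "x > 0"
  shows "\<bar>drift x - 2 * \<rho>\<bar> \<le> 2 * \<rho> / (x * (1 + x))"
proof -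
  let ?c = "cosh x / sinh x - 1" and ?t = "1 - sinh x / cosh x"
  have "drift x - 2 * \<rho> = (2 * \<alpha> + 1) * ?c - (2 * \<beta> + 1) * ?t"
    unfolding jacobi_drift_def two_rho by (simp add: algebra_simps)
  also have "\<bar>\<dots>\<bar> \<le> \<bar>(2 * \<alpha> + 1) * ?c\<bar> + \<bar>(2 * \<beta> + 1) * ?t\<bar>" by linarith
  also have "\<dots> = (2 * \<alpha> + 1) * ?c + (2 * \<beta> + 1) * ?t"
    unfolding abs_mult using coth_minus_one_le[OF assms] one_minus_tanh_le[OF assms] alpha beta by simp
  also have "\<dots> \<le> (2 * \<alpha> + 1) * (1 / (x * (1 + x))) + (2 * \<beta> + 1) * (1 / (x * (1 + x)))"
    using coth_minus_one_le[OF assms] one_minus_tanh_le[OF assms] alpha beta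
    by (intro add_mono mult_left_mono) auto
  also have "\<dots> = 2 * \<rho> / (x * (1 + x))" unfolding two_rho by (simp add: add_divide_distrib)
  finally show ?thesis .
qed

text \<open>For real l the coefficient l^2 + \<rho>^2 is real, so the cross terms cancel and the
  energy changes only by the damping term - 2 drift |\<phi>'|^2. Its value at 0 is l^2 +
  \<rho>^2.\<close>

lemma energy_real:
  assumes "x \<ge> 0"
  shows "(norm (\<phi>' (of_real l) x))\<^sup>2 + (l\<^sup>2 + \<rho>\<^sup>2) * (norm (\<phi> (of_real l) x))\<^sup>2 \<le> l\<^sup>2 + \<rho>\<^sup>2"
proof -
  let ?l = "complex_of_real l"
  let ?E = "\<lambda>x. (norm (\<phi>' ?l x))\<^sup>2 + (l\<^sup>2 + \<rho>\<^sup>2) * (norm (\<phi> ?l x))\<^sup>2"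
  have "?E x \<le> ?E 0"
  proof (rule DERIV_nonpos_imp_decreasing_open[OF assms])
    fix y assume y: "0 < y" "y < x"
    have K: "of_real (\<rho>\<^sup>2) + ?l\<^sup>2 = of_real (l\<^sup>2 + \<rho>\<^sup>2)" by simp
    have "(?E has_real_derivative 2 * (\<phi>' ?l y \<bullet> (- of_real (drift y) * \<phi>' ?l y - (of_real (\<rho>\<^sup>2) + ?l\<^sup>2) * \<phi> ?l y))
        + (l\<^sup>2 + \<rho>\<^sup>2) * (2 * (\<phi> ?l y \<bullet> \<phi>' ?l y))) (at y)"
      by (intro DERIV_add DERIV_cmult has_real_derivative_norm_sq phi_deriv phi'_deriv y)
    also have "2 * (\<phi>' ?l y \<bullet> (- of_real (drift y) * \<phi>' ?l y - (of_real (\<rho>\<^sup>2) + ?l\<^sup>2) * \<phi> ?l y))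
        + (l\<^sup>2 + \<rho>\<^sup>2) * (2 * (\<phi> ?l y \<bullet> \<phi>' ?l y)) = - 2 * drift y * (norm (\<phi>' ?l y))\<^sup>2"
      unfolding K of_real_minus[symmetric] scaleR_conv_of_real[symmetric] power2_norm_eq_inner
      by (simp add: inner_diff_right inner_commute algebra_simps)
    finally show "\<exists>d. (?E has_real_derivative d) (at y) \<and> d \<le> 0"
      using drift_nonneg[of y] y by (intro exI conjI) (auto intro!: mult_nonneg_nonneg)
  qed (intro continuous_intros cont_phi cont_phi')
  also have "\<dots> = l\<^sup>2 + \<rho>\<^sup>2" by (simp add: phi_0 jacobi_fun'_0)
  finally show ?thesis .
qed

lemma phi_real_le: "x \<ge> 0 \<Longrightarrow> norm (\<phi> (of_real l) x) \<le> 1"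
proof -
  assume "x \<ge> 0"
  have p: "l\<^sup>2 + \<rho>\<^sup>2 > 0" using rho_pos by (simp add: add_nonneg_pos)
  have "(l\<^sup>2 + \<rho>\<^sup>2) * (norm (\<phi> (of_real l) x))\<^sup>2 \<le> (l\<^sup>2 + \<rho>\<^sup>2) * 1"
    by (rule order_trans[OF _ order_trans[OF energy_real[OF \<open>x \<ge> 0\<close>, of l]]]) auto
  then have "(norm (\<phi> (of_real l) x))\<^sup>2 \<le> 1" using p by (simp only: mult_le_cancel_left_pos)
  then show ?thesis by (simp add: power2_le_iff_abs_le abs_square_le_1)
qed

lemma phi'_real_le: "x \<ge> 0 \<Longrightarrow> norm (\<phi>' (of_real l) x) \<le> sqrt (l\<^sup>2 + \<rho>\<^sup>2)"
proof -
  assume "x \<ge> 0"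
  have "0 \<le> (l\<^sup>2 + \<rho>\<^sup>2) * (norm (\<phi> (of_real l) x))\<^sup>2" by simp
  then have "(norm (\<phi>' (of_real l) x))\<^sup>2 \<le> l\<^sup>2 + \<rho>\<^sup>2"
    using energy_real[OF \<open>x \<ge> 0\<close>, of l] by linarith
  then show ?thesis by (rule real_le_rsqrt)
qed

text \<open>For complex l the cross terms remain; the rate in Gronwall's inequality absorbs them,
  while the singular drift enters with the favourable sign. The growth in x is too large for the
  strip, so the bound is used on a bounded interval only.\<close>

lemma energy_small:
  assumes "x \<ge> 0"
  shows "(norm (\<phi> l x))\<^sup>2 + (norm (\<phi>' l x))\<^sup>2 \<le> exp ((1 + norm (of_real (\<rho>\<^sup>2) + l\<^sup>2)) * x)"
proof -
  define K where "K = of_real (\<rho>\<^sup>2) + l\<^sup>2"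
  let ?E = "\<lambda>x. (norm (\<phi> l x))\<^sup>2 + (norm (\<phi>' l x))\<^sup>2"
  have "?E x \<le> ?E 0 * exp ((1 + norm K) * (x - 0))"
  proof (rule gronwall_real[OF assms])
    fix y :: real assume y: "0 < y" "y < x"
    show "(?E has_real_derivative 2 * (\<phi> l y \<bullet> \<phi>' l y) + 2 * (\<phi>' l y \<bullet> (- of_real (drift y) * \<phi>' l y - K * \<phi> l y))) (at y)"
      unfolding K_def by (intro DERIV_add has_real_derivative_norm_sq phi_deriv phi'_deriv y)
    have "2 * (\<phi>' l y \<bullet> (- of_real (drift y) * \<phi>' l y - K * \<phi> l y))
      = - (2 * drift y * (norm (\<phi>' l y))\<^sup>2) - 2 * (\<phi>' l y \<bullet> (K * \<phi> l y))"
      unfolding of_real_minus[symmetric] scaleR_conv_of_real[symmetric] power2_norm_eq_inner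
      by (simp add: inner_diff_right algebra_simps)
    moreover have "0 \<le> 2 * drift y * (norm (\<phi>' l y))\<^sup>2" using drift_nonneg[of y] y by simp
    moreover have "- (\<phi>' l y \<bullet> (K * \<phi> l y)) \<le> norm K * (norm (\<phi>' l y) * norm (\<phi> l y))"
      using Cauchy_Schwarz_ineq2[of "\<phi>' l y" "K * \<phi> l y"] by (simp add: norm_mult mult_ac)
    moreover have "\<phi> l y \<bullet> \<phi>' l y \<le> norm (\<phi>' l y) * norm (\<phi> l y)"
      using norm_cauchy_schwarz[of "\<phi> l y" "\<phi>' l y"] by (simp add: mult_ac)
    ultimately have "2 * (\<phi> l y \<bullet> \<phi>' l y) + 2 * (\<phi>' l y \<bullet> (- of_real (drift y) * \<phi>' l y - K * \<phi> l y))
       \<le> (1 + norm K) * (2 * norm (\<phi>' l y) * norm (\<phi> l y))" by (simp add: algebra_simps)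
    also have "\<dots> \<le> (1 + norm K) * ?E y"
      using sum_squares_bound[of "norm (\<phi>' l y)" "norm (\<phi> l y)"] by (intro mult_left_mono) auto
    finally show "2 * (\<phi> l y \<bullet> \<phi>' l y) + 2 * (\<phi>' l y \<bullet> (- of_real (drift y) * \<phi>' l y - K * \<phi> l y))
       \<le> (1 + norm K) * ?E y" .
  qed (intro continuous_intros cont_phi cont_phi')
  then show ?thesis by (simp add: phi_0 jacobi_fun'_0 K_def)
qed

text \<open>The combination \<open>\<phi>' + (\<rho> - i l) \<phi>\<close> annihilates one of the two exponential solutions of
  the constant coefficient equation at infinity, which triangularises the system.\<close>

lemma energy_large:
  assumes eps: "\<epsilon> > 0" and L: "norm l \<le> \<Lambda>" and ab: "1 \<le> a" "a \<le> b"
    and a: "2 * \<rho> * (2 + (\<rho> + \<Lambda>) / \<epsilon>) / a \<le> \<epsilon>"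
  defines "v \<equiv> \<lambda>x. \<phi>' l x + (of_real \<rho> - \<i> * l) * \<phi> l x"
  defines "N \<equiv> \<lambda>x. (norm (\<phi> l x))\<^sup>2 + (1 / \<epsilon>\<^sup>2) * (norm (v x))\<^sup>2"
  shows "N b \<le> N a * exp (2 * (\<bar>Im l\<bar> - \<rho> + \<epsilon>) * (b - a))"
proof (rule gronwall_real[OF ab(2)])
  show "continuous_on {a..b} N" unfolding N_def v_def by (intro continuous_intros cont_phi cont_phi')
  fix x assume x: "a < x" "x < b"
  then have x0: "x > 0" "x \<ge> 1" using ab by auto
  define d where "d = drift x - 2 * \<rho>"
  define p where "p = \<phi> l x"
  define p' where "p' = \<phi>' l x"
  define w where "w = v x"
  have p': "p' = w - (of_real \<rho> - \<i> * l) * p" by (simp add: w_def v_def p_def p'_def)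
  have Lpos: "\<Lambda> \<ge> 0" using L norm_ge_zero[of l] by linarith
  \<comment> \<open>The operator at infinity factors as (D + \<rho> + i l) (D + \<rho> - i l). Here
    \<open>v\<close> is the inner factor applied to \<open>\<phi> l\<close>, so only the drift error
    \<open>d\<close> couples it back.\<close>
  have v': "(v has_vector_derivative - (of_real \<rho> + \<i> * l) * w - of_real d * p') (at x)"
  proof -
    have "(v has_vector_derivative (- of_real (drift x) * \<phi>' l x - (of_real (\<rho>\<^sup>2) + l\<^sup>2) * \<phi> l x) + (of_real \<rho> - \<i> * l) * \<phi>' l x) (at x)"
      unfolding v_def by (intro has_vector_derivative_add has_vector_derivative_mult_right phi_deriv phi'_deriv x0)
    moreover have "(- of_real (drift x) * \<phi>' l x - (of_real (\<rho>\<^sup>2) + l\<^sup>2) * \<phi> l x) + (of_real \<rho> - \<i> * l) * \<phi>' l x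
        = - (of_real \<rho> + \<i> * l) * w - of_real d * p'"
      unfolding w_def v_def p'_def d_def by (simp add: algebra_simps power2_eq_square)
    ultimately show ?thesis by simp
  qed
  show "(N has_real_derivative 2 * (p \<bullet> p') + (1 / \<epsilon>\<^sup>2) * (2 * (w \<bullet> (- (of_real \<rho> + \<i> * l) * w - of_real d * p')))) (at x)"
    unfolding N_def w_def p_def p'_def
    by (intro DERIV_add DERIV_cmult has_real_derivative_norm_sq phi_deriv v'[unfolded w_def p'_def])
  have inner_self: "u \<bullet> (k * u) = Re k * (norm u)\<^sup>2" for u k :: complex
    unfolding inner_complex_def cmod_power2 by (simp add: algebra_simps power2_eq_square)
  let ?k = "\<bar>Im l\<bar> - \<rho>"
  have 1: "p \<bullet> p' \<le> norm p * norm w + ?k * (norm p)\<^sup>2"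
  proof -
    have "p \<bullet> p' = p \<bullet> w - (\<rho> + Im l) * (norm p)\<^sup>2"
      unfolding p' inner_diff_right inner_self by simp
    moreover have "p \<bullet> w \<le> norm p * norm w" by (rule norm_cauchy_schwarz)
    moreover have "- (\<rho> + Im l) * (norm p)\<^sup>2 \<le> ?k * (norm p)\<^sup>2" by (intro mult_right_mono) auto
    ultimately show ?thesis unfolding mult_minus_left by linarith
  qed
  have nl: "norm (of_real \<rho> - \<i> * l) \<le> \<rho> + \<Lambda>"
    using norm_triangle_ineq4[of "complex_of_real \<rho>" "\<i> * l"] L rho_pos by (simp add: norm_mult)
  have 2: "w \<bullet> (- (of_real \<rho> + \<i> * l) * w - of_real d * p') \<le> ?k * (norm w)\<^sup>2 + \<bar>d\<bar> * (norm w)\<^sup>2 + \<bar>d\<bar> * (\<rho> + \<Lambda>) * (norm w * norm p)"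
  proof -
    have "w \<bullet> (- (of_real \<rho> + \<i> * l) * w - of_real d * p') = - (\<rho> - Im l) * (norm w)\<^sup>2 - d * (w \<bullet> p')"
      unfolding inner_diff_right inner_self scaleR_conv_of_real[symmetric] by simp
    moreover have "- (\<rho> - Im l) * (norm w)\<^sup>2 \<le> ?k * (norm w)\<^sup>2" by (intro mult_right_mono) auto
    moreover have "- d * (w \<bullet> p') \<le> \<bar>d\<bar> * (norm w * norm p')"
    proof -
      have "- d * (w \<bullet> p') \<le> \<bar>d\<bar> * \<bar>w \<bullet> p'\<bar>" by (metis abs_ge_self abs_minus_cancel abs_mult)
      also have "\<dots> \<le> \<bar>d\<bar> * (norm w * norm p')" by (intro mult_left_mono Cauchy_Schwarz_ineq2) auto
      finally show ?thesis .
    qed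
    moreover have "norm p' \<le> norm w + (\<rho> + \<Lambda>) * norm p"
    proof -
      have "norm p' \<le> norm w + norm (of_real \<rho> - \<i> * l) * norm p"
        unfolding p' using norm_triangle_ineq4[of w "(of_real \<rho> - \<i> * l) * p"] by (simp add: norm_mult)
      also have "\<dots> \<le> norm w + (\<rho> + \<Lambda>) * norm p" by (intro add_left_mono mult_right_mono nl) auto
      finally show ?thesis .
    qed
    then have "\<bar>d\<bar> * (norm w * norm p') \<le> \<bar>d\<bar> * (norm w * (norm w + (\<rho> + \<Lambda>) * norm p))"
      by (intro mult_left_mono) auto
    ultimately show ?thesis by (simp add: algebra_simps power2_eq_square)
  qed
  have d: "\<bar>d\<bar> * (2 + (\<rho> + \<Lambda>) / \<epsilon>) \<le> \<epsilon>"
  proof -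
    have "\<bar>d\<bar> \<le> 2 * \<rho> / (x * (1 + x))" unfolding d_def by (rule drift_diff[OF x0(1)])
    also have "\<dots> \<le> 2 * \<rho> / a"
    proof (intro divide_left_mono)
      have "x * 1 \<le> x * (1 + x)" using x0 by (intro mult_left_mono) auto
      then show "a \<le> x * (1 + x)" using x by linarith
    qed (use rho_pos ab x0 in auto)
    finally have "\<bar>d\<bar> * (2 + (\<rho> + \<Lambda>) / \<epsilon>) \<le> 2 * \<rho> / a * (2 + (\<rho> + \<Lambda>) / \<epsilon>)"
      using rho_pos Lpos eps by (intro mult_right_mono) auto
    then show ?thesis using a by (simp add: mult_ac)
  qed
  define P where "P = norm p"
  \<comment> \<open>With \<open>w\<close> measured in units of \<epsilon> the term p \<bullet> w is
    at most \<epsilon> P W, hence small. This coupling and the drift error contribute \<epsilon> N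
    each, which makes up the 2 \<epsilon> in the rate.\<close>
  define W where "W = norm w / \<epsilon>"
  have nw: "norm w = \<epsilon> * W" using eps by (simp add: W_def)
  have PW: "P \<ge> 0" "W \<ge> 0" using eps by (auto simp: P_def W_def)
  have Nx: "N x = P\<^sup>2 + W\<^sup>2"
    using eps by (simp add: N_def P_def W_def w_def p_def power_divide)
  have "(1 / \<epsilon>\<^sup>2) * (2 * (w \<bullet> (- (of_real \<rho> + \<i> * l) * w - of_real d * p'))) \<le>
     (1 / \<epsilon>\<^sup>2) * (2 * (?k * (norm w)\<^sup>2 + \<bar>d\<bar> * (norm w)\<^sup>2 + \<bar>d\<bar> * (\<rho> + \<Lambda>) * (norm w * norm p)))"
    using 2 by (intro mult_left_mono) auto
  also have "\<dots> = 2 * ?k * W\<^sup>2 + 2 * \<bar>d\<bar> * W\<^sup>2 + \<bar>d\<bar> * ((\<rho> + \<Lambda>) / \<epsilon>) * (2 * W * P)"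
    unfolding nw P_def[symmetric] using eps by (simp add: field_simps power2_eq_square)
  finally have 3: "(1 / \<epsilon>\<^sup>2) * (2 * (w \<bullet> (- (of_real \<rho> + \<i> * l) * w - of_real d * p')))
    \<le> 2 * ?k * W\<^sup>2 + 2 * \<bar>d\<bar> * W\<^sup>2 + \<bar>d\<bar> * ((\<rho> + \<Lambda>) / \<epsilon>) * (2 * W * P)" .
  have "2 * (p \<bullet> p') + (1 / \<epsilon>\<^sup>2) * (2 * (w \<bullet> (- (of_real \<rho> + \<i> * l) * w - of_real d * p')))
    \<le> 2 * (P * (\<epsilon> * W) + ?k * P\<^sup>2) + (2 * ?k * W\<^sup>2 + 2 * \<bar>d\<bar> * W\<^sup>2 + \<bar>d\<bar> * ((\<rho> + \<Lambda>) / \<epsilon>) * (2 * W * P))"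
    by (intro add_mono 3 mult_left_mono 1[unfolded nw P_def[symmetric]]) simp
  also have "\<dots> = 2 * ?k * (P\<^sup>2 + W\<^sup>2) + \<epsilon> * (2 * W * P) + (\<bar>d\<bar> * (2 * W\<^sup>2) + \<bar>d\<bar> * ((\<rho> + \<Lambda>) / \<epsilon>) * (2 * W * P))"
    by (simp add: algebra_simps)
  also have "\<dots> \<le> 2 * ?k * (P\<^sup>2 + W\<^sup>2) + \<epsilon> * (P\<^sup>2 + W\<^sup>2) + (\<bar>d\<bar> * (2 * (P\<^sup>2 + W\<^sup>2)) + \<bar>d\<bar> * ((\<rho> + \<Lambda>) / \<epsilon>) * (P\<^sup>2 + W\<^sup>2))"
    using eps rho_pos Lpos sum_squares_bound[of W P] by (intro order.refl add_mono mult_left_mono) auto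
  also have "\<dots> = 2 * ?k * (P\<^sup>2 + W\<^sup>2) + \<epsilon> * (P\<^sup>2 + W\<^sup>2) + (\<bar>d\<bar> * (2 + (\<rho> + \<Lambda>) / \<epsilon>)) * (P\<^sup>2 + W\<^sup>2)"
    by (simp add: algebra_simps)
  also have "\<dots> \<le> 2 * ?k * (P\<^sup>2 + W\<^sup>2) + \<epsilon> * (P\<^sup>2 + W\<^sup>2) + \<epsilon> * (P\<^sup>2 + W\<^sup>2)"
    by (intro add_left_mono mult_right_mono d) auto
  finally show "2 * (p \<bullet> p') + (1 / \<epsilon>\<^sup>2) * (2 * (w \<bullet> (- (of_real \<rho> + \<i> * l) * w - of_real d * p')))
    \<le> 2 * (\<bar>Im l\<bar> - \<rho> + \<epsilon>) * N x"
    unfolding Nx by (simp add: algebra_simps)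
qed

text \<open>The point \<open>a\<close> where \<open>energy_large\<close> takes over from
  \<open>energy_small\<close> depends on \<Lambda> and \<epsilon> but not on l. This makes the
  constant uniform on bounded sets of l, as holomorphy under the integral requires.\<close>

lemma phi_exp_bound:
  assumes eps: "\<epsilon> > 0" and Lam: "\<Lambda> \<ge> 0"
  obtains C where "C > 0" "\<And>l x. norm l \<le> \<Lambda> \<Longrightarrow> x \<ge> 0 \<Longrightarrow>
     norm (\<phi> l x) + norm (\<phi>' l x) \<le> C * exp ((\<bar>Im l\<bar> - \<rho> + \<epsilon>) * x)"
proof -
  define M where "M = \<rho> + \<Lambda>"
  define a where "a = max 1 (2 * \<rho> * (2 + M / \<epsilon>) / \<epsilon>)"
  define k where "k = 1 + (\<rho>\<^sup>2 + \<Lambda>\<^sup>2)"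
  define C1 where "C1 = (1 + 2 / \<epsilon>\<^sup>2 + 2 * M\<^sup>2 / \<epsilon>\<^sup>2) * exp (k * a)"
  \<comment> \<open>The factor exp (\<rho> a) serves two purposes: on [0, a] the claimed exponential
    may be as small as exp (- \<rho> a), and beyond a it converts x - a into x. In both cases the
    rate is at least - \<rho>.\<close>
  define C where "C = max (2 * exp (k * a)) ((1 + \<epsilon> + M) * sqrt C1) * exp (\<rho> * a)"
  have a1: "a \<ge> 1" by (simp add: a_def)
  have M: "M > 0" using rho_pos Lam by (simp add: M_def)
  have a2: "2 * \<rho> * (2 + M / \<epsilon>) / a \<le> \<epsilon>"
  proof -
    have "2 * \<rho> * (2 + M / \<epsilon>) / \<epsilon> \<le> a" by (simp add: a_def)
    then show ?thesis using eps a1 by (simp add: field_simps)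
  qed
  have C1: "C1 > 0" using eps by (auto simp: C1_def intro!: mult_pos_pos add_pos_nonneg)
  have Cpos: "C > 0" unfolding C_def by (simp add: less_max_iff_disj)
  have small: "(norm (\<phi> l x))\<^sup>2 + (norm (\<phi>' l x))\<^sup>2 \<le> exp (k * a)" if "norm l \<le> \<Lambda>" "0 \<le> x" "x \<le> a" for l x
  proof -
    have "norm (of_real (\<rho>\<^sup>2) + l\<^sup>2) \<le> norm (complex_of_real (\<rho>\<^sup>2)) + norm (l\<^sup>2)" by (rule norm_triangle_ineq)
    also have "\<dots> = \<rho>\<^sup>2 + (norm l)\<^sup>2" by (simp add: norm_power del: of_real_power)
    also have "\<dots> \<le> \<rho>\<^sup>2 + \<Lambda>\<^sup>2" using that by (intro add_left_mono power_mono) auto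
    finally have "(1 + norm (of_real (\<rho>\<^sup>2) + l\<^sup>2)) * x \<le> k * a"
      unfolding k_def using that by (intro mult_mono) auto
    then show ?thesis using energy_small[OF that(2), of l] by (meson exp_le_cancel_iff order_trans)
  qed
  have "norm (\<phi> l x) + norm (\<phi>' l x) \<le> C * exp ((\<bar>Im l\<bar> - \<rho> + \<epsilon>) * x)" if l: "norm l \<le> \<Lambda>" and x: "x \<ge> 0" for l x
  proof -
    let ?e = "\<bar>Im l\<bar> - \<rho> + \<epsilon>"
    have e: "- \<rho> \<le> ?e" using eps by simp
    show ?thesis
    proof (cases "x \<le> a")
      case True
      have 1: "exp (k * a) \<ge> 1" using a1 by (simp add: k_def)
      have ab: "s + t \<le> 2 * E" if "s\<^sup>2 + t\<^sup>2 \<le> E" "E \<ge> 1" "s \<ge> 0" "t \<ge> 0" for s t E :: real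
      proof -
        have "E \<le> E * E" using that by (simp add: mult_le_cancel_left1)
        then have "s\<^sup>2 \<le> E\<^sup>2" "t\<^sup>2 \<le> E\<^sup>2" using that zero_le_power2[of s] zero_le_power2[of t]
          unfolding power2_eq_square[of E] by linarith+
        then have "s \<le> E" "t \<le> E" using that by (auto simp: power2_le_iff_abs_le)
        then show ?thesis by simp
      qed
      have "norm (\<phi> l x) + norm (\<phi>' l x) \<le> 2 * exp (k * a)"
        by (rule ab[OF small[OF l x True] 1]) auto
      also have "\<dots> \<le> max (2 * exp (k * a)) ((1 + \<epsilon> + M) * sqrt C1)" by simp
      also have "\<dots> = C * exp (- \<rho> * a)" by (simp add: C_def mult.assoc flip: exp_add)
      also have "\<dots> \<le> C * exp (?e * x)"
      proof (intro mult_left_mono)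
        have "- \<rho> * a \<le> - \<rho> * x" using True rho_pos by simp
        also have "\<dots> \<le> ?e * x" using e x by (intro mult_right_mono) auto
        finally show "exp (- \<rho> * a) \<le> exp (?e * x)" by simp
      qed (use Cpos in simp)
      finally show ?thesis .
    next
      case False
      then have xa: "a \<le> x" by simp
      define v where "v = (\<lambda>x. \<phi>' l x + (of_real \<rho> - \<i> * l) * \<phi> l x)"
      define N where "N = (\<lambda>x. (norm (\<phi> l x))\<^sup>2 + (1 / \<epsilon>\<^sup>2) * (norm (v x))\<^sup>2)"
      have nl: "norm (of_real \<rho> - \<i> * l) \<le> M"
        using norm_triangle_ineq4[of "complex_of_real \<rho>" "\<i> * l"] l rho_pos by (simp add: norm_mult M_def)
      have 1: "N x \<le> N a * exp (2 * ?e * (x - a))"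
        unfolding N_def v_def by (rule energy_large[OF eps l a1 xa]) (use a2 in \<open>simp add: M_def\<close>)
      have Na: "N a \<le> C1"
      proof -
        have "norm (v a) \<le> norm (\<phi>' l a) + M * norm (\<phi> l a)"
          unfolding v_def by (rule order_trans[OF norm_triangle_ineq])
            (auto simp: norm_mult intro!: mult_right_mono nl)
        then have "(norm (v a))\<^sup>2 \<le> (norm (\<phi>' l a) + M * norm (\<phi> l a))\<^sup>2" by (intro power_mono) auto
        also have "\<dots> \<le> 2 * (norm (\<phi>' l a))\<^sup>2 + 2 * (M * norm (\<phi> l a))\<^sup>2"
          using sum_squares_bound[of "norm (\<phi>' l a)" "M * norm (\<phi> l a)"] by (simp add: power2_sum)
        also have "\<dots> \<le> 2 * exp (k * a) + 2 * (M\<^sup>2 * exp (k * a))"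
        proof -
          have "(norm (\<phi> l a))\<^sup>2 \<le> exp (k * a)" "(norm (\<phi>' l a))\<^sup>2 \<le> exp (k * a)"
            using small[OF l, of a] a1 zero_le_power2[of "norm (\<phi> l a)"] zero_le_power2[of "norm (\<phi>' l a)"] by linarith+
          then show ?thesis unfolding power_mult_distrib by (intro add_mono mult_left_mono) auto
        qed
        finally have "(1 / \<epsilon>\<^sup>2) * (norm (v a))\<^sup>2 \<le> (1 / \<epsilon>\<^sup>2) * (2 * exp (k * a) + 2 * (M\<^sup>2 * exp (k * a)))"
          by (intro mult_left_mono) auto
        moreover have "(norm (\<phi> l a))\<^sup>2 \<le> exp (k * a)"
          using small[OF l, of a] a1 zero_le_power2[of "norm (\<phi>' l a)"] by linarith
        ultimately have "N a \<le> exp (k * a) + (1 / \<epsilon>\<^sup>2) * (2 * exp (k * a) + 2 * (M\<^sup>2 * exp (k * a)))"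
          unfolding N_def by linarith
        also have "\<dots> = C1" by (simp add: C1_def algebra_simps add_divide_distrib)
        finally show ?thesis .
      qed
      have "N x \<le> C1 * exp (2 * ?e * (x - a))"
        by (rule order_trans[OF 1]) (intro mult_right_mono Na, simp)
      also have "\<dots> = (sqrt C1 * exp (?e * (x - a)))\<^sup>2"
        using C1 by (simp add: power_mult_distrib mult.assoc flip: exp_double)
      finally have N: "N x \<le> (sqrt C1 * exp (?e * (x - a)))\<^sup>2" .
      let ?B = "sqrt C1 * exp (?e * (x - a))"
      have B: "?B \<ge> 0" using C1 by simp
      have "(norm (\<phi> l x))\<^sup>2 \<le> ?B\<^sup>2" using N unfolding N_def by (smt (verit) mult_nonneg_nonneg zero_le_power2 divide_nonneg_nonneg)
      then have 2: "norm (\<phi> l x) \<le> ?B" using B by (rule power2_le_imp_le)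
      have "(norm (v x) / \<epsilon>)\<^sup>2 \<le> ?B\<^sup>2" using N unfolding N_def power_divide
        using zero_le_power2[of "norm (\<phi> l x)"] unfolding mult_1_left times_divide_eq_left by linarith
      then have "norm (v x) / \<epsilon> \<le> ?B" using B by (rule power2_le_imp_le)
      then have 3: "norm (v x) \<le> \<epsilon> * ?B" using eps by (simp add: field_simps)
      have "\<phi>' l x = v x - (of_real \<rho> - \<i> * l) * \<phi> l x" by (simp add: v_def)
      then have "norm (\<phi>' l x) \<le> norm (v x) + norm (of_real \<rho> - \<i> * l) * norm (\<phi> l x)"
        by (metis norm_mult norm_triangle_ineq4)
      also have "\<dots> \<le> \<epsilon> * ?B + M * ?B" using M by (intro add_mono 3 mult_mono nl 2) auto
      finally have "norm (\<phi> l x) + norm (\<phi>' l x) \<le> (1 + \<epsilon> + M) * ?B" using 2 by (simp add: algebra_simps)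
      also have "\<dots> = ((1 + \<epsilon> + M) * sqrt C1) * exp (- (?e * a)) * exp (?e * x)"
        by (simp add: algebra_simps flip: exp_add)
      also have "\<dots> \<le> (max (2 * exp (k * a)) ((1 + \<epsilon> + M) * sqrt C1)) * exp (\<rho> * a) * exp (?e * x)"
      proof (intro mult_right_mono mult_mono)
        have "- (?e * a) = (- ?e) * a" by (rule minus_mult_left)
        also have "\<dots> \<le> \<rho> * a" using e a1 by (intro mult_right_mono) auto
        finally show "exp (- (?e * a)) \<le> exp (\<rho> * a)" by simp
      qed (auto simp: le_max_iff_disj)
      finally show ?thesis by (simp add: C_def)
    qed
  qed
  with Cpos show ?thesis by (rule that)
qed

lemma opdam_G_params:
  assumes "l \<noteq> - \<i> * of_real \<rho>"
  shows "opdam_G \<alpha> \<beta> l x = \<phi> l x - \<phi>' l x / (of_real \<rho> - \<i> * l)"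
  using opdam_G_eq[OF alpha1 assms] .

lemma of_real_ne_special: "complex_of_real l \<noteq> - \<i> * of_real \<rho>"
  using rho_pos by (auto simp: complex_eq_iff)

text \<open>For real l the modulus of \<rho> - i l is sqrt (l^2 + \<rho>^2), precisely the bound for
  \<open>\<phi>'\<close>, so both terms of G are at most 1.\<close>

lemma opdam_G_real_le: "norm (opdam_G \<alpha> \<beta> (of_real l) x) \<le> 2"
proof -
  have "norm (complex_of_real \<rho> - \<i> * of_real l) = sqrt (l\<^sup>2 + \<rho>\<^sup>2)"
    by (simp add: cmod_def add.commute)
  moreover have "sqrt (l\<^sup>2 + \<rho>\<^sup>2) > 0" using rho_pos by (simp add: add_nonneg_pos)
  moreover have "norm (\<phi> (of_real l) x) \<le> 1"
    using phi_real_le[of "\<bar>x\<bar>" l] by (cases "x \<ge> 0") (auto simp: jacobi_fun_even)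
  moreover have "norm (\<phi>' (of_real l) x) \<le> sqrt (l\<^sup>2 + \<rho>\<^sup>2)"
    using phi'_real_le[of "\<bar>x\<bar>" l] by (cases "x \<ge> 0") (auto simp: jacobi_fun'_odd)
  ultimately have "norm (\<phi>' (of_real l) x / (of_real \<rho> - \<i> * of_real l)) \<le> 1"
    by (simp add: norm_divide)
  with \<open>norm (\<phi> (of_real l) x) \<le> 1\<close> show ?thesis
    unfolding opdam_G_params[OF of_real_ne_special]
    using norm_triangle_ineq4[of "\<phi> (of_real l) x" "\<phi>' (of_real l) x / (of_real \<rho> - \<i> * of_real l)"] by linarith
qed

end

section \<open>Asymptotics of the normalized Jacobi functions\<close>

lemma sinh_cosh_le_3:
  fixes x :: real
  assumes "0 < x" "x \<le> 1"
  shows "sinh x \<le> 3 * x" "cosh x \<le> 3"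
proof -
  have e: "exp x \<le> 1 + x + x\<^sup>2" using exp_bound[of x] assms by simp
  have "x\<^sup>2 \<le> x" using assms by (simp add: power2_eq_square mult_le_cancel_left1)
  moreover have "exp (- x) \<ge> 1 - x" using exp_ge_add_one_self[of "- x"] by simp
  moreover have "exp (- x) \<le> 1" using assms by simp
  ultimately have "exp x - exp (- x) \<le> 2 * (3 * x)" "exp x + exp (- x) \<le> 2 * 3"
    using e assms by linarith+
  then have "(exp x - exp (- x)) / 2 \<le> 3 * x" "(exp x + exp (- x)) / 2 \<le> 3" by simp_all
  then show "sinh x \<le> 3 * x" "cosh x \<le> 3"
    unfolding sinh_field_def cosh_field_def .
qed

lemma x_le_sinh: "x \<ge> 0 \<Longrightarrow> x \<le> sinh (x::real)"
proof -
  assume x: "x \<ge> 0"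
  have "sinh 0 - 0 \<le> sinh x - x"
  proof (rule DERIV_nonneg_imp_nondecreasing[OF x])
    fix y :: real
    show "\<exists>d. ((\<lambda>x. sinh x - x) has_real_derivative d) (at y) \<and> d \<ge> 0"
      using cosh_real_ge_1[of y] by (intro exI[of _ "cosh y - 1"]) (auto intro!: derivative_eq_intros)
  qed
  then show ?thesis by simp
qed

lemma one_divide_powr: "x > 0 \<Longrightarrow> (1 / x) powr e = x powr (- e)" for x :: real
  by (simp add: powr_minus_divide powr_divide)

section \<open>Liouville normal form and comparison with free waves\<close>

context jacobi_params
begin

text \<open>The square root of the weight A on the positive axis; multiplication by it removes the
  first-order term of the equation.\<close>

definition w :: "real \<Rightarrow> real" where
  "w x = sinh x powr (\<alpha> + 1 / 2) * cosh x powr (\<beta> + 1 / 2)"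

lemma w_pos: "x > 0 \<Longrightarrow> w x > 0"
  by (simp add: w_def)

lemma w_sq: "x > 0 \<Longrightarrow> (w x)\<^sup>2 = jacobi_weight \<alpha> \<beta> x"
  by (simp add: w_def jacobi_weight_def power_mult_distrib powr_power algebra_simps)

lemma w_deriv:
  assumes "x > 0"
  shows "(w has_real_derivative w x * (drift x / 2)) (at x)"
proof -
  have s: "sinh x > 0" "cosh x > 0" using assms by auto
  have ds: "(sinh has_real_derivative cosh x) (at x)" and dc: "(cosh has_real_derivative sinh x) (at x)"
    by (auto intro!: derivative_eq_intros)
  have 1: "((\<lambda>x. sinh x powr (\<alpha> + 1 / 2)) has_real_derivative sinh x powr (\<alpha> + 1 / 2) * ((\<alpha> + 1 / 2) * (cosh x / sinh x))) (at x)"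
    by (rule DERIV_cong[OF DERIV_chain2[OF has_real_derivative_powr[OF s(1)] ds]])
       (subst powr_diff, use s in simp)
  have 2: "((\<lambda>x. cosh x powr (\<beta> + 1 / 2)) has_real_derivative cosh x powr (\<beta> + 1 / 2) * ((\<beta> + 1 / 2) * (sinh x / cosh x))) (at x)"
    by (rule DERIV_cong[OF DERIV_chain2[OF has_real_derivative_powr[OF s(2)] dc]])
       (subst powr_diff, use s in simp)
  have "(w has_real_derivative sinh x powr (\<alpha> + 1 / 2) * ((\<alpha> + 1 / 2) * (cosh x / sinh x)) * cosh x powr (\<beta> + 1 / 2)
      + cosh x powr (\<beta> + 1 / 2) * ((\<beta> + 1 / 2) * (sinh x / cosh x)) * sinh x powr (\<alpha> + 1 / 2)) (at x)"
    unfolding w_def[abs_def] by (rule DERIV_mult[OF 1 2])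
  then show ?thesis unfolding w_def jacobi_drift_def by (rule DERIV_cong) (simp add: algebra_simps)
qed

definition drift' :: "real \<Rightarrow> real" where
  "drift' x = (2 * \<beta> + 1) / (cosh x)\<^sup>2 - (2 * \<alpha> + 1) / (sinh x)\<^sup>2"

lemma drift_deriv:
  assumes "x > 0"
  shows "(drift has_real_derivative drift' x) (at x)"
proof -
  have s: "sinh x > 0" "cosh x > 0" using assms by auto
  have cs: "cosh x * cosh x = sinh x * sinh x + 1"
    using cosh_square_eq[of x] by (simp add: power2_eq_square)
  have "((\<lambda>x. cosh x / sinh x) has_real_derivative (sinh x * sinh x - cosh x * cosh x) / (sinh x * sinh x)) (at x)"
    using s by (auto intro!: derivative_eq_intros)
  moreover have "((\<lambda>x. sinh x / cosh x) has_real_derivative (cosh x * cosh x - sinh x * sinh x) / (cosh x * cosh x)) (at x)"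
    using s by (auto intro!: derivative_eq_intros)
  ultimately show ?thesis
    unfolding jacobi_drift_def[abs_def] drift'_def
    by (intro DERIV_cong[OF DERIV_add[OF DERIV_cmult DERIV_cmult]]) (auto simp: power2_eq_square cs)
qed

text \<open>The potential V in u'' = (V - l^2) u for u = w \<phi>: the usual expression b'/2 + b^2/4
  of the normal form, with b the drift, minus the spectral shift \<rho>^2.\<close>

definition pot :: "real \<Rightarrow> real" where
  "pot x = drift' x / 2 + (drift x)\<^sup>2 / 4 - \<rho>\<^sup>2"

text \<open>The form x^(-2) is chosen for its integral: over [1/l, \<infinity>) it is l, so division
  by l leaves a constant independent of l.\<close>

lemma pot_bound:
  assumes "x > 0"
  shows "\<bar>pot x\<bar> \<le> (\<rho> + 2 * \<rho>\<^sup>2) / x\<^sup>2"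
proof -
  have s: "sinh x \<ge> x" "cosh x \<ge> sinh x" using x_le_sinh[of x] sinh_le_cosh_real[of x] assms by auto
  have ab: "2 * \<alpha> + 1 \<ge> 0" "2 * \<beta> + 1 \<ge> 0" using alpha beta by auto
  have "(2 * \<beta> + 1) / (cosh x)\<^sup>2 \<le> (2 * \<beta> + 1) / x\<^sup>2"
    using ab s assms by (intro divide_left_mono power_mono) auto
  moreover have "(2 * \<alpha> + 1) / (sinh x)\<^sup>2 \<le> (2 * \<alpha> + 1) / x\<^sup>2"
    using ab s assms by (intro divide_left_mono power_mono) auto
  moreover have "0 \<le> (2 * \<beta> + 1) / (cosh x)\<^sup>2" "0 \<le> (2 * \<alpha> + 1) / (sinh x)\<^sup>2" using ab by auto
  moreover have "2 * \<rho> / x\<^sup>2 = (2 * \<alpha> + 1) / x\<^sup>2 + (2 * \<beta> + 1) / x\<^sup>2"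
    unfolding two_rho by (simp add: add_divide_distrib)
  ultimately have 1: "\<bar>drift' x\<bar> \<le> 2 * \<rho> / x\<^sup>2" unfolding drift'_def by linarith
  have 2: "\<bar>(drift x)\<^sup>2 / 4 - \<rho>\<^sup>2\<bar> \<le> 2 * \<rho>\<^sup>2 / x\<^sup>2"
  proof -
    define y where "y = x * (1 + x)"
    have y: "y > 0" using assms by (simp add: y_def)
    have "(drift x)\<^sup>2 / 4 - \<rho>\<^sup>2 = (drift x - 2 * \<rho>) * (drift x - 2 * \<rho> + 4 * \<rho>) / 4"
      by (simp add: power2_eq_square field_simps)
    also have "\<bar>\<dots>\<bar> = \<bar>drift x - 2 * \<rho>\<bar> * \<bar>drift x - 2 * \<rho> + 4 * \<rho>\<bar> / 4" by (simp add: abs_mult)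
    also have "\<dots> \<le> (2 * \<rho> / y) * (2 * \<rho> / y + 4 * \<rho>) / 4"
      using drift_diff[OF assms] rho_pos y unfolding y_def[symmetric]
      by (intro divide_right_mono mult_mono) auto
    also have "\<dots> = \<rho>\<^sup>2 * ((1 + 2 * y) / y\<^sup>2)"
      using y by (simp add: power2_eq_square field_simps)
    also have "\<dots> \<le> \<rho>\<^sup>2 * (2 / x\<^sup>2)"
    proof (intro mult_left_mono)
      have "(1 + 2 * y) * x\<^sup>2 \<le> 2 * y\<^sup>2"
      proof -
        have "1 + 2 * y \<le> 2 * (1 + x)\<^sup>2" unfolding y_def using assms by (simp add: power2_eq_square algebra_simps)
        then have "(1 + 2 * y) * x\<^sup>2 \<le> 2 * (1 + x)\<^sup>2 * x\<^sup>2" by (intro mult_right_mono) auto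
        then show ?thesis by (simp add: y_def power_mult_distrib mult_ac)
      qed
      then show "(1 + 2 * y) / y\<^sup>2 \<le> 2 / x\<^sup>2" using y assms by (simp add: divide_simps)
    qed auto
    finally show ?thesis by simp
  qed
  have "\<bar>pot x\<bar> \<le> \<bar>drift' x\<bar> / 2 + \<bar>(drift x)\<^sup>2 / 4 - \<rho>\<^sup>2\<bar>" unfolding pot_def by linarith
  also have "\<dots> \<le> \<rho> / x\<^sup>2 + 2 * \<rho>\<^sup>2 / x\<^sup>2" using 1 2 by linarith
  finally show ?thesis by (simp add: add_divide_distrib)
qed

definition u :: "real \<Rightarrow> real \<Rightarrow> complex" where
  "u l x = of_real (w x) * \<phi> (of_real l) x"

definition u' :: "real \<Rightarrow> real \<Rightarrow> complex" where
  "u' l x = of_real (w x) * (\<phi>' (of_real l) x + of_real (drift x / 2) * \<phi> (of_real l) x)"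

lemma u_deriv:
  assumes "x > 0"
  shows "(u l has_vector_derivative u' l x) (at x)"
proof -
  have "((\<lambda>x. complex_of_real (w x)) has_vector_derivative of_real (w x * (drift x / 2))) (at x)"
    using w_deriv[OF assms] by (intro has_vector_derivative_of_real)
      (simp add: has_real_derivative_iff_has_vector_derivative)
  from has_vector_derivative_mult[OF this phi_deriv[of "of_real l" x]]
  show ?thesis unfolding u_def[abs_def] u'_def
    by (rule has_vector_derivative_eq_rhs) (simp add: algebra_simps)
qed

lemma u'_deriv:
  assumes "x > 0"
  shows "(u' l has_vector_derivative of_real (pot x - l\<^sup>2) * u l x) (at x)"
proof -
  have W: "((\<lambda>x. complex_of_real (w x)) has_vector_derivative of_real (w x * (drift x / 2))) (at x)"
    using w_deriv[OF assms] by (intro has_vector_derivative_of_real)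
      (simp add: has_real_derivative_iff_has_vector_derivative)
  have D: "((\<lambda>x. complex_of_real (drift x / 2)) has_vector_derivative of_real (drift' x / 2)) (at x)"
    using DERIV_cdivide[OF drift_deriv[OF assms], of 2] by (intro has_vector_derivative_of_real)
      (simp add: has_real_derivative_iff_has_vector_derivative)
  from has_vector_derivative_mult[OF W has_vector_derivative_add[OF phi'_deriv[OF assms]
      has_vector_derivative_mult[OF D phi_deriv]], of "of_real l" "of_real l"]
  show ?thesis unfolding u'_def[abs_def]
    by (rule has_vector_derivative_eq_rhs) (simp add: u_def pot_def power2_eq_square field_simps)
qed

lemma w_small_bound:
  assumes "0 < x" "x \<le> 1"
  shows "w x \<le> 3 powr \<rho> * x powr (\<alpha> + 1 / 2)"
proof -
  have "w x \<le> (3 * x) powr (\<alpha> + 1 / 2) * 3 powr (\<beta> + 1 / 2)"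
    unfolding w_def using sinh_cosh_le_3[OF assms] assms alpha beta
    by (intro mult_mono powr_mono2) auto
  also have "\<dots> = 3 powr \<rho> * x powr (\<alpha> + 1 / 2)"
    using assms by (simp add: powr_mult jacobi_rho_def mult_ac add_ac flip: powr_add)
  finally show ?thesis .
qed

text \<open>Three losses are collected: 3 powr \<rho> from \<open>w\<close> near 0, then under the
  root (1 + 3 \<rho>)^2 + 1 from the energy at x = 1/l and exp (\<rho> + 2 \<rho>^2) from
  propagating it to infinity.\<close>

definition amp :: real where
  "amp = 3 powr \<rho> * sqrt (((1 + 3 * \<rho>)\<^sup>2 + 1) * exp (\<rho> + 2 * \<rho>\<^sup>2))"

lemma amp_ge: "3 powr \<rho> \<le> amp" and amp_pos: "amp > 0"
proof -
  have "1 \<le> ((1 + 3 * \<rho>)\<^sup>2 + 1)" by simp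
  moreover have "1 \<le> exp (\<rho> + 2 * \<rho>\<^sup>2)" using rho_pos by simp
  ultimately have "1 * 1 \<le> ((1 + 3 * \<rho>)\<^sup>2 + 1) * exp (\<rho> + 2 * \<rho>\<^sup>2)" by (intro mult_mono) auto
  then have "1 \<le> sqrt (((1 + 3 * \<rho>)\<^sup>2 + 1) * exp (\<rho> + 2 * \<rho>\<^sup>2))" by simp
  then have "3 powr \<rho> * 1 \<le> amp" unfolding amp_def by (intro mult_left_mono) auto
  then show "3 powr \<rho> \<le> amp" by simp
  moreover have "3 powr \<rho> > 0" by simp
  ultimately show "amp > 0" by linarith
qed

text \<open>Relative to the free energy the potential acts at a rate of at most C / (l y^2), with
  total C on [1/l, \<infinity>). At 1/l the function w is at most of order l powr (- (\<alpha> +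
  1/2)), and this order therefore persists for all larger x.\<close>

lemma u_energy:
  assumes l: "l \<ge> 1" and x: "x \<ge> 1 / l"
  shows "(norm (u' l x))\<^sup>2 + l\<^sup>2 * (norm (u l x))\<^sup>2 \<le> (amp * (l * l powr (- (\<alpha> + 1 / 2))))\<^sup>2"
proof -
  let ?C = "\<rho> + 2 * \<rho>\<^sup>2" and ?a = "1 / l"
  let ?e = "\<lambda>x. (norm (u' l x))\<^sup>2 + l\<^sup>2 * (norm (u l x))\<^sup>2"
  have C: "?C > 0" using rho_pos by (simp add: add_pos_nonneg)
  have a: "?a > 0" "?a \<le> 1" using l by auto
  have der: "(?e has_real_derivative 2 * (u' l y \<bullet> (of_real (pot y - l\<^sup>2) * u l y)) + l\<^sup>2 * (2 * (u l y \<bullet> u' l y))) (at y)"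
    if "y > 0" for y
    by (intro DERIV_add DERIV_cmult has_real_derivative_norm_sq u_deriv u'_deriv that)
  have deq: "2 * (u' l y \<bullet> (of_real (pot y - l\<^sup>2) * u l y)) + l\<^sup>2 * (2 * (u l y \<bullet> u' l y)) = 2 * pot y * (u l y \<bullet> u' l y)" for y
    unfolding scaleR_conv_of_real[symmetric] by (simp add: inner_commute algebra_simps)
  \<comment> \<open>The exponential is an integrating factor: C / (l y) has derivative - C / (l
    y^2), and at y = 1/l the factor is exp C.\<close>
  have "?e x * exp (?C / (l * x)) \<le> ?e ?a * exp (?C / (l * ?a))"
  proof (rule DERIV_nonpos_imp_nonincreasing[OF x])
    fix y assume "?a \<le> y" "y \<le> x"
    then have y: "y > 0" using a by linarith
    have "((\<lambda>y. ?e y * exp (?C / (l * y))) has_real_derivative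
      (2 * pot y * (u l y \<bullet> u' l y) - ?C / (l * y\<^sup>2) * ?e y) * exp (?C / (l * y))) (at y)"
    proof -
      have "((\<lambda>y. ?C / (l * y)) has_real_derivative - (?C / (l * y\<^sup>2))) (at y)"
        using y l by (auto intro!: derivative_eq_intros simp: power2_eq_square)
      from DERIV_mult[OF der[OF y] DERIV_fun_exp[OF this]] show ?thesis
        unfolding deq by (rule DERIV_cong) (simp add: algebra_simps add_divide_distrib)
    qed
    moreover have "2 * pot y * (u l y \<bullet> u' l y) \<le> ?C / (l * y\<^sup>2) * ?e y"
    proof -
      have "2 * pot y * (u l y \<bullet> u' l y) \<le> 2 * \<bar>pot y\<bar> * \<bar>u l y \<bullet> u' l y\<bar>"
        by (metis abs_ge_self abs_mult abs_numeral)
      also have "\<dots> \<le> 2 * (?C / y\<^sup>2) * (norm (u l y) * norm (u' l y))"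
        by (intro mult_mono pot_bound y Cauchy_Schwarz_ineq2) (use C in auto)
      also have "\<dots> = ?C / (l * y\<^sup>2) * (2 * norm (u' l y) * (l * norm (u l y)))"
        using l y by (simp add: field_simps)
      also have "\<dots> \<le> ?C / (l * y\<^sup>2) * ((norm (u' l y))\<^sup>2 + (l * norm (u l y))\<^sup>2)"
        using C l by (intro mult_left_mono sum_squares_bound) auto
      finally show ?thesis by (simp add: power_mult_distrib)
    qed
    then have "(2 * pot y * (u l y \<bullet> u' l y) - ?C / (l * y\<^sup>2) * ?e y) * exp (?C / (l * y)) \<le> 0"
      by (intro mult_nonpos_nonneg) auto
    ultimately show "\<exists>d. ((\<lambda>y. ?e y * exp (?C / (l * y))) has_real_derivative d) (at y) \<and> d \<le> 0" by blast
  qed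
  moreover have "?e x * 1 \<le> ?e x * exp (?C / (l * x))"
    using C l x a order_trans[OF less_imp_le[OF a(1)] x] by (intro mult_left_mono) (auto intro!: divide_nonneg_nonneg)
  moreover have "exp (?C / (l * ?a)) = exp ?C" using l by simp
  ultimately have 1: "?e x \<le> ?e ?a * exp ?C" by simp
  have wa: "w ?a \<le> 3 powr \<rho> * l powr (- (\<alpha> + 1 / 2))"
    using w_small_bound[OF a] unfolding one_divide_powr[OF less_le_trans[OF zero_less_one l]] .
  have p1: "norm (\<phi> (of_real l) ?a) \<le> 1" using phi_real_le[of ?a l] a by simp
  have p2: "norm (\<phi>' (of_real l) ?a) \<le> (1 + \<rho>) * l"
  proof -
    have "\<rho> * 1 \<le> \<rho> * l" using l rho_pos by (intro mult_left_mono) auto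
    then have "sqrt (l\<^sup>2 + \<rho>\<^sup>2) \<le> l + \<rho> * l"
      using sqrt_sum_squares_le_sum[of l \<rho>] l rho_pos by linarith
    then show ?thesis using phi'_real_le[of ?a l] a by (simp add: algebra_simps)
  qed
  have p3: "drift ?a / 2 \<le> 2 * \<rho> * l" "0 \<le> drift ?a / 2"
  proof -
    have "drift ?a \<le> 2 * \<rho> + 2 * \<rho> / (?a * (1 + ?a))" using drift_diff[OF a(1)] by linarith
    also have "2 * \<rho> / (?a * (1 + ?a)) \<le> 2 * \<rho> / ?a"
      using a rho_pos l by (intro divide_left_mono) (auto simp: mult_le_cancel_left1 field_simps)
    also have "\<rho> * 1 \<le> \<rho> * l" using l rho_pos by (intro mult_left_mono) auto
    then have "2 * \<rho> + 2 * \<rho> / ?a \<le> 4 * \<rho> * l" by (simp add: mult.commute)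
    finally show "drift ?a / 2 \<le> 2 * \<rho> * l" by simp
    show "0 \<le> drift ?a / 2" using drift_nonneg[OF a(1)] by simp
  qed
  have ua: "norm (u l ?a) \<le> w ?a" using w_pos[OF a(1)] p1 by (simp add: u_def norm_mult mult_left_le)
  have u'a: "norm (u' l ?a) \<le> w ?a * ((1 + 3 * \<rho>) * l)"
  proof -
    have "norm (\<phi>' (of_real l) ?a + of_real (drift ?a / 2) * \<phi> (of_real l) ?a) \<le> (1 + \<rho>) * l + (2 * \<rho> * l) * 1"
    proof (intro order_trans[OF norm_triangle_ineq] add_mono p2)
      show "norm (complex_of_real (drift ?a / 2) * \<phi> (of_real l) ?a) \<le> (2 * \<rho> * l) * 1"
        unfolding norm_mult norm_of_real using p3 l rho_pos by (intro mult_mono p1) simp_all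
    qed
    also have "\<dots> = (1 + 3 * \<rho>) * l" by (simp add: algebra_simps)
    finally show ?thesis unfolding u'_def norm_mult using w_pos[OF a(1)] by (simp add: mult_left_mono)
  qed
  have "?e ?a \<le> (w ?a * ((1 + 3 * \<rho>) * l))\<^sup>2 + l\<^sup>2 * (w ?a)\<^sup>2"
    by (intro add_mono mult_left_mono power_mono ua u'a) auto
  also have "\<dots> = ((1 + 3 * \<rho>)\<^sup>2 + 1) * l\<^sup>2 * (w ?a)\<^sup>2"
    unfolding power_mult_distrib by (simp only: distrib_left distrib_right mult_ac mult_1_left mult_1_right)
  also have "\<dots> \<le> ((1 + 3 * \<rho>)\<^sup>2 + 1) * l\<^sup>2 * (3 powr \<rho> * l powr (- (\<alpha> + 1 / 2)))\<^sup>2"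
    using w_pos[OF a(1)] by (intro mult_left_mono power_mono wa) auto
  finally have "?e ?a * exp ?C \<le> ((1 + 3 * \<rho>)\<^sup>2 + 1) * l\<^sup>2 * (3 powr \<rho> * l powr (- (\<alpha> + 1 / 2)))\<^sup>2 * exp ?C"
    by (intro mult_right_mono) auto
  also have "\<dots> = (amp * (l * l powr (- (\<alpha> + 1 / 2))))\<^sup>2"
    unfolding amp_def power_mult_distrib by (simp add: mult_ac)
  finally show ?thesis using 1 by linarith
qed

lemma u_bounds:
  assumes l: "l \<ge> 1" and x: "x \<ge> 1 / l"
  shows "norm (u l x) \<le> amp * l powr (- (\<alpha> + 1 / 2))" "norm (u' l x) \<le> l * (amp * l powr (- (\<alpha> + 1 / 2)))"
proof -
  let ?B = "amp * (l * l powr (- (\<alpha> + 1 / 2)))"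
  have B: "?B \<ge> 0" using amp_pos l by simp
  have "(norm (u' l x))\<^sup>2 \<le> ?B\<^sup>2" "(l * norm (u l x))\<^sup>2 \<le> ?B\<^sup>2"
    using u_energy[OF assms] zero_le_power2[of "norm (u' l x)"] zero_le_power2[of "l * norm (u l x)"]
    unfolding power_mult_distrib[of l "norm (u l x)"] by linarith+
  then have "norm (u' l x) \<le> ?B" "l * norm (u l x) \<le> ?B" using B by (blast intro: power2_le_imp_le)+
  then have "norm (u' l x) \<le> l * (amp * l powr (- (\<alpha> + 1 / 2)))"
    "l * norm (u l x) \<le> l * (amp * l powr (- (\<alpha> + 1 / 2)))" by (simp_all only: mult_ac)
  then show "norm (u l x) \<le> amp * l powr (- (\<alpha> + 1 / 2))" "norm (u' l x) \<le> l * (amp * l powr (- (\<alpha> + 1 / 2)))"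
    using l by (simp_all only: mult_le_cancel_left_pos)
qed

text \<open>Below 1/l the estimate comes from w alone, since |\<phi>| \<le> 1 and the exponent
  \<alpha> + 1/2 is positive.\<close>

lemma u_bound_all:
  assumes l: "l \<ge> 1" and x: "x > 0"
  shows "norm (u l x) \<le> amp * l powr (- (\<alpha> + 1 / 2))"
proof (cases "x \<ge> 1 / l")
  case False
  then have xl: "x \<le> 1 / l" and x1: "x \<le> 1" using l
    by (auto intro: order_trans[of x "1 / l" 1])
  have "norm (u l x) \<le> w x" using w_pos[OF x] phi_real_le[of x l] x by (simp add: u_def norm_mult mult_left_le)
  also have "\<dots> \<le> 3 powr \<rho> * x powr (\<alpha> + 1 / 2)" by (rule w_small_bound[OF x x1])
  also have "\<dots> \<le> amp * (1 / l) powr (\<alpha> + 1 / 2)"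
    using xl x alpha amp_ge amp_pos by (intro mult_mono powr_mono2) auto
  also have "\<dots> = amp * l powr (- (\<alpha> + 1 / 2))" using one_divide_powr[of l "\<alpha> + 1 / 2"] l by simp
  finally show ?thesis .
qed (use u_bounds l in auto)

text \<open>Variation of constants: up to oscillating factors the combinations below are
  the coefficients of \<open>u\<close> with respect to the free solutions; they converge at infinity.\<close>

definition amp_fun :: "real \<Rightarrow> real \<Rightarrow> real \<Rightarrow> complex" where
  "amp_fun l k x = cis (- (k * x)) * (u' l x + \<i> * of_real k * u l x)"

lemma amp_fun_deriv:
  assumes "x > 0" "k\<^sup>2 = l\<^sup>2"
  shows "(amp_fun l k has_vector_derivative cis (- (k * x)) * (of_real (pot x) * u l x)) (at x)"
proof -
  have c: "((\<lambda>x. cis (- (k * x))) has_vector_derivative - \<i> * of_real k * cis (- (k * x))) (at x)"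
  proof -
    have "((\<lambda>x. exp (x *\<^sub>R (- \<i> * of_real k))) has_vector_derivative exp (x *\<^sub>R (- \<i> * of_real k)) * (- \<i> * of_real k)) (at x)"
      by (rule exp_scaleR_has_vector_derivative_right)
    moreover have "exp (x *\<^sub>R (- \<i> * of_real k)) = cis (- (k * x))" for x
      unfolding cis_conv_exp by (rule arg_cong[of _ _ exp]) (simp add: scaleR_conv_of_real)
    ultimately show ?thesis by (simp add: mult_ac)
  qed
  have k: "complex_of_real k * complex_of_real k = of_real l * of_real l"
    using assms(2) by (simp add: power2_eq_square flip: of_real_mult)
  have k2: "complex_of_real k * (complex_of_real k * z) = of_real l * (of_real l * z)" for z
    using k by (simp flip: mult.assoc)
  from has_vector_derivative_mult[OF c has_vector_derivative_add[OF u'_deriv[OF assms(1)]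
      has_vector_derivative_mult_right[OF u_deriv[OF assms(1)]]], of l "\<i> * of_real k" l]
  show ?thesis unfolding amp_fun_def[abs_def]
    by (rule has_vector_derivative_eq_rhs) (simp add: power2_eq_square algebra_simps k2)
qed

lemma u_amp_fun:
  assumes "l \<noteq> 0"
  shows "u l x = (cis (l * x) * amp_fun l l x - cis (- (l * x)) * amp_fun l (- l) x) / (2 * \<i> * of_real l)"
proof -
  have "cis (l * x) * cis (- (l * x)) = 1" "cis (- (l * x)) * cis (l * x) = 1" by (simp_all add: cis_mult)
  then have "cis (l * x) * amp_fun l l x - cis (- (l * x)) * amp_fun l (- l) x
     = (u' l x + \<i> * of_real l * u l x) - (u' l x - \<i> * of_real l * u l x)"
    unfolding amp_fun_def mult.assoc[symmetric] by simp
  then show ?thesis using assms by simp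
qed

text \<open>The derivative of \<open>amp_fun\<close> is at most a multiple of x^(-2), so the
  distance to the limit is at most the integral of that bound, a multiple of 1/x. The choices k = l
  and k = - l cover the two waves.\<close>

lemma amp_fun_tendsto:
  assumes l: "l \<ge> 1" and k: "k = l \<or> k = - l"
  obtains L where "norm L \<le> 2 * (l * (amp * l powr (- (\<alpha> + 1 / 2))))"
    "\<And>x. x \<ge> 1 / l \<Longrightarrow> norm (amp_fun l k x - L) \<le> (\<rho> + 2 * \<rho>\<^sup>2) * (amp * l powr (- (\<alpha> + 1 / 2))) / x"
proof -
  let ?B = "amp * l powr (- (\<alpha> + 1 / 2))" and ?C = "\<rho> + 2 * \<rho>\<^sup>2"
  have k2: "k\<^sup>2 = l\<^sup>2" "\<bar>k\<bar> = l" using k l by auto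
  have CB: "?C * ?B \<ge> 0" using rho_pos amp_pos by simp
  have a: "1 / l > 0" using l by simp
  have diff: "norm (amp_fun l k y - amp_fun l k x) \<le> ?C * ?B / x - (?C * ?B / y)" if "1 / l \<le> x" "x \<le> y" for x y
  proof (cases "x = y")
    case False
    then have xy: "x < y" and xp: "x > 0" using that a by linarith+
    have "norm (amp_fun l k y - amp_fun l k x) \<le> (- (?C * ?B / y)) - (- (?C * ?B / x))"
    proof (rule differentiable_bound_general[OF xy, where f' = "\<lambda>z. cis (- (k * z)) * (of_real (pot z) * u l z)"
          and \<phi>' = "\<lambda>z. ?C / z\<^sup>2 * ?B"])
      show "continuous_on {x..y} (amp_fun l k)"
      proof (intro continuous_at_imp_continuous_on ballI)
        fix z assume "z \<in> {x..y}"
        then have "z > 0" using xp by auto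
        from amp_fun_deriv[OF this k2(1)] show "isCont (amp_fun l k) z" by (rule has_vector_derivative_continuous)
      qed
      show "continuous_on {x..y} (\<lambda>z. - (?C * ?B / z))" using xp by (intro continuous_intros) auto
      fix z assume z: "x < z" "z < y"
      then have z0: "z > 0" "1 / l \<le> z" using that xp by linarith+
      show "(amp_fun l k has_vector_derivative cis (- (k * z)) * (of_real (pot z) * u l z)) (at z)"
        by (rule amp_fun_deriv[OF z0(1) k2(1)])
      have "((\<lambda>z. - (?C * ?B / z)) has_real_derivative ?C / z\<^sup>2 * ?B) (at z)"
        using z0 by (auto intro!: derivative_eq_intros simp: power2_eq_square field_simps)
      then show "((\<lambda>z. - (?C * ?B / z)) has_vector_derivative ?C / z\<^sup>2 * ?B) (at z)"
        by (simp add: has_real_derivative_iff_has_vector_derivative)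
      show "norm (cis (- (k * z)) * (of_real (pot z) * u l z)) \<le> ?C / z\<^sup>2 * ?B"
        unfolding norm_mult norm_cis norm_of_real mult_1_left
        using rho_pos by (intro mult_mono pot_bound z0 u_bounds(1) l) auto
    qed
    then show ?thesis by simp
  qed simp
  have "Cauchy (\<lambda>n. amp_fun l k (real (Suc n)))"
  proof (rule metric_CauchyI)
    fix e :: real assume "e > 0"
    obtain N where N: "?C * ?B / e < real N" using reals_Archimedean2 by blast
    have A: "norm (amp_fun l k (real (Suc n)) - amp_fun l k (real (Suc m))) < e" if mn: "N \<le> m" "m \<le> n" for m n
    proof -
      have "1 / l \<le> 1" "1 \<le> real (Suc m)" using l by simp_all
      then have "1 / l \<le> real (Suc m)" by linarith
      then have "norm (amp_fun l k (real (Suc n)) - amp_fun l k (real (Suc m))) \<le> ?C * ?B / real (Suc m) - ?C * ?B / real (Suc n)"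
        using mn by (intro diff) auto
      also have "\<dots> \<le> ?C * ?B / real (Suc m)" using CB by (simp del: of_nat_Suc)
      also have "\<dots> < e"
      proof -
        have "real N < real (Suc m)" using mn by simp
        then have "?C * ?B / e < real (Suc m)" using N by linarith
        then show ?thesis using \<open>e > 0\<close> by (simp add: pos_divide_less_eq mult.commute del: of_nat_Suc)
      qed
      finally show ?thesis .
    qed
    show "\<exists>M. \<forall>m\<ge>M. \<forall>n\<ge>M. dist (amp_fun l k (real (Suc m))) (amp_fun l k (real (Suc n))) < e"
    proof (intro exI[of _ N] allI impI)
      fix m n assume "N \<le> m" "N \<le> n"
      then show "dist (amp_fun l k (real (Suc m))) (amp_fun l k (real (Suc n))) < e"
        using A[of m n] A[of n m] by (cases "m \<le> n") (auto simp: dist_norm norm_minus_commute)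
    qed
  qed
  then obtain L where L: "(\<lambda>n. amp_fun l k (real (Suc n))) \<longlonglongrightarrow> L"
    using Cauchy_convergent_iff convergent_def by blast
  show ?thesis
  proof (rule that)
    show "norm L \<le> 2 * (l * ?B)"
    proof (rule Lim_bounded[OF tendsto_norm[OF L], of 0], intro allI impI)
      fix n :: nat assume "n \<ge> 0"
      have "1 / l \<le> 1" "1 \<le> real (Suc n)" using l by simp_all
      then have x: "1 / l \<le> real (Suc n)" by linarith
      have "norm (amp_fun l k (real (Suc n))) \<le> norm (u' l (real (Suc n))) + l * norm (u l (real (Suc n)))"
        unfolding amp_fun_def norm_mult norm_cis mult_1_left
        by (rule order_trans[OF norm_triangle_ineq]) (simp add: norm_mult k2)
      also have "\<dots> \<le> l * ?B + l * ?B" using l by (intro add_mono mult_left_mono u_bounds x) auto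
      finally show "norm (amp_fun l k (real (Suc n))) \<le> 2 * (l * ?B)" by simp
    qed
    fix x assume x: "x \<ge> 1 / l"
    show "norm (amp_fun l k x - L) \<le> ?C * ?B / x"
    proof (rule Lim_bounded[OF tendsto_norm[OF tendsto_diff[OF tendsto_const L]], of "nat \<lceil>x\<rceil>"], intro allI impI)
      fix n assume "n \<ge> nat \<lceil>x\<rceil>"
      then have n: "x \<le> real (Suc n)" by linarith
      have "norm (amp_fun l k x - amp_fun l k (real (Suc n))) \<le> ?C * ?B / x - ?C * ?B / real (Suc n)"
        using diff[OF x n] by (simp add: norm_minus_commute)
      also have "\<dots> \<le> ?C * ?B / x" using CB by (simp del: of_nat_Suc)
      finally show "norm (amp_fun l k x - amp_fun l k (real (Suc n))) \<le> ?C * ?B / x" .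
    qed
  qed
qed

definition asymp_const :: real where
  "asymp_const = amp * (3 + \<rho> + 2 * \<rho>\<^sup>2)"

lemma asymp_const_pos: "asymp_const > 0"
  unfolding asymp_const_def using amp_pos rho_pos by (intro mult_pos_pos add_pos_nonneg) auto

text \<open>The constants c and d are the rescaled limits of the two amplitudes; they depend on l,
  and only their bounds are recorded. Below x = 1/l the function and each of the two waves are
  separately at most \<open>amp\<close>, which accounts for the minimum and for the 3 in
  \<open>asymp_const\<close>.\<close>

lemma u_asymptotics:
  assumes l: "l \<ge> 1"
  obtains c d where "norm c \<le> asymp_const" "norm d \<le> asymp_const"
    "\<And>x. x > 0 \<Longrightarrow> norm (of_real (l powr (\<alpha> + 1 / 2)) * u l x - (c * cis (l * x) + d * cis (- (l * x))))
        \<le> asymp_const * min 1 (1 / (l * x))"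
proof -
  let ?B = "amp * l powr (- (\<alpha> + 1 / 2))" and ?C = "\<rho> + 2 * \<rho>\<^sup>2" and ?p = "l powr (\<alpha> + 1 / 2)"
  have C: "?C \<ge> 0" using rho_pos by simp
  have "l powr e * l powr (- e) = 1" for e using l by (simp add: powr_minus)
  from this[of "\<alpha> + 1 / 2"] have pB: "?p * ?B = amp"
    by (simp only: mult.left_commute[of _ amp] mult_1_right)
  obtain L1 where L1: "norm L1 \<le> 2 * (l * ?B)" "\<And>x. x \<ge> 1 / l \<Longrightarrow> norm (amp_fun l l x - L1) \<le> ?C * ?B / x"
    using amp_fun_tendsto[OF l, of l] by blast
  obtain L2 where L2: "norm L2 \<le> 2 * (l * ?B)" "\<And>x. x \<ge> 1 / l \<Longrightarrow> norm (amp_fun l (- l) x - L2) \<le> ?C * ?B / x"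
    using amp_fun_tendsto[OF l, of "- l"] by blast
  define c where "c = of_real ?p * L1 / (2 * \<i> * of_real l)"
  define d where "d = - of_real ?p * L2 / (2 * \<i> * of_real l)"
  have cd: "norm c \<le> amp" "norm d \<le> amp"
  proof -
    have e: "?p * (2 * (l * ?B)) = 2 * l * (?p * ?B)" by (simp only: mult_ac)
    have "?p * norm L1 \<le> 2 * l * amp" "?p * norm L2 \<le> 2 * l * amp"
      using mult_left_mono[OF L1(1), of ?p] mult_left_mono[OF L2(1), of ?p] unfolding e pB by simp_all
    then show "norm c \<le> amp" "norm d \<le> amp"
      using l by (auto simp: c_def d_def norm_mult norm_divide divide_le_eq mult_ac)
  qed
  have pu: "norm (of_real ?p * u l x) \<le> amp" if "x > 0" for x
    using mult_left_mono[OF u_bound_all[OF l that], of ?p] unfolding pB norm_mult by simp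
  have K: "amp * 3 \<le> asymp_const" "amp * ?C \<le> asymp_const"
    unfolding asymp_const_def using amp_pos C by (intro mult_left_mono; simp)+
  show ?thesis
  proof (rule that[of c d])
    show "norm c \<le> asymp_const" "norm d \<le> asymp_const" using cd K amp_pos by auto
    fix x :: real assume x: "x > 0"
    let ?D = "of_real ?p * u l x - (c * cis (l * x) + d * cis (- (l * x)))"
    have "norm ?D \<le> norm (of_real ?p * u l x) + norm (c * cis (l * x) + d * cis (- (l * x)))"
      by (rule norm_triangle_ineq4)
    also have "\<dots> \<le> amp + (amp + amp)"
      by (intro add_mono pu x order_trans[OF norm_triangle_ineq]) (simp_all add: norm_mult cd)
    finally have 1: "norm ?D \<le> asymp_const" using K by simp
    show "norm ?D \<le> asymp_const * min 1 (1 / (l * x))"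
    proof (cases "x \<ge> 1 / l")
      case False
      then have "l * x \<le> 1" using l by (simp add: field_simps)
      then have "1 / (l * x) \<ge> 1" using l x by simp
      then have "min 1 (1 / (l * x)) = 1" by simp
      then show ?thesis using 1 by simp
    next
      case True
      then have "l * x \<ge> 1" using l by (simp add: field_simps)
      then have m: "min 1 (1 / (l * x)) = 1 / (l * x)" by (simp add: min_def divide_le_eq)
      have "?D = of_real ?p * (cis (l * x) * (amp_fun l l x - L1) - cis (- (l * x)) * (amp_fun l (- l) x - L2)) / (2 * \<i> * of_real l)"
        unfolding u_amp_fun[of l x, OF less_imp_neq[THEN not_sym, OF less_le_trans[OF zero_less_one l]]] c_def d_def
        using l by (simp add: field_simps)
      also have "norm \<dots> = ?p * norm (cis (l * x) * (amp_fun l l x - L1) - cis (- (l * x)) * (amp_fun l (- l) x - L2)) / (2 * l)"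
        using l by (simp add: norm_mult norm_divide)
      also have "\<dots> \<le> ?p * (?C * ?B / x + ?C * ?B / x) / (2 * l)"
        using l by (intro divide_right_mono mult_left_mono order_trans[OF norm_triangle_ineq4] add_mono)
          (simp_all only: norm_mult norm_cis mult_1_left L1(2)[OF True] L2(2)[OF True], simp_all)
      also have "\<dots> = (?p * ?B) * ?C / (l * x)" using l x by (simp add: field_simps)
      also have "\<dots> = amp * ?C / (l * x)" unfolding pB ..
      also have "\<dots> \<le> asymp_const / (l * x)" using K l x by (intro divide_right_mono) auto
      finally show ?thesis unfolding m by simp
    qed
  qed
qed

end

section \<open>Integral inequalities\<close>

lemma nn_integral_FTC_Ioc:
  fixes F f :: "real \<Rightarrow> real"
  assumes "a < b"
    and "\<And>x. a < x \<Longrightarrow> x < b \<Longrightarrow> (F has_real_derivative f x) (at x)"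
    and "\<And>x. a < x \<Longrightarrow> x < b \<Longrightarrow> isCont f x" "\<And>x. a < x \<Longrightarrow> x < b \<Longrightarrow> 0 \<le> f x"
    and "(F \<longlongrightarrow> A) (at_right a)" "(F \<longlongrightarrow> B) (at_left b)"
  shows "(\<integral>\<^sup>+x. ennreal (f x) * indicator {a<..b} x \<partial>lborel) = ennreal (B - A)"
proof -
  have 1: "set_integrable lborel {a<..<b} f" "(LBINT x=a..b. f x) = B - A"
    using interval_integral_FTC_nonneg[of "ereal a" "ereal b" F f A B] assms
    by (auto simp: ereal_tendsto_simps)
  have "(\<integral>\<^sup>+x. ennreal (f x) * indicator {a<..b} x \<partial>lborel) = (\<integral>\<^sup>+x. ennreal (indicator {a<..<b} x *\<^sub>R f x) \<partial>lborel)"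
    using AE_lborel_singleton[of b]
    by (intro nn_integral_cong_AE) (auto elim!: eventually_mono simp: indicator_def)
  also have "\<dots> = ennreal (LINT x:{a<..<b}|lborel. f x)"
    unfolding set_lebesgue_integral_def using 1(1) assms(4) unfolding set_integrable_def
    by (intro nn_integral_eq_integral) (auto simp: indicator_def)
  also have "(LINT x:{a<..<b}|lborel. f x) = B - A"
    using 1(2) \<open>a < b\<close> by (simp add: interval_lebesgue_integral_def)
  finally show ?thesis .
qed

lemma nn_integral_FTC_Ioi:
  fixes F f :: "real \<Rightarrow> real"
  assumes "\<And>x. a < x \<Longrightarrow> (F has_real_derivative f x) (at x)"
    and "\<And>x. a < x \<Longrightarrow> isCont f x" "\<And>x. a < x \<Longrightarrow> 0 \<le> f x"
    and "(F \<longlongrightarrow> A) (at_right a)" "(F \<longlongrightarrow> B) at_top"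
  shows "(\<integral>\<^sup>+x. ennreal (f x) * indicator {a<..} x \<partial>lborel) = ennreal (B - A)"
proof -
  have 1: "set_integrable lborel {a<..} f" "(LBINT x=a..\<infinity>. f x) = B - A"
    using interval_integral_FTC_nonneg[of "ereal a" \<infinity> F f A B] assms
    by (auto simp: ereal_tendsto_simps)
  have "(\<integral>\<^sup>+x. ennreal (f x) * indicator {a<..} x \<partial>lborel) = (\<integral>\<^sup>+x. ennreal (indicator {a<..} x *\<^sub>R f x) \<partial>lborel)"
    by (intro nn_integral_cong) (auto simp: indicator_def)
  also have "\<dots> = ennreal (LINT x:{a<..}|lborel. f x)"
    unfolding set_lebesgue_integral_def using 1(1) assms(3) unfolding set_integrable_def
    by (intro nn_integral_eq_integral) (auto simp: indicator_def)
  also have "(LINT x:{a<..}|lborel. f x) = B - A"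
    using 1(2) by (simp add: interval_lebesgue_integral_def)
  finally show ?thesis .
qed

lemma nn_integral_powr_Ioc:
  assumes "r > 0" "a \<ge> 0"
  shows "(\<integral>\<^sup>+s. ennreal (r * s powr (r - 1)) * indicator {0<..a} s \<partial>lborel) = ennreal (a powr r)"
proof (cases "a = 0")
  case False
  then have a: "a > 0" using assms by simp
  have "(\<integral>\<^sup>+s. ennreal (r * s powr (r - 1)) * indicator {0<..a} s \<partial>lborel) = ennreal (a powr r - 0)"
  proof (rule nn_integral_FTC_Ioc[OF a, where F = "\<lambda>s. s powr r"])
    show "((\<lambda>s. s powr r) \<longlongrightarrow> 0) (at_right 0)"
      by (rule tendsto_eq_rhs[OF tendsto_powr'[where a = 0 and b = r]])
        (use assms in \<open>auto intro!: tendsto_intros eventually_at_rightI[of 0 1]\<close>)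
    show "((\<lambda>s. s powr r) \<longlongrightarrow> a powr r) (at_left a)" using a by (intro tendsto_intros) auto
  qed (use assms in \<open>auto intro!: has_real_derivative_powr continuous_intros\<close>)
  then show ?thesis by simp
qed simp

text \<open>The antiderivative is 4 / sqrt l * arctan (sqrt (l x)). The kernel depends on l x alone,
  so the weight x powr (-1/2) reproduces itself as l powr (-1/2), the relation that Schur's test
  needs.\<close>

lemma nn_integral_hardy_kernel:
  assumes l: "l > 0"
  shows "(\<integral>\<^sup>+x. ennreal (2 / (1 + l * x) / sqrt x) * indicator {0<..} x \<partial>lborel) = ennreal (2 * pi / sqrt l)"
proof -
  let ?F = "\<lambda>x. 4 / sqrt l * arctan (sqrt (l * x))"
  have "(\<integral>\<^sup>+x. ennreal (2 / (1 + l * x) / sqrt x) * indicator {0<..} x \<partial>lborel) = ennreal (4 / sqrt l * (pi / 2) - 0)"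
  proof (rule nn_integral_FTC_Ioi[where F = ?F])
    fix x :: real assume x: "0 < x"
    have lx: "l * x > 0" using l x by simp
    have "((\<lambda>x. sqrt (l * x)) has_real_derivative l * (inverse (sqrt (l * x)) / 2)) (at x)"
      using DERIV_chain2[OF DERIV_real_sqrt[OF lx] DERIV_cmult_Id[of l]] by (simp add: mult.commute)
    from DERIV_cmult[OF DERIV_chain2[OF DERIV_arctan this], of "4 / sqrt l"]
    show "(?F has_real_derivative 2 / (1 + l * x) / sqrt x) (at x)"
    proof (rule DERIV_cong)
      have e: "4 / r * (inverse D * (r * r * (inverse (r * y) / 2))) = 2 / D / y"
        if "r > 0" "y > 0" "D > 0" for r y D :: real
        using that by (simp add: field_simps)
      have "(sqrt (l * x))\<^sup>2 = l * x" using lx by simp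
      moreover have "sqrt l * sqrt l = l" "sqrt (l * x) = sqrt l * sqrt x"
        using l by (simp_all add: real_sqrt_mult)
      ultimately show "4 / sqrt l * (inverse (1 + (sqrt (l * x))\<^sup>2) * (l * (inverse (sqrt (l * x)) / 2))) = 2 / (1 + l * x) / sqrt x"
        using e[of "sqrt l" "sqrt x" "1 + l * x"] l x lx by (simp add: add_pos_pos)
    qed
    have "1 + l * x \<noteq> 0" using lx by linarith
    then show "isCont (\<lambda>x. 2 / (1 + l * x) / sqrt x) x" using x by (intro continuous_intros) auto
    show "0 \<le> 2 / (1 + l * x) / sqrt x" using lx x by simp
  next
    have "((\<lambda>x. 4 / sqrt l * arctan (sqrt (l * x))) \<longlongrightarrow> 4 / sqrt l * arctan (sqrt (l * 0))) (at_right 0)"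
      by (intro tendsto_intros)
    then show "(?F \<longlongrightarrow> 0) (at_right 0)" by simp
    have "filterlim (\<lambda>x. sqrt (l * x)) at_top at_top"
      by (intro filterlim_compose[OF sqrt_at_top] filterlim_tendsto_pos_mult_at_top[OF tendsto_const l filterlim_ident])
    then have "((\<lambda>x. arctan (sqrt (l * x))) \<longlongrightarrow> pi / 2) at_top"
      by (rule filterlim_compose[OF tendsto_arctan_at_top])
    then show "(?F \<longlongrightarrow> 4 / sqrt l * (pi / 2)) at_top" by (intro tendsto_intros)
  qed
  then show ?thesis by simp
qed

text \<open>Schur's test with the weight \<open>x powr (-1/2)\<close>.\<close>

lemma hardy_kernel_L2:
  fixes H :: "real \<Rightarrow> ennreal"
  assumes [measurable]: "H \<in> borel_measurable borel"
  shows "(\<integral>\<^sup>+l. (\<integral>\<^sup>+x. H x * ennreal (2 / (1 + l * x)) * indicator {0<..} x \<partial>lborel)\<^sup>2 * indicator {0<..} l \<partial>lborel)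
    \<le> ennreal (4 * pi\<^sup>2) * (\<integral>\<^sup>+x. (H x)\<^sup>2 * indicator {0<..} x \<partial>lborel)"
proof -
  let ?k = "\<lambda>l x::real. 2 / (1 + l * x)"
  let ?I = "indicator {0::real<..} :: real \<Rightarrow> ennreal"
  have I2: "(?I x)\<^sup>2 = ?I x" for x by (simp add: indicator_def)
  have 1: "(\<integral>\<^sup>+x. H x * ennreal (?k l x) * ?I x \<partial>lborel)\<^sup>2 \<le>
      (\<integral>\<^sup>+x. (H x)\<^sup>2 * ennreal (?k l x * sqrt x) * ?I x \<partial>lborel) * ennreal (2 * pi / sqrt l)" if l: "l > 0" for l
  proof -
    \<comment> \<open>The kernel is factored as a b so that Cauchy-Schwarz puts sqrt x with H^2 and
      leaves 1 / sqrt x for the explicit integral.\<close>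
    define a where "a x = sqrt (?k l x * sqrt x)" for x
    define b where "b x = sqrt (?k l x / sqrt x)" for x
    have kp: "?k l x > 0" if "x > 0" for x using l that by (simp add: add_pos_pos)
    have ab: "a x * b x = ?k l x" "a x \<ge> 0" "b x \<ge> 0" "(a x)\<^sup>2 = ?k l x * sqrt x" "(b x)\<^sup>2 = ?k l x / sqrt x" if x: "x > 0" for x
    proof -
      have "a x * b x = sqrt ((?k l x * sqrt x) * (?k l x / sqrt x))"
        unfolding a_def b_def by (rule real_sqrt_mult[symmetric])
      also have "(?k l x * sqrt x) * (?k l x / sqrt x) = (?k l x)\<^sup>2"
        using x by (simp add: power2_eq_square)
      finally show "a x * b x = ?k l x" using kp[OF x] by simp
    qed (use kp[OF x] x in \<open>simp_all add: a_def b_def\<close>)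
    have "(\<integral>\<^sup>+x. H x * ennreal (?k l x) * ?I x \<partial>lborel) = (\<integral>\<^sup>+x. (H x * ennreal (a x) * ?I x) * (ennreal (b x) * ?I x) \<partial>lborel)"
    proof (intro nn_integral_cong)
      fix x :: real
      show "H x * ennreal (?k l x) * ?I x = (H x * ennreal (a x) * ?I x) * (ennreal (b x) * ?I x)"
        using ab[of x] by (cases "x > 0") (auto simp: mult.assoc simp flip: ennreal_mult')
    qed
    also have "\<dots>\<^sup>2 \<le> (\<integral>\<^sup>+x. (H x * ennreal (a x) * ?I x)\<^sup>2 \<partial>lborel) * (\<integral>\<^sup>+x. (ennreal (b x) * ?I x)\<^sup>2 \<partial>lborel)"
      by (rule Cauchy_Schwarz_nn_integral) (auto simp: a_def b_def)
    also have "(\<integral>\<^sup>+x. (H x * ennreal (a x) * ?I x)\<^sup>2 \<partial>lborel) = (\<integral>\<^sup>+x. (H x)\<^sup>2 * ennreal (?k l x * sqrt x) * ?I x \<partial>lborel)"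
    proof (intro nn_integral_cong)
      fix x :: real
      show "(H x * ennreal (a x) * ?I x)\<^sup>2 = (H x)\<^sup>2 * ennreal (?k l x * sqrt x) * ?I x"
        using ab[of x] by (cases "x > 0") (auto simp: power_mult_distrib ennreal_power)
    qed
    also have "(\<integral>\<^sup>+x. (ennreal (b x) * ?I x)\<^sup>2 \<partial>lborel) = (\<integral>\<^sup>+x. ennreal (?k l x / sqrt x) * ?I x \<partial>lborel)"
    proof (intro nn_integral_cong)
      fix x :: real
      show "(ennreal (b x) * ?I x)\<^sup>2 = ennreal (?k l x / sqrt x) * ?I x"
        using ab[of x] by (cases "x > 0") (auto simp: power_mult_distrib ennreal_power)
    qed
    also have "\<dots> = ennreal (2 * pi / sqrt l)" by (rule nn_integral_hardy_kernel[OF l])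
    finally show ?thesis .
  qed
  have "(\<integral>\<^sup>+l. (\<integral>\<^sup>+x. H x * ennreal (?k l x) * ?I x \<partial>lborel)\<^sup>2 * ?I l \<partial>lborel)
    \<le> (\<integral>\<^sup>+l. (\<integral>\<^sup>+x. (H x)\<^sup>2 * ennreal (?k l x * sqrt x) * ?I x \<partial>lborel) * (ennreal (2 * pi / sqrt l) * ?I l) \<partial>lborel)"
    using 1 by (intro nn_integral_mono) (auto simp: indicator_def)
  also have "\<dots> = (\<integral>\<^sup>+l. (\<integral>\<^sup>+x. (H x)\<^sup>2 * ennreal (?k l x * sqrt x) * ?I x * (ennreal (2 * pi / sqrt l) * ?I l) \<partial>lborel) \<partial>lborel)"
    by (subst nn_integral_multc) auto
  also have "\<dots> = (\<integral>\<^sup>+x. (\<integral>\<^sup>+l. (H x)\<^sup>2 * ennreal (?k l x * sqrt x) * ?I x * (ennreal (2 * pi / sqrt l) * ?I l) \<partial>lborel) \<partial>lborel)"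
    by (rule lborel_pair.Fubini') simp
  \<comment> \<open>The same integral with x and l exchanged supplies a second factor 2 pi / sqrt x,
    which cancels sqrt x.\<close>
  also have "\<dots> = (\<integral>\<^sup>+x. ennreal (4 * pi\<^sup>2) * ((H x)\<^sup>2 * ?I x) \<partial>lborel)"
  proof (intro nn_integral_cong)
    fix x :: real
    show "(\<integral>\<^sup>+l. (H x)\<^sup>2 * ennreal (?k l x * sqrt x) * ?I x * (ennreal (2 * pi / sqrt l) * ?I l) \<partial>lborel) = ennreal (4 * pi\<^sup>2) * ((H x)\<^sup>2 * ?I x)"
    proof (cases "x > 0")
      case x: True
      have "(\<integral>\<^sup>+l. (H x)\<^sup>2 * ennreal (?k l x * sqrt x) * ?I x * (ennreal (2 * pi / sqrt l) * ?I l) \<partial>lborel)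
        = (\<integral>\<^sup>+l. (H x)\<^sup>2 * ennreal (2 * pi * sqrt x) * (ennreal (2 / (1 + x * l) / sqrt l) * ?I l) \<partial>lborel)"
      proof (intro nn_integral_cong)
        fix l :: real
        have "ennreal (?k l x * sqrt x) * ennreal (2 * pi / sqrt l) = ennreal (2 * pi * sqrt x) * ennreal (2 / (1 + x * l) / sqrt l)"
          if "l > 0" using x that by (simp add: mult_ac flip: ennreal_mult'')
        then show "(H x)\<^sup>2 * ennreal (?k l x * sqrt x) * ?I x * (ennreal (2 * pi / sqrt l) * ?I l)
          = (H x)\<^sup>2 * ennreal (2 * pi * sqrt x) * (ennreal (2 / (1 + x * l) / sqrt l) * ?I l)"
          using x by (cases "l > 0") (simp_all add: mult.assoc)
      qed
      also have "\<dots> = (H x)\<^sup>2 * ennreal (2 * pi * sqrt x) * ennreal (2 * pi / sqrt x)"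
        unfolding nn_integral_hardy_kernel[OF x, symmetric] by (rule nn_integral_cmult) simp
      also have "\<dots> = (H x)\<^sup>2 * ennreal (4 * pi\<^sup>2)"
        using x by (simp add: mult.assoc power2_eq_square flip: ennreal_mult')
      finally show ?thesis using x by (simp add: mult.commute)
    qed simp
  qed
  also have "\<dots> = ennreal (4 * pi\<^sup>2) * (\<integral>\<^sup>+x. (H x)\<^sup>2 * ?I x \<partial>lborel)"
    by (rule nn_integral_cmult) simp
  finally show ?thesis .
qed

text \<open>Fatou's lemma for a pointwise limit; it removes both the Gaussian weights and the
  truncations in x further below.\<close>

lemma nn_integral_le_of_tendsto:
  fixes g :: "'a \<Rightarrow> ennreal"
  assumes "\<And>n. f n \<in> borel_measurable M" "\<And>x. x \<in> space M \<Longrightarrow> (\<lambda>n. f n x) \<longlonglongrightarrow> g x"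
    and "\<And>n. (\<integral>\<^sup>+x. f n x \<partial>M) \<le> C"
  shows "(\<integral>\<^sup>+x. g x \<partial>M) \<le> C"
proof -
  have "(\<integral>\<^sup>+x. g x \<partial>M) = (\<integral>\<^sup>+x. liminf (\<lambda>n. f n x) \<partial>M)"
    by (intro nn_integral_cong) (rule lim_imp_Liminf[symmetric, OF trivial_limit_sequentially assms(2)])
  also have "\<dots> \<le> liminf (\<lambda>n. \<integral>\<^sup>+x. f n x \<partial>M)" by (rule nn_integral_liminf) (rule assms)
  also have "\<dots> \<le> C" by (intro Liminf_le always_eventually allI assms(3)) simp
  finally show ?thesis .
qed

text \<open>A non-integrable \<open>f\<close> has Bochner integral 0 by convention, so the
  inequality covers it too.\<close>

lemma norm_integral_le_nn_integral:
  fixes f :: "'a \<Rightarrow> 'b::{banach, second_countable_topology}"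
  shows "ennreal (norm (integral\<^sup>L M f)) \<le> (\<integral>\<^sup>+x. norm (f x) \<partial>M)"
  by (cases "integrable M f") (auto intro: integral_norm_bound_ennreal simp: not_integrable_integral_eq)

section \<open>Plancherel's inequality by Gaussian regularization\<close>

lemma cis_measurable[measurable]: "cis \<in> borel_measurable borel"
  by (intro borel_measurable_continuous_onI continuous_intros)

text \<open>A bounded kernel and a probability measure keep the product integrable, so Fubini's
  theorem applies.\<close>

lemma integral_swap_bounded:
  fixes h :: "real \<Rightarrow> complex" and b :: "real \<Rightarrow> real \<Rightarrow> complex"
  assumes h: "integrable lborel h" and S: "prob_space S" and sets[measurable_cong]: "sets S = sets borel"
    and b[measurable]: "case_prod b \<in> borel_measurable (borel \<Otimes>\<^sub>M borel)" and B: "\<And>x s. norm (b x s) \<le> B"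
  shows "(LINT s|S. LINT x|lborel. h x * b x s) = (LINT x|lborel. h x * (LINT s|S. b x s))"
proof -
  interpret S: prob_space S by (rule S)
  interpret P: pair_sigma_finite lborel S ..
  have [measurable]: "h \<in> borel_measurable borel" using h by auto
  have B0: "B \<ge> 0" using order_trans[OF norm_ge_zero B[of 0 0]] .
  have "integrable (lborel \<Otimes>\<^sub>M S) (\<lambda>(x, s). h x * b x s)"
  proof (rule integrableI_bounded)
    show "(\<lambda>(x, s). h x * b x s) \<in> borel_measurable (lborel \<Otimes>\<^sub>M S)" by measurable
    have "(\<integral>\<^sup>+z. norm (case z of (x, s) \<Rightarrow> h x * b x s) \<partial>(lborel \<Otimes>\<^sub>M S)) = (\<integral>\<^sup>+x. \<integral>\<^sup>+s. norm (h x * b x s) \<partial>S \<partial>lborel)"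
      by (subst S.nn_integral_fst[symmetric]) (auto simp: case_prod_beta)
    also have "\<dots> \<le> (\<integral>\<^sup>+x. \<integral>\<^sup>+s. ennreal (norm (h x)) * ennreal B \<partial>S \<partial>lborel)"
      using B by (intro nn_integral_mono) (auto simp: norm_mult B0 simp flip: ennreal_mult intro!: mult_left_mono)
    also have "\<dots> = (\<integral>\<^sup>+x. ennreal (norm (h x)) * ennreal B \<partial>lborel)" by (simp add: S.emeasure_space_1)
    also have "\<dots> = (\<integral>\<^sup>+x. ennreal (norm (h x)) \<partial>lborel) * ennreal B" by (rule nn_integral_multc) simp
    also have "\<dots> < \<infinity>" using h by (simp add: integrable_iff_bounded ennreal_mult_less_top)
    finally show "(\<integral>\<^sup>+z. norm (case z of (x, s) \<Rightarrow> h x * b x s) \<partial>(lborel \<Otimes>\<^sub>M S)) < \<infinity>" .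
  qed
  from P.Fubini_integral[OF this] show ?thesis by simp
qed

text \<open>Unnormalized and with positive sign, to match the waves \<open>cis (l * x)\<close>; the
  Plancherel constant is then 2 pi.\<close>

definition ft :: "(real \<Rightarrow> complex) \<Rightarrow> real \<Rightarrow> complex" where
  "ft h t = (LINT x|lborel. h x * cis (t * x))"

lemma ft_measurable[measurable]:
  assumes [measurable]: "h \<in> borel_measurable borel"
  shows "ft h \<in> borel_measurable borel"
  unfolding ft_def[abs_def] by measurable

lemma nn_integral_gaussian:
  assumes "\<sigma> > 0"
  shows "(\<integral>\<^sup>+x. ennreal (exp (- (\<sigma> * x)\<^sup>2 / 2)) \<partial>lborel) = ennreal (sqrt (2 * pi) / \<sigma>)"
proof -
  have "(\<integral>\<^sup>+x. ennreal (std_normal_density x) \<partial>lborel) = ennreal (LINT x|lborel. std_normal_density x)"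
    by (rule nn_integral_eq_integral) auto
  then have "1 = (\<integral>\<^sup>+x. ennreal (std_normal_density x) \<partial>lborel)" by simp
  also have "\<dots> = ennreal \<bar>\<sigma>\<bar> * (\<integral>\<^sup>+x. ennreal (std_normal_density (0 + \<sigma> * x)) \<partial>lborel)"
    by (rule nn_integral_real_affine) (use assms in auto)
  finally have 1: "1 = ennreal \<sigma> * (\<integral>\<^sup>+x. ennreal (std_normal_density (\<sigma> * x)) \<partial>lborel)" using assms by simp
  have "(\<integral>\<^sup>+x. ennreal (exp (- (\<sigma> * x)\<^sup>2 / 2)) \<partial>lborel) = (\<integral>\<^sup>+x. ennreal (sqrt (2 * pi)) * ennreal (std_normal_density (\<sigma> * x)) \<partial>lborel)"
    by (intro nn_integral_cong) (simp add: std_normal_density_def flip: ennreal_mult')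
  also have "\<dots> = ennreal (sqrt (2 * pi)) * (\<integral>\<^sup>+x. ennreal (std_normal_density (\<sigma> * x)) \<partial>lborel)"
    by (rule nn_integral_cmult) simp
  also have "\<dots> = ennreal (sqrt (2 * pi) / \<sigma>) * (ennreal \<sigma> * (\<integral>\<^sup>+x. ennreal (std_normal_density (\<sigma> * x)) \<partial>lborel))"
    using assms by (simp add: mult.assoc[symmetric] flip: ennreal_mult'')
  also have "\<dots> = ennreal (sqrt (2 * pi) / \<sigma>)" unfolding 1[symmetric] by simp
  finally show ?thesis .
qed

text \<open>With a Gaussian weight, \<open>ft h * cnj (ft h)\<close> turns into the quadratic form of a positive
  convolution kernel, which the Schur test bounds.\<close>

lemma ft_gaussian_L2:
  assumes h: "integrable lborel h" and \<sigma>: "\<sigma> > 0"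
  shows "(\<integral>\<^sup>+s. ennreal ((norm (ft h (\<sigma> * s)))\<^sup>2) \<partial>std_normal_distribution)
    \<le> ennreal (sqrt (2 * pi) / \<sigma>) * (\<integral>\<^sup>+x. ennreal ((norm (h x))\<^sup>2) \<partial>lborel)"
proof -
  let ?S = "std_normal_distribution"
  interpret S: real_distribution ?S by (rule real_dist_normal_dist)
  have ps: "prob_space ?S" by (rule S.prob_space_axioms)
  have sets: "sets ?S = sets borel" by simp
  have hm[measurable]: "h \<in> borel_measurable borel" using h by auto
  define \<psi> where "\<psi> s = ft h (\<sigma> * s)" for s
  have \<psi>m[measurable]: "\<psi> \<in> borel_measurable borel" unfolding \<psi>_def by measurable
  define B where "B = (LINT x|lborel. norm (h x))"
  have \<psi>B: "norm (\<psi> s) \<le> B" for s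
    unfolding \<psi>_def ft_def B_def by (rule order_trans[OF integral_norm_bound]) (simp add: norm_mult)
  have B0: "B \<ge> 0" using order_trans[OF norm_ge_zero \<psi>B[of 0]] .
  let ?e = "\<lambda>x y. exp (- (\<sigma> * (x - y))\<^sup>2 / 2)"
  \<comment> \<open>The Gaussian average over the frequency is the characteristic function of the
    normal law, which is again a Gaussian in x - y.\<close>
  have inner: "(LINT s|?S. \<psi> s * cis (- (\<sigma> * s * y))) = (LINT x|lborel. h x * of_real (?e x y))" for y
  proof -
    have "\<psi> s * cis (- (\<sigma> * s * y)) = (LINT x|lborel. h x * cis (\<sigma> * (x - y) * s))" for s
    proof -
      have "\<psi> s * cis (- (\<sigma> * s * y)) = (LINT x|lborel. h x * cis (\<sigma> * s * x) * cis (- (\<sigma> * s * y)))"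
        unfolding \<psi>_def ft_def by simp
      also have "\<dots> = (LINT x|lborel. h x * cis (\<sigma> * (x - y) * s))"
        by (simp add: mult.assoc cis_mult) (simp add: algebra_simps)
      finally show ?thesis .
    qed
    moreover have "(LINT s|?S. cis (\<sigma> * (x - y) * s)) = of_real (?e x y)" for x
      using fun_cong[OF char_std_normal_distribution, of "\<sigma> * (x - y)"]
      unfolding char_def by (simp add: cis_conv_exp)
    moreover have "(LINT s|?S. LINT x|lborel. h x * cis (\<sigma> * (x - y) * s)) = (LINT x|lborel. h x * (LINT s|?S. cis (\<sigma> * (x - y) * s)))"
      by (rule integral_swap_bounded[OF h ps sets, where B = 1]) auto
    ultimately show ?thesis by simp
  qed
  have int: "integrable ?S (\<lambda>s. (norm (\<psi> s))\<^sup>2)"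
    by (rule S.integrable_const_bound[where B = "B\<^sup>2"]) (use \<psi>B in \<open>auto intro!: power_mono\<close>)
  have "complex_of_real (LINT s|?S. (norm (\<psi> s))\<^sup>2) = (LINT s|?S. LINT y|lborel. cnj (h y) * (\<psi> s * cis (- (\<sigma> * s * y))))"
  proof -
    have "complex_of_real ((norm (\<psi> s))\<^sup>2) = (LINT y|lborel. cnj (h y) * (\<psi> s * cis (- (\<sigma> * s * y))))" for s
    proof -
      have "cnj (\<psi> s) = (LINT y|lborel. cnj (h y * cis (\<sigma> * s * y)))"
        unfolding \<psi>_def ft_def by (rule Bochner_Integration.integral_cnj[symmetric])
      also have "\<dots> = (LINT y|lborel. cnj (h y) * cis (- (\<sigma> * s * y)))" by (simp add: cis_cnj)
      finally have "complex_of_real ((norm (\<psi> s))\<^sup>2) = \<psi> s * (LINT y|lborel. cnj (h y) * cis (- (\<sigma> * s * y)))"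
        using complex_norm_square[of "\<psi> s"] by simp
      also have "\<dots> = (LINT y|lborel. cnj (h y) * (\<psi> s * cis (- (\<sigma> * s * y))))"
        by (simp add: mult_ac flip: integral_mult_right_zero)
      finally show ?thesis .
    qed
    then show ?thesis unfolding integral_complex_of_real[symmetric] by (simp only:)
  qed
  also have "\<dots> = (LINT y|lborel. cnj (h y) * (LINT s|?S. \<psi> s * cis (- (\<sigma> * s * y))))"
    by (rule integral_swap_bounded[OF _ ps sets, where B = B]) (use h \<psi>B in \<open>auto simp: norm_mult\<close>)
  finally have eq: "complex_of_real (LINT s|?S. (norm (\<psi> s))\<^sup>2) = (LINT y|lborel. cnj (h y) * (LINT x|lborel. h x * of_real (?e x y)))"
    unfolding inner .
  have i1: "(\<integral>\<^sup>+x. ennreal ((norm (h y))\<^sup>2 / 2) * ennreal (?e x y) \<partial>lborel) = ennreal ((norm (h y))\<^sup>2 / 2) * ennreal (sqrt (2 * pi) / \<sigma>)" for y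
  proof -
    have "(\<integral>\<^sup>+x. ennreal (?e x y) \<partial>lborel) = ennreal \<bar>1\<bar> * (\<integral>\<^sup>+x. ennreal (?e (y + 1 * x) y) \<partial>lborel)"
      by (rule nn_integral_real_affine) auto
    then show ?thesis using nn_integral_gaussian[OF \<sigma>] by (simp add: nn_integral_cmult)
  qed
  have i2: "(\<integral>\<^sup>+y. ennreal ((norm (h x))\<^sup>2 / 2) * ennreal (?e x y) \<partial>lborel) = ennreal ((norm (h x))\<^sup>2 / 2) * ennreal (sqrt (2 * pi) / \<sigma>)" for x
  proof -
    have "(\<integral>\<^sup>+y. ennreal (?e x y) \<partial>lborel) = ennreal \<bar>1\<bar> * (\<integral>\<^sup>+y. ennreal (?e x (x + 1 * y)) \<partial>lborel)"
      by (rule nn_integral_real_affine) auto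
    then show ?thesis using nn_integral_gaussian[OF \<sigma>] by (simp add: nn_integral_cmult)
  qed
  have "(\<integral>\<^sup>+s. ennreal ((norm (\<psi> s))\<^sup>2) \<partial>?S) = ennreal (LINT s|?S. (norm (\<psi> s))\<^sup>2)"
    by (rule nn_integral_eq_integral[OF int]) auto
  also have "\<dots> = ennreal (norm (complex_of_real (LINT s|?S. (norm (\<psi> s))\<^sup>2)))"
    by (simp only: norm_of_real) (simp add: integral_nonneg_AE)
  also have "\<dots> \<le> (\<integral>\<^sup>+y. norm (cnj (h y) * (LINT x|lborel. h x * of_real (?e x y))) \<partial>lborel)"
    unfolding eq by (rule norm_integral_le_nn_integral)
  also have "\<dots> \<le> (\<integral>\<^sup>+y. ennreal (norm (h y)) * (\<integral>\<^sup>+x. ennreal (norm (h x)) * ennreal (?e x y) \<partial>lborel) \<partial>lborel)"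
  proof (intro nn_integral_mono)
    fix y
    have "ennreal (norm (LINT x|lborel. h x * of_real (?e x y))) \<le> (\<integral>\<^sup>+x. norm (h x * of_real (?e x y)) \<partial>lborel)"
      by (rule norm_integral_le_nn_integral)
    also have "\<dots> = (\<integral>\<^sup>+x. ennreal (norm (h x)) * ennreal (?e x y) \<partial>lborel)"
      by (intro nn_integral_cong) (simp add: norm_mult ennreal_mult)
    finally show "ennreal (norm (cnj (h y) * (LINT x|lborel. h x * of_real (?e x y)))) \<le>
       ennreal (norm (h y)) * (\<integral>\<^sup>+x. ennreal (norm (h x)) * ennreal (?e x y) \<partial>lborel)"
      by (simp add: norm_mult ennreal_mult mult_left_mono)
  qed
  also have "\<dots> = (\<integral>\<^sup>+y. (\<integral>\<^sup>+x. ennreal (norm (h y)) * (ennreal (norm (h x)) * ennreal (?e x y)) \<partial>lborel) \<partial>lborel)"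
    by (simp add: nn_integral_cmult)
  \<comment> \<open>Schur's test in its simplest form: the kernel is symmetric, so |h(x) h(y)| is
    bounded by half the sum of the squares, and each half is integrated against the mass sqrt (2 pi)
    / \<sigma> of the kernel.\<close>
  also have "\<dots> \<le> (\<integral>\<^sup>+y. (\<integral>\<^sup>+x. ennreal ((norm (h y))\<^sup>2 / 2) * ennreal (?e x y) + ennreal ((norm (h x))\<^sup>2 / 2) * ennreal (?e x y) \<partial>lborel) \<partial>lborel)"
  proof (intro nn_integral_mono)
    fix x y
    have "norm (h y) * (norm (h x) * ?e x y) \<le> (norm (h y))\<^sup>2 / 2 * ?e x y + (norm (h x))\<^sup>2 / 2 * ?e x y"
    proof -
      have "norm (h y) * norm (h x) \<le> (norm (h y))\<^sup>2 / 2 + (norm (h x))\<^sup>2 / 2"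
        using sum_squares_bound[of "norm (h y)" "norm (h x)"] by simp
      then have "norm (h y) * norm (h x) * ?e x y \<le> ((norm (h y))\<^sup>2 / 2 + (norm (h x))\<^sup>2 / 2) * ?e x y"
        by (intro mult_right_mono) auto
      then show ?thesis by (simp add: algebra_simps)
    qed
    then show "ennreal (norm (h y)) * (ennreal (norm (h x)) * ennreal (?e x y)) \<le> ennreal ((norm (h y))\<^sup>2 / 2) * ennreal (?e x y) + ennreal ((norm (h x))\<^sup>2 / 2) * ennreal (?e x y)"
      by (simp flip: ennreal_mult ennreal_plus)
  qed
  also have "\<dots> = (\<integral>\<^sup>+y. (\<integral>\<^sup>+x. ennreal ((norm (h y))\<^sup>2 / 2) * ennreal (?e x y) \<partial>lborel) \<partial>lborel) +
      (\<integral>\<^sup>+y. (\<integral>\<^sup>+x. ennreal ((norm (h x))\<^sup>2 / 2) * ennreal (?e x y) \<partial>lborel) \<partial>lborel)"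
    by (simp add: nn_integral_add)
  also have "(\<integral>\<^sup>+y. (\<integral>\<^sup>+x. ennreal ((norm (h x))\<^sup>2 / 2) * ennreal (?e x y) \<partial>lborel) \<partial>lborel)
     = (\<integral>\<^sup>+x. (\<integral>\<^sup>+y. ennreal ((norm (h x))\<^sup>2 / 2) * ennreal (?e x y) \<partial>lborel) \<partial>lborel)"
    by (rule lborel_pair.Fubini') simp
  finally have "(\<integral>\<^sup>+s. ennreal ((norm (\<psi> s))\<^sup>2) \<partial>?S) \<le> (\<integral>\<^sup>+x. ennreal ((norm (h x))\<^sup>2 / 2) * ennreal (sqrt (2 * pi) / \<sigma>) \<partial>lborel) + (\<integral>\<^sup>+x. ennreal ((norm (h x))\<^sup>2 / 2) * ennreal (sqrt (2 * pi) / \<sigma>) \<partial>lborel)"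
    unfolding i1 i2 .
  also have "(\<integral>\<^sup>+x. ennreal ((norm (h x))\<^sup>2 / 2) * ennreal (sqrt (2 * pi) / \<sigma>) \<partial>lborel) + (\<integral>\<^sup>+x. ennreal ((norm (h x))\<^sup>2 / 2) * ennreal (sqrt (2 * pi) / \<sigma>) \<partial>lborel)
     = (\<integral>\<^sup>+x. ennreal (sqrt (2 * pi) / \<sigma>) * ennreal ((norm (h x))\<^sup>2) \<partial>lborel)"
    using \<sigma> by (subst nn_integral_add[symmetric]) (auto intro!: nn_integral_cong simp flip: ennreal_mult ennreal_plus)
  also have "\<dots> = ennreal (sqrt (2 * pi) / \<sigma>) * (\<integral>\<^sup>+x. ennreal ((norm (h x))\<^sup>2) \<partial>lborel)"
    by (rule nn_integral_cmult) simp
  finally show ?thesis unfolding \<psi>_def .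
qed

text \<open>Rescaling by \<open>Suc n\<close> turns the weight into the standard normal density. The
  factors Suc n, sqrt (2 pi) and sqrt (2 pi) / Suc n multiply to 2 pi for every n, so the weight can
  be removed by Fatou's lemma.\<close>

theorem plancherel_le:
  assumes h: "integrable lborel h"
  shows "(\<integral>\<^sup>+t. ennreal ((norm (ft h t))\<^sup>2) \<partial>lborel) \<le> ennreal (2 * pi) * (\<integral>\<^sup>+x. ennreal ((norm (h x))\<^sup>2) \<partial>lborel)"
proof (rule nn_integral_le_of_tendsto)
  have [measurable]: "h \<in> borel_measurable borel" using h by auto
  let ?f = "\<lambda>n t. ennreal ((norm (ft h t))\<^sup>2 * exp (- (t / real (Suc n))\<^sup>2 / 2))"
  show "?f n \<in> borel_measurable lborel" for n by measurable
  show "(\<lambda>n. ?f n t) \<longlonglongrightarrow> ennreal ((norm (ft h t))\<^sup>2)" for t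
  proof -
    have "(\<lambda>n. t / real (Suc n)) \<longlonglongrightarrow> 0"
      by (rule LIMSEQ_Suc) (rule lim_const_over_n)
    then have "(\<lambda>n. (norm (ft h t))\<^sup>2 * exp (- (t / real (Suc n))\<^sup>2 / 2)) \<longlonglongrightarrow> (norm (ft h t))\<^sup>2 * exp (- 0\<^sup>2 / 2)"
      by (intro tendsto_intros) auto
    then show ?thesis by (intro tendsto_ennrealI) simp
  qed
  fix n
  let ?s = "real (Suc n)"
  have s: "?s > 0" by simp
  have "(\<integral>\<^sup>+t. ?f n t \<partial>lborel) = ennreal \<bar>?s\<bar> * (\<integral>\<^sup>+t. ?f n (0 + ?s * t) \<partial>lborel)"
    by (rule nn_integral_real_affine) auto
  also have "(\<integral>\<^sup>+t. ?f n (0 + ?s * t) \<partial>lborel) = (\<integral>\<^sup>+t. ennreal (sqrt (2 * pi)) * (ennreal (std_normal_density t) * ennreal ((norm (ft h (?s * t)))\<^sup>2)) \<partial>lborel)"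
  proof (intro nn_integral_cong)
    fix t
    have "?s * t / ?s = t" using s by simp
    then show "?f n (0 + ?s * t) = ennreal (sqrt (2 * pi)) * (ennreal (std_normal_density t) * ennreal ((norm (ft h (?s * t)))\<^sup>2))"
      unfolding add_0 by (simp add: std_normal_density_def del: of_nat_Suc flip: ennreal_mult ennreal_mult')
  qed
  also have "\<dots> = ennreal (sqrt (2 * pi)) * (\<integral>\<^sup>+t. ennreal (std_normal_density t) * ennreal ((norm (ft h (?s * t)))\<^sup>2) \<partial>lborel)"
    by (rule nn_integral_cmult) measurable
  also have "(\<integral>\<^sup>+t. ennreal (std_normal_density t) * ennreal ((norm (ft h (?s * t)))\<^sup>2) \<partial>lborel) = (\<integral>\<^sup>+t. ennreal ((norm (ft h (?s * t)))\<^sup>2) \<partial>std_normal_distribution)"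
    by (rule nn_integral_density[symmetric]) measurable
  also have "ennreal \<bar>?s\<bar> * (ennreal (sqrt (2 * pi)) * (\<integral>\<^sup>+t. ennreal ((norm (ft h (?s * t)))\<^sup>2) \<partial>std_normal_distribution))
    \<le> ennreal \<bar>?s\<bar> * (ennreal (sqrt (2 * pi)) * (ennreal (sqrt (2 * pi) / ?s) * (\<integral>\<^sup>+x. ennreal ((norm (h x))\<^sup>2) \<partial>lborel)))"
    by (intro mult_left_mono ft_gaussian_L2 h s) auto
  also have "\<dots> = (ennreal \<bar>?s\<bar> * (ennreal (sqrt (2 * pi)) * ennreal (sqrt (2 * pi) / ?s))) * (\<integral>\<^sup>+x. ennreal ((norm (h x))\<^sup>2) \<partial>lborel)"
    by (simp only: mult.assoc)
  also have "ennreal \<bar>?s\<bar> * (ennreal (sqrt (2 * pi)) * ennreal (sqrt (2 * pi) / ?s)) = ennreal (2 * pi)"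
    by (simp del: of_nat_Suc flip: ennreal_mult ennreal_mult')
  finally show "(\<integral>\<^sup>+t. ?f n t \<partial>lborel) \<le> ennreal (2 * pi) * (\<integral>\<^sup>+x. ennreal ((norm (h x))\<^sup>2) \<partial>lborel)" .
qed

text \<open>Interpolation between \<open>L1 -> Linf\<close> (constant \<open>A\<close>) and \<open>L2 -> L2\<close> (constant \<open>B\<close>), for the
  image \<open>F\<close> of a fixed \<open>f\<close>; \<open>G t\<close> is the image of the truncation of \<open>f\<close> at height \<open>t\<close>.\<close>

lemma marcinkiewicz:
  fixes f :: "'a \<Rightarrow> complex" and F :: "'b \<Rightarrow> complex" and G :: "real \<Rightarrow> 'b \<Rightarrow> complex"
  assumes "sigma_finite_measure M" "sigma_finite_measure N"
    and f[measurable]: "f \<in> borel_measurable M" and F[measurable]: "F \<in> borel_measurable N"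
    and G[measurable]: "\<And>t. t > 0 \<Longrightarrow> G t \<in> borel_measurable N"
    and p: "1 < p" "p < 2" and q: "q = p / (p - 1)" and A: "A > 0" and B: "B \<ge> 0"
    and \<Phi>: "(\<integral>\<^sup>+x. ennreal (norm (f x) powr p) \<partial>M) = ennreal \<Phi>" "\<Phi> > 0"
    and L1: "\<And>t y. t > 0 \<Longrightarrow> y \<in> space N \<Longrightarrow> ennreal (norm (F y - G t y)) \<le> ennreal A * (\<integral>\<^sup>+x. ennreal (norm (f x)) * indicator {x. norm (f x) > t} x \<partial>M)"
    and L2: "\<And>t. t > 0 \<Longrightarrow> (\<integral>\<^sup>+y. ennreal ((norm (G t y))\<^sup>2) \<partial>N) \<le> ennreal B * (\<integral>\<^sup>+x. ennreal ((norm (f x))\<^sup>2) * indicator {x. norm (f x) \<le> t} x \<partial>M)"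
  shows "(\<integral>\<^sup>+y. ennreal (norm (F y) powr q) \<partial>N) \<le> ennreal (4 * q * B * (2 * A) powr (q - 2) / (q - 2) * \<Phi> powr (q - 1))"
proof -
  interpret M: sigma_finite_measure M by fact
  interpret N: sigma_finite_measure N by fact
  interpret PN: pair_sigma_finite N lborel ..
  interpret PM: pair_sigma_finite M lborel ..
  have q2: "q > 2" using p unfolding q by (simp add: less_divide_eq)
  have pq: "(p - 1) * (q - 1) = 1" using p unfolding q by (simp add: field_simps)
  define K where "K = 2 * A * \<Phi>"
  have K: "K > 0" using A \<Phi> by (simp add: K_def)
  \<comment> \<open>The truncation height varies with the level s: it solves \<tau> powr (1 - p) = s
    / K, and K = 2 A \<Phi> makes the \<open>L1\<close> part at most s / 2, so that the level set is
    governed by \<open>G (\<tau> s)\<close> alone.\<close>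
  define \<tau> where "\<tau> s = (K / s) powr (1 / (p - 1))" for s
  have \<tau>: "\<tau> s > 0" if "s > 0" for s using K that by (simp add: \<tau>_def)
  have trunc: "norm (F y - G (\<tau> s) y) \<le> s / 2" if s: "s > 0" and y: "y \<in> space N" for s y
  proof -
    have "(\<integral>\<^sup>+x. ennreal (norm (f x)) * indicator {x. norm (f x) > \<tau> s} x \<partial>M) \<le> (\<integral>\<^sup>+x. ennreal (\<tau> s powr (1 - p)) * ennreal (norm (f x) powr p) \<partial>M)"
    proof (intro nn_integral_mono)
      fix x
      show "ennreal (norm (f x)) * indicator {x. norm (f x) > \<tau> s} x \<le> ennreal (\<tau> s powr (1 - p)) * ennreal (norm (f x) powr p)"
      proof (cases "norm (f x) > \<tau> s")
        case True
        then have "norm (f x) > 0" using \<tau>[OF s] by linarith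
        then have "norm (f x) = norm (f x) powr (1 - p) * norm (f x) powr p" by (simp flip: powr_add)
        also have "\<dots> \<le> \<tau> s powr (1 - p) * norm (f x) powr p"
          using True \<tau>[OF s] p by (intro mult_right_mono powr_mono2') auto
        finally show ?thesis using True by (simp flip: ennreal_mult)
      qed simp
    qed
    also have "\<dots> = ennreal (\<tau> s powr (1 - p)) * ennreal \<Phi>" using \<Phi> by (simp add: nn_integral_cmult)
    also have "\<tau> s powr (1 - p) = s / K"
    proof -
      have "\<tau> s powr (1 - p) = (K / s) powr (1 / (p - 1) * (1 - p))" by (simp add: \<tau>_def powr_powr)
      also have "1 / (p - 1) * (1 - p) = -1" using p by (simp add: field_simps)
      finally show ?thesis using K s by (simp add: powr_minus_divide)
    qed
    finally have "ennreal (norm (F y - G (\<tau> s) y)) \<le> ennreal A * (ennreal (s / K) * ennreal \<Phi>)"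
      using L1[OF \<tau>[OF s] y] by (meson mult_left_mono order_trans zero_le)
    also have "\<dots> = ennreal (s / 2)"
      using A \<Phi>(2) s K by (simp add: K_def flip: ennreal_mult)
    finally show ?thesis using s by simp
  qed
  \<comment> \<open>Chebyshev's inequality at height s / 2 for the truncated part, whence the 4 in
    the final constant.\<close>
  have level: "(\<integral>\<^sup>+y. indicator {y. s \<le> norm (F y)} y \<partial>N) \<le> ennreal (4 / s\<^sup>2) * (ennreal B * (\<integral>\<^sup>+x. ennreal ((norm (f x))\<^sup>2) * indicator {x. norm (f x) \<le> \<tau> s} x \<partial>M))"
    if s: "s > 0" for s
  proof -
    have [measurable]: "G (\<tau> s) \<in> borel_measurable N" by (rule G[OF \<tau>[OF s]])
    have "(\<integral>\<^sup>+y. indicator {y. s \<le> norm (F y)} y \<partial>N) \<le> (\<integral>\<^sup>+y. ennreal (4 / s\<^sup>2) * ennreal ((norm (G (\<tau> s) y))\<^sup>2) \<partial>N)"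
    proof (intro nn_integral_mono)
      fix y assume y: "y \<in> space N"
      show "indicator {y. s \<le> norm (F y)} y \<le> ennreal (4 / s\<^sup>2) * ennreal ((norm (G (\<tau> s) y))\<^sup>2)"
      proof (cases "s \<le> norm (F y)")
        case True
        have "norm (F y) \<le> norm (F y - G (\<tau> s) y) + norm (G (\<tau> s) y)" using norm_triangle_ineq[of "F y - G (\<tau> s) y" "G (\<tau> s) y"] by simp
        then have "s / 2 \<le> norm (G (\<tau> s) y)" using trunc[OF s y] True by linarith
        then have "(s / 2)\<^sup>2 \<le> (norm (G (\<tau> s) y))\<^sup>2" using s by (intro power_mono) auto
        then have "1 \<le> 4 / s\<^sup>2 * (norm (G (\<tau> s) y))\<^sup>2" using s by (simp add: field_simps)
        then have "ennreal 1 \<le> ennreal (4 / s\<^sup>2 * (norm (G (\<tau> s) y))\<^sup>2)" by (rule ennreal_leI)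
        also have "\<dots> = ennreal (4 / s\<^sup>2) * ennreal ((norm (G (\<tau> s) y))\<^sup>2)" by (rule ennreal_mult) auto
        finally show ?thesis using True by simp
      qed simp
    qed
    also have "\<dots> = ennreal (4 / s\<^sup>2) * (\<integral>\<^sup>+y. ennreal ((norm (G (\<tau> s) y))\<^sup>2) \<partial>N)" by (rule nn_integral_cmult) simp
    also have "\<dots> \<le> ennreal (4 / s\<^sup>2) * (ennreal B * (\<integral>\<^sup>+x. ennreal ((norm (f x))\<^sup>2) * indicator {x. norm (f x) \<le> \<tau> s} x \<partial>M))"
      by (intro mult_left_mono L2 \<tau> s) auto
    finally show ?thesis .
  qed
  \<comment> \<open>Layer-cake formula, followed by Tonelli's theorem in (s, y).\<close>
  have "(\<integral>\<^sup>+y. ennreal (norm (F y) powr q) \<partial>N) = (\<integral>\<^sup>+y. \<integral>\<^sup>+s. ennreal (q * s powr (q - 1)) * indicator {0<..norm (F y)} s \<partial>lborel \<partial>N)"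
    using q2 by (intro nn_integral_cong) (simp add: nn_integral_powr_Ioc)
  also have "\<dots> = (\<integral>\<^sup>+y. \<integral>\<^sup>+s. (if 0 < s \<and> s \<le> norm (F y) then ennreal (q * s powr (q - 1)) else 0) \<partial>lborel \<partial>N)"
    by (intro nn_integral_cong) (auto simp: indicator_def)
  also have "\<dots> = (\<integral>\<^sup>+s. \<integral>\<^sup>+y. (if 0 < s \<and> s \<le> norm (F y) then ennreal (q * s powr (q - 1)) else 0) \<partial>N \<partial>lborel)"
    by (rule PN.Fubini'[symmetric]) measurable
  also have "\<dots> = (\<integral>\<^sup>+s. (if 0 < s then ennreal (q * s powr (q - 1)) * (\<integral>\<^sup>+y. indicator {y. s \<le> norm (F y)} y \<partial>N) else 0) \<partial>lborel)"
  proof (intro nn_integral_cong)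
    fix s :: real
    have "(\<integral>\<^sup>+y. (if 0 < s \<and> s \<le> norm (F y) then ennreal (q * s powr (q - 1)) else 0) \<partial>N) = (\<integral>\<^sup>+y. ennreal (q * s powr (q - 1)) * indicator {y\<in>space N. s \<le> norm (F y)} y \<partial>N)" if "s > 0"
      using that by (intro nn_integral_cong) (auto simp: indicator_def)
    also have "\<dots> = ennreal (q * s powr (q - 1)) * (\<integral>\<^sup>+y. indicator {y\<in>space N. s \<le> norm (F y)} y \<partial>N)"
      by (rule nn_integral_cmult) simp
    also have "(\<integral>\<^sup>+y. indicator {y\<in>space N. s \<le> norm (F y)} y \<partial>N) = (\<integral>\<^sup>+y. indicator {y. s \<le> norm (F y)} y \<partial>N)"
      by (intro nn_integral_cong) (auto simp: indicator_def)
    finally show "(\<integral>\<^sup>+y. (if 0 < s \<and> s \<le> norm (F y) then ennreal (q * s powr (q - 1)) else 0) \<partial>N)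
       = (if 0 < s then ennreal (q * s powr (q - 1)) * (\<integral>\<^sup>+y. indicator {y. s \<le> norm (F y)} y \<partial>N) else 0)"
      by (cases "s > 0") auto
  qed
  also have "\<dots> \<le> (\<integral>\<^sup>+s. (if 0 < s then ennreal (q * s powr (q - 1)) * (ennreal (4 / s\<^sup>2) * (ennreal B * (\<integral>\<^sup>+x. ennreal ((norm (f x))\<^sup>2) * indicator {x. norm (f x) \<le> \<tau> s} x \<partial>M))) else 0) \<partial>lborel)"
    using level by (intro nn_integral_mono) (auto intro!: mult_left_mono)
  also have "\<dots> = (\<integral>\<^sup>+s. \<integral>\<^sup>+x. (if 0 < s \<and> norm (f x) \<le> \<tau> s then ennreal (4 * q * B * s powr (q - 3) * (norm (f x))\<^sup>2) else 0) \<partial>M \<partial>lborel)"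
  proof (intro nn_integral_cong)
    fix s :: real
    show "(if 0 < s then ennreal (q * s powr (q - 1)) * (ennreal (4 / s\<^sup>2) * (ennreal B * (\<integral>\<^sup>+x. ennreal ((norm (f x))\<^sup>2) * indicator {x. norm (f x) \<le> \<tau> s} x \<partial>M))) else 0)
      = (\<integral>\<^sup>+x. (if 0 < s \<and> norm (f x) \<le> \<tau> s then ennreal (4 * q * B * s powr (q - 3) * (norm (f x))\<^sup>2) else 0) \<partial>M)"
    proof (cases "s > 0")
      case s: True
      have e: "s powr (q - 1) / s\<^sup>2 = s powr (q - 3)"
        using s powr_diff[of s "q - 1" 2] by (simp add: algebra_simps)
      have e2: "q * s powr (q - 1) * (4 / s\<^sup>2 * B) = 4 * q * B * s powr (q - 3)" unfolding e[symmetric] by simp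
      have "ennreal (q * s powr (q - 1)) * (ennreal (4 / s\<^sup>2) * (ennreal B * (\<integral>\<^sup>+x. ennreal ((norm (f x))\<^sup>2) * indicator {x. norm (f x) \<le> \<tau> s} x \<partial>M)))
        = ennreal (q * s powr (q - 1) * (4 / s\<^sup>2 * B)) * (\<integral>\<^sup>+x. ennreal ((norm (f x))\<^sup>2) * indicator {x\<in>space M. norm (f x) \<le> \<tau> s} x \<partial>M)"
      proof -
        have "(\<integral>\<^sup>+x. ennreal ((norm (f x))\<^sup>2) * indicator {x. norm (f x) \<le> \<tau> s} x \<partial>M) = (\<integral>\<^sup>+x. ennreal ((norm (f x))\<^sup>2) * indicator {x\<in>space M. norm (f x) \<le> \<tau> s} x \<partial>M)"
          by (intro nn_integral_cong) (auto simp: indicator_def)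
        moreover have "ennreal (q * s powr (q - 1) * (4 / s\<^sup>2 * B)) = ennreal (q * s powr (q - 1)) * (ennreal (4 / s\<^sup>2) * ennreal B)"
          using q2 B by (subst ennreal_mult, simp, simp, subst ennreal_mult) simp_all
        ultimately show ?thesis by (simp only: mult.assoc)
      qed
      also have "\<dots> = (\<integral>\<^sup>+x. ennreal (4 * q * B * s powr (q - 3)) * (ennreal ((norm (f x))\<^sup>2) * indicator {x\<in>space M. norm (f x) \<le> \<tau> s} x) \<partial>M)"
        unfolding e2 by (rule nn_integral_cmult[symmetric]) simp
      also have "\<dots> = (\<integral>\<^sup>+x. (if 0 < s \<and> norm (f x) \<le> \<tau> s then ennreal (4 * q * B * s powr (q - 3) * (norm (f x))\<^sup>2) else 0) \<partial>M)"
        using s q2 B by (intro nn_integral_cong) (auto simp: indicator_def ennreal_mult)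
      finally show ?thesis using s by simp
    qed simp
  qed
  also have "\<dots> = (\<integral>\<^sup>+x. \<integral>\<^sup>+s. (if 0 < s \<and> norm (f x) \<le> \<tau> s then ennreal (4 * q * B * s powr (q - 3) * (norm (f x))\<^sup>2) else 0) \<partial>lborel \<partial>M)"
    unfolding \<tau>_def by (rule PM.Fubini') measurable
  also have "\<dots> \<le> (\<integral>\<^sup>+x. ennreal (4 * q * B * K powr (q - 2) / (q - 2)) * ennreal (norm (f x) powr p) \<partial>M)"
  proof (intro nn_integral_mono)
    fix x
    define a where "a = norm (f x)"
    show "(\<integral>\<^sup>+s. (if 0 < s \<and> norm (f x) \<le> \<tau> s then ennreal (4 * q * B * s powr (q - 3) * (norm (f x))\<^sup>2) else 0) \<partial>lborel) \<le> ennreal (4 * q * B * K powr (q - 2) / (q - 2)) * ennreal (norm (f x) powr p)"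
    proof (cases "a = 0")
      case False
      then have a: "a > 0" by (simp add: a_def)
      \<comment> \<open>Inverting \<tau>: the condition a \<le> \<tau> s forces s \<le> S. The
        remaining integral of s powr (q - 3) converges at 0 because q > 2.\<close>
      define S where "S = K * a powr (1 - p)"
      have S: "S > 0" using K a by (simp add: S_def)
      have sS: "s \<le> S" if "s > 0" "a \<le> \<tau> s" for s
      proof -
        have "a powr (p - 1) \<le> \<tau> s powr (p - 1)" using that a p by (intro powr_mono2) auto
        also have "\<dots> = K / s" using p K that by (simp add: \<tau>_def powr_powr)
        finally have "s * a powr (p - 1) \<le> K" using that by (simp add: field_simps)
        then have "s * a powr (p - 1) * a powr (1 - p) \<le> S" unfolding S_def by (intro mult_right_mono) auto
        then show ?thesis using a by (simp add: mult.assoc flip: powr_add)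
      qed
      have "(\<integral>\<^sup>+s. (if 0 < s \<and> norm (f x) \<le> \<tau> s then ennreal (4 * q * B * s powr (q - 3) * (norm (f x))\<^sup>2) else 0) \<partial>lborel)
         \<le> (\<integral>\<^sup>+s. ennreal (4 * q * B / (q - 2) * a\<^sup>2) * (ennreal ((q - 2) * s powr ((q - 2) - 1)) * indicator {0<..S} s) \<partial>lborel)"
      proof (intro nn_integral_mono)
        fix s :: real
        have "4 * q * B * s powr (q - 3) * a\<^sup>2 = (4 * q * B / (q - 2) * a\<^sup>2) * ((q - 2) * s powr ((q - 2) - 1))"
          using q2 by simp
        then show "(if 0 < s \<and> norm (f x) \<le> \<tau> s then ennreal (4 * q * B * s powr (q - 3) * (norm (f x))\<^sup>2) else 0)
           \<le> ennreal (4 * q * B / (q - 2) * a\<^sup>2) * (ennreal ((q - 2) * s powr ((q - 2) - 1)) * indicator {0<..S} s)"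
          using sS[of s] q2 B unfolding a_def[symmetric] by (auto simp flip: ennreal_mult)
      qed
      also have "\<dots> = ennreal (4 * q * B / (q - 2) * a\<^sup>2) * ennreal (S powr (q - 2))"
        using q2 S by (subst nn_integral_cmult) (auto simp only: nn_integral_powr_Ioc, auto)
      also have "\<dots> = ennreal (4 * q * B / (q - 2) * (a\<^sup>2 * S powr (q - 2)))"
        using q2 B by (simp add: mult.assoc flip: ennreal_mult')
      also have "a\<^sup>2 * S powr (q - 2) = K powr (q - 2) * a powr p"
      proof -
        \<comment> \<open>Here (p - 1) (q - 1) = 1 makes the powers of |f| add up to p, which closes
          the estimate.\<close>
        have "2 + (1 - p) * (q - 2) = p" using pq by (simp add: algebra_simps)
        then have "a powr 2 * a powr ((1 - p) * (q - 2)) = a powr p" by (simp flip: powr_add)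
        then show ?thesis using K a by (simp add: S_def powr_mult powr_powr)
      qed
      also have "ennreal (4 * q * B / (q - 2) * (K powr (q - 2) * a powr p)) = ennreal (4 * q * B * K powr (q - 2) / (q - 2)) * ennreal (a powr p)"
        using q2 B by (simp flip: ennreal_mult)
      finally show ?thesis unfolding a_def .
    qed (simp add: a_def cong: if_cong)
  qed
  also have "\<dots> = ennreal (4 * q * B * K powr (q - 2) / (q - 2)) * ennreal \<Phi>" using \<Phi> by (simp add: nn_integral_cmult)
  also have "\<dots> = ennreal (4 * q * B * (2 * A) powr (q - 2) / (q - 2) * \<Phi> powr (q - 1))"
  proof -
    have "K powr (q - 2) * \<Phi> = (2 * A) powr (q - 2) * (\<Phi> powr (q - 2) * \<Phi> powr 1)"
      using A \<Phi> by (simp add: K_def powr_mult)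
    also have "\<Phi> powr (q - 2) * \<Phi> powr 1 = \<Phi> powr (q - 1)" unfolding powr_add[symmetric] by simp
    finally have "4 * q * B * K powr (q - 2) / (q - 2) * \<Phi> = 4 * q * B * (2 * A) powr (q - 2) / (q - 2) * \<Phi> powr (q - 1)"
      by (simp add: mult.assoc)
    then show ?thesis using q2 B \<Phi> by (simp flip: ennreal_mult)
  qed
  finally show ?thesis .
qed

lemma nn_integral_Hoelder:
  fixes f g :: "'a \<Rightarrow> real"
  assumes [measurable]: "f \<in> borel_measurable M" "g \<in> borel_measurable M"
    and nn: "\<And>x. f x \<ge> 0" "\<And>x. g x \<ge> 0" and pq: "p > 1" "q > 1" "1 / p + 1 / q = 1"
    and I: "(\<integral>\<^sup>+x. ennreal (f x powr p) \<partial>M) = ennreal I" "I \<ge> 0"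
    and J: "(\<integral>\<^sup>+x. ennreal (g x powr q) \<partial>M) = ennreal J" "J \<ge> 0"
  shows "(\<integral>\<^sup>+x. ennreal (f x * g x) \<partial>M) \<le> ennreal (I powr (1 / p) * J powr (1 / q))"
proof (cases "I = 0 \<or> J = 0")
  case True
  have "AE x in M. f x * g x = 0"
  proof (cases "I = 0")
    case True
    then have "AE x in M. ennreal (f x powr p) = 0" using I by (simp add: nn_integral_0_iff_AE)
    then show ?thesis by eventually_elim (use nn in auto)
  next
    case False
    then have "AE x in M. ennreal (g x powr q) = 0" using J \<open>I = 0 \<or> J = 0\<close> by (simp add: nn_integral_0_iff_AE)
    then show ?thesis by eventually_elim (use nn in auto)
  qed
  then have "AE x in M. ennreal (f x * g x) = 0" by eventually_elim (simp only: ennreal_0)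
  then have "(\<integral>\<^sup>+x. ennreal (f x * g x) \<partial>M) = 0" by (subst nn_integral_0_iff_AE) auto
  then show ?thesis by simp
next
  case False
  then have IJ: "I > 0" "J > 0" using I J by auto
  define a b where "a = I powr (1 / p)" and "b = J powr (1 / q)"
  have ab: "a > 0" "b > 0" using IJ by (auto simp: a_def b_def)
  have ap: "a powr p = I" "b powr q = J" using IJ pq by (auto simp: a_def b_def powr_powr)
  have "(\<integral>\<^sup>+x. ennreal (f x * g x) \<partial>M) \<le> (\<integral>\<^sup>+x. ennreal (a * b / (p * I)) * ennreal (f x powr p) + ennreal (a * b / (q * J)) * ennreal (g x powr q) \<partial>M)"
  proof (intro nn_integral_mono)
    fix x
    have "(f x / a) * (g x / b) \<le> (f x / a) powr p / p + (g x / b) powr q / q"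
      using nn ab pq by (intro Youngs_inequality) auto
    also have "\<dots> = f x powr p / (p * I) + g x powr q / (q * J)"
      using nn ab ap by (simp add: powr_divide mult.commute)
    finally have "a * b * ((f x / a) * (g x / b)) \<le> a * b * (f x powr p / (p * I) + g x powr q / (q * J))"
      using ab by (intro mult_left_mono) auto
    then have "f x * g x \<le> a * b / (p * I) * f x powr p + a * b / (q * J) * g x powr q"
      using ab by (simp add: distrib_left)
    then show "ennreal (f x * g x) \<le> ennreal (a * b / (p * I)) * ennreal (f x powr p) + ennreal (a * b / (q * J)) * ennreal (g x powr q)"
      using ab pq IJ by (simp flip: ennreal_mult ennreal_plus)
  qed
  also have "\<dots> = ennreal (a * b / (p * I)) * ennreal I + ennreal (a * b / (q * J)) * ennreal J"
    using I J by (subst nn_integral_add) (auto simp: nn_integral_cmult)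
  also have "\<dots> = ennreal (a * b / (p * I) * I + a * b / (q * J) * J)"
    using ab pq IJ by (simp flip: ennreal_mult ennreal_plus)
  also have "a * b / (p * I) * I + a * b / (q * J) * J = a * b * (1 / p + 1 / q)"
    using IJ by (simp add: distrib_left)
  finally show ?thesis unfolding pq a_def b_def by simp
qed

section \<open>The density of the spectral measure\<close>

text \<open>Partial products of Gamma(x)^2 / |Gamma(x + i y)|^2.\<close>

definition gamma_quot :: "real \<Rightarrow> real \<Rightarrow> nat \<Rightarrow> real" where
  "gamma_quot y x n = (\<Prod>k\<le>n. 1 + (y / (x + real k))\<^sup>2)"

text \<open>In the quotient of the two Gauss products the powers of n cancel, because n powr (x + i
  y) has modulus n powr x; the factors of the Pochhammer symbols remain.\<close>

lemma gamma_quot_LIMSEQ: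
  assumes x: "x > 0"
  shows "gamma_quot y x \<longlonglongrightarrow> (Gamma x)\<^sup>2 * (norm (rGamma (Complex x y)))\<^sup>2"
proof -
  have 1: "(\<lambda>n. (norm (rGamma_series (Complex x y) n))\<^sup>2 / (rGamma_series x n)\<^sup>2)
      \<longlonglongrightarrow> (norm (rGamma (Complex x y)))\<^sup>2 / (rGamma x)\<^sup>2"
    using Gamma_real_pos[OF x]
    by (intro tendsto_intros rGamma_series_LIMSEQ) (simp add: rGamma_inverse_Gamma)
  have "(norm (rGamma_series (Complex x y) n))\<^sup>2 / (rGamma_series x n)\<^sup>2 = gamma_quot y x n" if n: "n > 0" for n
  proof -
    have e: "norm (exp (Complex x y * of_real (ln (of_nat n)))) = exp (x * ln (of_nat n))" by simp
    have "(norm (pochhammer (Complex x y) (n + 1)))\<^sup>2 = (\<Prod>k\<le>n. (norm (Complex x y + of_nat k))\<^sup>2)"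
      unfolding pochhammer_prod by (simp add: prod_norm[symmetric] prod_power_distrib atLeast0LessThan lessThan_Suc_atMost)
    also have "\<dots> = (\<Prod>k\<le>n. (x + real k)\<^sup>2 * (1 + (y / (x + real k))\<^sup>2))"
    proof (intro prod.cong refl)
      fix k
      have "x + real k > 0" using x by simp
      then show "(norm (Complex x y + of_nat k))\<^sup>2 = (x + real k)\<^sup>2 * (1 + (y / (x + real k))\<^sup>2)"
        by (simp add: cmod_power2 power_divide field_simps)
    qed
    also have "\<dots> = (pochhammer x (n + 1))\<^sup>2 * gamma_quot y x n"
      unfolding pochhammer_prod gamma_quot_def prod.distrib
      by (simp add: prod_power_distrib atLeast0LessThan lessThan_Suc_atMost)
    finally have p: "(norm (pochhammer (Complex x y) (n + 1)))\<^sup>2 = (pochhammer x (n + 1))\<^sup>2 * gamma_quot y x n" .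
    have "pochhammer x (n + 1) \<noteq> 0" using pochhammer_pos[OF x, of "n + 1"] by simp
    then show ?thesis
      unfolding rGamma_series_def norm_divide norm_mult e norm_fact power_divide p
      by (simp add: power_mult_distrib)
  qed
  then have "\<forall>\<^sub>F n in sequentially. (norm (rGamma_series (Complex x y) n))\<^sup>2 / (rGamma_series x n)\<^sup>2 = gamma_quot y x n"
    by (rule eventually_mono[OF eventually_gt_at_top[of 0]])
  from Lim_transform_eventually[OF 1 this]
  show ?thesis by (simp add: rGamma_inverse_Gamma power_inverse divide_inverse mult.commute)
qed

lemma convex_ln_one_plus_inverse_sq: "convex_on {0<..} (\<lambda>t::real. ln (1 + (y / t)\<^sup>2))"
proof (rule convex_on_realI[where f' = "\<lambda>t. - (2 * y\<^sup>2 / (t * (t\<^sup>2 + y\<^sup>2)))"])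
  fix t :: real assume "t \<in> {0<..}"
  then have t: "t > 0" by simp
  have p: "1 + (y / t)\<^sup>2 > 0" by (simp add: add_pos_nonneg)
  have tp: "t\<^sup>2 + y\<^sup>2 > 0" using t by (simp add: add_pos_nonneg)
  have "((\<lambda>t. 1 + (y / t)\<^sup>2) has_real_derivative 2 * (y / t) * (- y / t\<^sup>2)) (at t)"
    using t by (auto intro!: derivative_eq_intros simp: power2_eq_square)
  from DERIV_chain2[OF DERIV_ln[OF p] this]
  show "((\<lambda>t. ln (1 + (y / t)\<^sup>2)) has_real_derivative - (2 * y\<^sup>2 / (t * (t\<^sup>2 + y\<^sup>2)))) (at t)"
  proof (rule DERIV_cong)
    have "1 + (y / t)\<^sup>2 = (t\<^sup>2 + y\<^sup>2) / t\<^sup>2" using t by (simp add: power_divide field_simps)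
    then show "inverse (1 + (y / t)\<^sup>2) * (2 * (y / t) * (- y / t\<^sup>2)) = - (2 * y\<^sup>2 / (t * (t\<^sup>2 + y\<^sup>2)))"
      using t tp by (simp add: power2_eq_square divide_simps)
  qed
next
  fix s t :: real assume "s \<in> {0<..}" "t \<in> {0<..}" "s \<le> t"
  then have st: "0 < s" "s \<le> t" by auto
  have "2 * y\<^sup>2 / (t * (t\<^sup>2 + y\<^sup>2)) \<le> 2 * y\<^sup>2 / (s * (s\<^sup>2 + y\<^sup>2))"
    using st by (intro divide_left_mono mult_mono add_right_mono power_mono mult_pos_pos add_pos_nonneg) auto
  then show "- (2 * y\<^sup>2 / (s * (s\<^sup>2 + y\<^sup>2))) \<le> - (2 * y\<^sup>2 / (t * (t\<^sup>2 + y\<^sup>2)))" by simp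
qed auto

text \<open>A substitute for Stirling's formula. The point 2 + k is the convex combination of 1 + k
  and 2 + s + k with weights s / (1 + s) and 1 / (1 + s). Convexity of ln (1 + (y/t)^2) is applied
  term by term, and the sums over 1 + k and 2 + k differ by boundary terms only.\<close>

lemma gamma_quot_le:
  assumes s: "s \<ge> 0"
  shows "gamma_quot y 2 n \<le> gamma_quot y (2 + s) n * (1 + y\<^sup>2) powr s"
proof -
  define L where "L t = ln (1 + (y / t)\<^sup>2)" for t
  have pos: "1 + (y / t)\<^sup>2 > 0" for t :: real by (simp add: add_pos_nonneg)
  have q: "ln (gamma_quot y x n) = (\<Sum>k\<le>n. L (x + real k))" for x
    unfolding gamma_quot_def L_def by (rule ln_prod) (simp_all add: add_nonneg_eq_0_iff)
  have qpos: "gamma_quot y x n > 0" for x unfolding gamma_quot_def by (intro prod_pos) (use pos in auto)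
  have conv: "(1 + s) * L (2 + real k) \<le> s * L (1 + real k) + L (2 + s + real k)" for k
  proof -
    have "L ((1 - 1 / (1 + s)) *\<^sub>R (1 + real k) + (1 / (1 + s)) *\<^sub>R (2 + s + real k))
       \<le> (1 - 1 / (1 + s)) * L (1 + real k) + (1 / (1 + s)) * L (2 + s + real k)"
      unfolding L_def using s by (intro convex_onD[OF convex_ln_one_plus_inverse_sq]) auto
    also have "(1 - 1 / (1 + s)) *\<^sub>R (1 + real k) + (1 / (1 + s)) *\<^sub>R (2 + s + real k) = 2 + real k"
    proof -
      have "1 + s \<noteq> 0" using s by simp
      then show ?thesis by (simp add: divide_simps) (simp add: algebra_simps)
    qed
    also have "1 - 1 / (1 + s) = s / (1 + s)" using s by (simp add: field_simps)
    finally have "(1 + s) * L (2 + real k) \<le> (1 + s) * (s / (1 + s) * L (1 + real k) + 1 / (1 + s) * L (2 + s + real k))"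
      using s by (intro mult_left_mono) auto
    then show ?thesis using s by (simp add: distrib_left)
  qed
  have "(1 + s) * (\<Sum>k\<le>n. L (2 + real k)) \<le> s * (\<Sum>k\<le>n. L (1 + real k)) + (\<Sum>k\<le>n. L (2 + s + real k))"
    unfolding sum_distrib_left sum.distrib[symmetric] by (intro sum_mono conv)
  \<comment> \<open>Telescoping: shifting the sum costs at most L 1 = ln (1 + y^2), the source of
    the factor (1 + y^2) powr s.\<close>
  moreover have "(\<Sum>k\<le>n. L (1 + real k)) \<le> (\<Sum>k\<le>n. L (2 + real k)) + L 1"
  proof -
    have "(\<Sum>k\<le>n. L (1 + real k)) + L (2 + real n) = L 1 + (\<Sum>k\<le>n. L (2 + real k))"
      by (induction n) (simp_all add: algebra_simps)
    moreover have "L (2 + real n) \<ge> 0" unfolding L_def by simp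
    ultimately show ?thesis by simp
  qed
  then have "s * (\<Sum>k\<le>n. L (1 + real k)) \<le> s * ((\<Sum>k\<le>n. L (2 + real k)) + L 1)" using s by (rule mult_left_mono)
  ultimately have "(\<Sum>k\<le>n. L (2 + real k)) \<le> s * L 1 + (\<Sum>k\<le>n. L (2 + s + real k))"
    by (simp add: algebra_simps)
  then have "ln (gamma_quot y 2 n) \<le> ln ((1 + y\<^sup>2) powr s) + ln (gamma_quot y (2 + s) n)"
    unfolding q by (simp add: L_def ln_powr add_pos_nonneg)
  also have "\<dots> = ln (gamma_quot y (2 + s) n * (1 + y\<^sup>2) powr s)"
    using qpos[of "2 + s"] by (subst ln_mult) (auto simp: add_pos_nonneg add_nonneg_eq_0_iff)
  finally show ?thesis
    using qpos by (subst (asm) ln_le_cancel_iff) (auto intro!: mult_pos_pos simp: add_nonneg_eq_0_iff)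
qed

text \<open>Allows both Gamma factors of the c-function to be compared with the single value at 2 +
  i y, which the reflection formula makes explicit. Two applications of the functional equation
  lower 2 + s to s, each dividing by at least |y|.\<close>

lemma norm_Gamma_shift_le:
  assumes s: "s > 0" and y: "y \<noteq> 0"
  shows "norm (Gamma (Complex s y)) \<le> Gamma (2 + s) * (norm (Gamma (Complex 2 y)) * (1 + y\<^sup>2) powr (s / 2) / y\<^sup>2)"
proof -
  have ni: "Complex x y \<notin> \<int>\<^sub>\<le>\<^sub>0" for x using y by (auto simp: complex_eq_iff elim!: nonpos_Ints_cases)
  have G0: "Gamma (Complex x y) \<noteq> 0" for x using ni[of x] by (simp add: Gamma_eq_zero_iff)
  have "(Gamma (2::real))\<^sup>2 * (norm (rGamma (Complex 2 y)))\<^sup>2 \<le> (Gamma (2 + s))\<^sup>2 * (norm (rGamma (Complex (2 + s) y)))\<^sup>2 * (1 + y\<^sup>2) powr s"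
    by (rule LIMSEQ_le[OF gamma_quot_LIMSEQ tendsto_mult[OF gamma_quot_LIMSEQ tendsto_const]])
       (use s in \<open>auto intro!: exI[of _ 0] gamma_quot_le\<close>)
  moreover have "Gamma (2::real) = 1" using Gamma_fact[of 1, where 'a = real] by simp
  ultimately have "(norm (rGamma (Complex 2 y)))\<^sup>2 \<le> (Gamma (2 + s))\<^sup>2 * (norm (rGamma (Complex (2 + s) y)))\<^sup>2 * (1 + y\<^sup>2) powr s"
    by simp
  also have "(1 + y\<^sup>2) powr s = ((1 + y\<^sup>2) powr (s / 2))\<^sup>2"
    by (simp add: powr_power add_nonneg_eq_0_iff)
  finally have "(norm (rGamma (Complex 2 y)))\<^sup>2 \<le> (Gamma (2 + s) * norm (rGamma (Complex (2 + s) y)) * (1 + y\<^sup>2) powr (s / 2))\<^sup>2"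
    by (simp add: power_mult_distrib)
  then have "norm (rGamma (Complex 2 y)) \<le> Gamma (2 + s) * norm (rGamma (Complex (2 + s) y)) * (1 + y\<^sup>2) powr (s / 2)"
    by (rule power2_le_imp_le) (use s in \<open>auto intro!: mult_nonneg_nonneg less_imp_le[OF Gamma_real_pos]\<close>)
  then have 1: "norm (Gamma (Complex (2 + s) y)) \<le> Gamma (2 + s) * norm (Gamma (Complex 2 y)) * (1 + y\<^sup>2) powr (s / 2)"
    using G0[of 2] G0[of "2 + s"] unfolding rGamma_inverse_Gamma norm_inverse
    by (simp add: divide_simps mult_ac)
  have c: "Complex (x + 1) y = Complex x y + 1" for x by (simp add: complex_eq_iff)
  have "Gamma (Complex (2 + s) y) = Complex (s + 1) y * (Complex s y * Gamma (Complex s y))"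
  proof -
    have "Complex (2 + s) y = Complex (s + 1) y + 1" by (simp add: complex_eq_iff)
    then show ?thesis using Gamma_plus1[OF ni[of "s + 1"]] Gamma_plus1[OF ni[of s]] c[of s] by simp
  qed
  then have "norm (Gamma (Complex (2 + s) y)) = norm (Complex (s + 1) y) * norm (Complex s y) * norm (Gamma (Complex s y))"
    by (simp add: norm_mult)
  moreover have "\<bar>y\<bar> * \<bar>y\<bar> * norm (Gamma (Complex s y)) \<le> norm (Complex (s + 1) y) * norm (Complex s y) * norm (Gamma (Complex s y))"
    using abs_Im_le_cmod[of "Complex (s + 1) y"] abs_Im_le_cmod[of "Complex s y"] by (intro mult_right_mono mult_mono) auto
  ultimately have "y\<^sup>2 * norm (Gamma (Complex s y)) \<le> Gamma (2 + s) * norm (Gamma (Complex 2 y)) * (1 + y\<^sup>2) powr (s / 2)"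
    using 1 by (simp add: power2_eq_square)
  then show ?thesis using y by (simp add: field_simps)
qed

text \<open>The reflection formula at i y, where Gamma(1 - i y) is - i y times the conjugate of
  Gamma(i y).\<close>

lemma norm_Gamma_imaginary:
  assumes "y > 0"
  shows "(norm (Gamma (\<i> * of_real y)))\<^sup>2 = pi / (y * sinh (pi * y))"
proof -
  have ni: "- (\<i> * of_real y) \<notin> \<int>\<^sub>\<le>\<^sub>0" using assms by (auto simp: complex_eq_iff elim!: nonpos_Ints_cases)
  have sh: "sinh (complex_of_real t) = of_real (sinh t)" for t
    by (simp add: sinh_def exp_of_real scaleR_conv_of_real flip: of_real_minus)
  have "Gamma (\<i> * of_real y) * Gamma (1 - \<i> * of_real y) = of_real pi / sin (of_real pi * (\<i> * of_real y))"
    by (rule Gamma_reflection_complex)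
  moreover have "Gamma (1 - \<i> * of_real y) = - (\<i> * of_real y) * cnj (Gamma (\<i> * of_real y))"
    using Gamma_plus1[OF ni] by (simp add: cnj_Gamma)
  moreover have "sin (of_real pi * (\<i> * of_real y)) = \<i> * of_real (sinh (pi * y))"
    using sinh_conv_sin[of "of_real (pi * y)"] unfolding sh by (simp add: mult_ac)
  ultimately have "- \<i> * of_real y * (Gamma (\<i> * of_real y) * cnj (Gamma (\<i> * of_real y))) = of_real pi / (\<i> * of_real (sinh (pi * y)))"
    by (simp add: mult_ac)
  then have "norm (- \<i> * of_real y * (of_real ((norm (Gamma (\<i> * of_real y)))\<^sup>2))) = norm (complex_of_real pi / (\<i> * of_real (sinh (pi * y))))"
    by (simp only: complex_norm_square[symmetric])
  then have "y * (norm (Gamma (\<i> * of_real y)))\<^sup>2 = pi / sinh (pi * y)"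
    using assms by (simp add: norm_mult norm_divide norm_power)
  then show ?thesis using assms by (simp add: field_simps)
qed

lemma norm_Gamma_imaginary':
  assumes "y \<noteq> 0"
  shows "(norm (Gamma (\<i> * of_real y)))\<^sup>2 = pi / (\<bar>y\<bar> * sinh (pi * \<bar>y\<bar>))"
proof (cases "y > 0")
  case False
  have "Gamma (\<i> * of_real y) = cnj (Gamma (\<i> * of_real (- y)))" by (simp add: cnj_Gamma)
  then show ?thesis using norm_Gamma_imaginary[of "- y"] False assms by simp
qed (use norm_Gamma_imaginary in auto)

section \<open>Upper bounds for the density of |nu|\<close>

context jacobi_params
begin

text \<open>Modulus of the denominator of \<open>jacobi_c\<close> on the real line, hence the
  numerator of 1 / |c|.\<close>

definition c_num :: "real \<Rightarrow> real" where
  "c_num l = norm (Gamma (Complex (\<rho> / 2) (l / 2))) * norm (Gamma (Complex ((\<alpha> - \<beta> + 1) / 2) (l / 2)))"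

lemma norm_jacobi_c:
  "norm (jacobi_c \<alpha> \<beta> (of_real l)) = Gamma (\<alpha> + 1) * 2 powr \<rho> * norm (Gamma (\<i> * of_real l)) / c_num l"
proof -
  have 1: "(of_real \<rho> + \<i> * of_real l) / 2 = Complex (\<rho> / 2) (l / 2)"
    "(of_real (\<alpha> - \<beta> + 1) + \<i> * of_real l) / 2 = Complex ((\<alpha> - \<beta> + 1) / 2) (l / 2)"
    by (simp_all add: complex_eq_iff)
  have 2: "norm ((2::complex) powr (of_real \<rho> - \<i> * of_real l)) = 2 powr \<rho>"
    by (subst norm_powr_real) (auto simp: powr_def)
  have 3: "norm (Gamma (complex_of_real (\<alpha> + 1))) = Gamma (\<alpha> + 1)"
    unfolding Gamma_complex_of_real using Gamma_real_pos[of "\<alpha> + 1"] alpha1 by simp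
  show ?thesis unfolding jacobi_c_def 1 norm_divide norm_mult 2 3 c_num_def by simp
qed

lemma norm_opdam_density:
  "norm (opdam_density \<alpha> \<beta> k l) = \<bar>k\<bar> * norm (1 - of_real \<rho> / (\<i> * of_real l))
     * ((c_num l)\<^sup>2 / (8 * pi * ((Gamma (\<alpha> + 1) * 2 powr \<rho>)\<^sup>2 * (norm (Gamma (\<i> * of_real l)))\<^sup>2)))"
proof -
  have "norm (opdam_density \<alpha> \<beta> k l) = \<bar>k\<bar> * norm (1 - of_real \<rho> / (\<i> * of_real l)) / (8 * pi * (norm (jacobi_c \<alpha> \<beta> (of_real l)))\<^sup>2)"
    unfolding opdam_density_def norm_divide norm_mult norm_of_real by simp
  then show ?thesis unfolding norm_jacobi_c by (simp add: power_divide power_mult_distrib)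
qed

text \<open>With y = l/2 both Gamma factors reduce to |Gamma(2 + i y)|, that is to a polynomial
  factor times |Gamma(i y)|. The exponential decays of |Gamma(i y)|^4 and of |Gamma(i l)|^2 cancel,
  and only powers of l are left.\<close>

lemma c_num_sq_div_le:
  assumes l: "\<bar>l\<bar> \<ge> 1"
  shows "(c_num l)\<^sup>2 / (norm (Gamma (\<i> * of_real l)))\<^sup>2
    \<le> (Gamma (2 + \<rho> / 2) * Gamma (2 + (\<alpha> - \<beta> + 1) / 2))\<^sup>2 * (8 * pi * 5 powr (\<alpha> + 3)) * \<bar>l\<bar> powr (2 * \<alpha> + 1)"
proof -
  define y where "y = l / 2"
  define Y where "Y = \<bar>y\<bar>"
  define K where "K = Gamma (2 + \<rho> / 2) * Gamma (2 + (\<alpha> - \<beta> + 1) / 2)"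
  define g where "g = (norm (Gamma (\<i> * of_real y)))\<^sup>2"
  define D where "D = 1 + y\<^sup>2"
  have Y: "Y \<ge> 1 / 2" using l by (simp add: Y_def y_def)
  have y0: "y \<noteq> 0" using Y by (auto simp: Y_def)
  have Y2: "y\<^sup>2 = Y\<^sup>2" by (simp add: Y_def)
  have D: "D > 0" by (simp add: D_def add_pos_nonneg)
  have s: "\<rho> / 2 > 0" "(\<alpha> - \<beta> + 1) / 2 > 0" using rho_pos alpha_beta by auto
  have K: "K \<ge> 0" unfolding K_def
    using Gamma_real_pos[of "2 + \<rho> / 2"] Gamma_real_pos[of "2 + (\<alpha> - \<beta> + 1) / 2"] s by (intro mult_nonneg_nonneg) linarith+
  have G2: "(norm (Gamma (Complex 2 y)))\<^sup>2 = D * Y\<^sup>2 * g"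
  proof -
    have ni: "Complex x y \<notin> \<int>\<^sub>\<le>\<^sub>0" for x using y0 by (auto simp: complex_eq_iff elim!: nonpos_Ints_cases)
    have e: "Complex 0 y = \<i> * of_real y" "Complex 0 y + 1 = Complex 1 y" "Complex 1 y + 1 = Complex 2 y"
      by (simp_all add: complex_eq_iff)
    have "Gamma (Complex 2 y) = Complex 1 y * (Complex 0 y * Gamma (Complex 0 y))"
      using Gamma_plus1[OF ni[of 0]] Gamma_plus1[OF ni[of 1]] unfolding e(2,3) by simp
    then have "(norm (Gamma (Complex 2 y)))\<^sup>2 = (norm (Complex 1 y))\<^sup>2 * ((norm (Complex 0 y))\<^sup>2 * g)"
      unfolding g_def e(1)[symmetric] by (simp add: norm_mult power_mult_distrib)
    then show ?thesis by (simp add: cmod_power2 D_def Y2)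
  qed
  have "c_num l \<le> (Gamma (2 + \<rho> / 2) * (norm (Gamma (Complex 2 y)) * D powr (\<rho> / 2 / 2) / y\<^sup>2)) *
      (Gamma (2 + (\<alpha> - \<beta> + 1) / 2) * (norm (Gamma (Complex 2 y)) * D powr ((\<alpha> - \<beta> + 1) / 2 / 2) / y\<^sup>2))"
    unfolding c_num_def y_def[symmetric] D_def using norm_Gamma_shift_le[OF s(1) y0] norm_Gamma_shift_le[OF s(2) y0]
    by (intro mult_mono) (auto intro: order_trans[OF norm_ge_zero])
  also have "\<dots> = K * (norm (Gamma (Complex 2 y)))\<^sup>2 * (D powr (\<rho> / 2 / 2) * D powr ((\<alpha> - \<beta> + 1) / 2 / 2)) / Y ^ 4"
    unfolding Y2 K_def by (simp add: power2_eq_square power4_eq_xxxx mult_ac)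
  also have "D powr (\<rho> / 2 / 2) * D powr ((\<alpha> - \<beta> + 1) / 2 / 2) = D powr ((\<alpha> + 1) / 2)"
    unfolding powr_add[symmetric] by (rule arg_cong[where f = "\<lambda>e. D powr e"]) (simp add: jacobi_rho_def field_simps)
  also have "K * (norm (Gamma (Complex 2 y)))\<^sup>2 * D powr ((\<alpha> + 1) / 2) / Y ^ 4 = K * (D * D powr ((\<alpha> + 1) / 2)) * g / Y\<^sup>2"
    unfolding G2 using Y by (simp add: power2_eq_square power4_eq_xxxx)
  also have "D * D powr ((\<alpha> + 1) / 2) = D powr ((\<alpha> + 3) / 2)"
  proof -
    have e: "1 + (\<alpha> + 1) / 2 = (\<alpha> + 3) / 2" by (simp add: field_simps)
    show ?thesis using powr_add[of D 1 "(\<alpha> + 1) / 2", unfolded e] D by simp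
  qed
  finally have "(c_num l)\<^sup>2 \<le> (K * D powr ((\<alpha> + 3) / 2) * g / Y\<^sup>2)\<^sup>2"
    by (intro power_mono) (auto simp: c_num_def)
  also have "\<dots> = K\<^sup>2 * D powr (\<alpha> + 3) * (g\<^sup>2 / Y ^ 4)"
  proof -
    have "(D powr ((\<alpha> + 3) / 2))\<^sup>2 = D powr (\<alpha> + 3)"
      unfolding power2_eq_square powr_add[symmetric] field_sum_of_halves ..
    then show ?thesis by (simp add: power_mult_distrib power_divide)
  qed
  finally have 1: "(c_num l)\<^sup>2 \<le> K\<^sup>2 * D powr (\<alpha> + 3) * (g\<^sup>2 / Y ^ 4)" .
  have l0: "l \<noteq> 0" using l by auto
  have lY: "\<bar>l\<bar> = 2 * Y" by (simp add: Y_def y_def)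
  have sh: "sinh (pi * Y) > 0" using Y by simp
  have Y0: "Y > 0" using Y by simp
  have "g\<^sup>2 / (norm (Gamma (\<i> * of_real l)))\<^sup>2 = 4 * pi * (cosh (pi * Y) / sinh (pi * Y)) / Y"
  proof -
    \<comment> \<open>The duplication formula makes the hyperbolic sines cancel up to coth (pi Y),
      which is at most 2 for Y \<ge> 1/2.\<close>
    have "sinh (pi * (2 * Y)) = 2 * sinh (pi * Y) * cosh (pi * Y)"
      using sinh_double[of "pi * Y"] by (simp add: mult_ac)
    then show ?thesis
      unfolding g_def norm_Gamma_imaginary'[OF y0] norm_Gamma_imaginary'[OF l0] lY Y_def[symmetric]
      using sh Y0 by (simp add: power2_eq_square divide_simps)
  qed
  also have "\<dots> \<le> 4 * pi * 2 / Y"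
  proof (intro divide_right_mono mult_left_mono)
    have p: "pi * Y \<ge> 1" using mult_mono[of 2 pi "1 / 2" Y] Y pi_ge_two by simp
    then have "1 * 2 \<le> pi * Y * (1 + pi * Y)" by (intro mult_mono) auto
    then have "1 / (pi * Y * (1 + pi * Y)) \<le> 1" using p by simp
    then show "cosh (pi * Y) / sinh (pi * Y) \<le> 2" using coth_minus_one_le(2)[of "pi * Y"] Y by simp
  qed (use Y0 in auto)
  finally have 2: "g\<^sup>2 / (norm (Gamma (\<i> * of_real l)))\<^sup>2 \<le> 8 * pi / Y" by simp
  have "(c_num l)\<^sup>2 / (norm (Gamma (\<i> * of_real l)))\<^sup>2 \<le> K\<^sup>2 * D powr (\<alpha> + 3) * (g\<^sup>2 / Y ^ 4) / (norm (Gamma (\<i> * of_real l)))\<^sup>2"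
    by (intro divide_right_mono 1) auto
  also have "\<dots> = K\<^sup>2 * (D powr (\<alpha> + 3) / Y ^ 4 * (g\<^sup>2 / (norm (Gamma (\<i> * of_real l)))\<^sup>2))" by simp
  also have "\<dots> \<le> K\<^sup>2 * ((5 * Y\<^sup>2) powr (\<alpha> + 3) / Y ^ 4 * (8 * pi / Y))"
  proof (intro mult_left_mono mult_mono divide_right_mono powr_mono2 2)
    have "(1 / 2)\<^sup>2 \<le> Y\<^sup>2" using Y by (intro power_mono) auto
    then show "D \<le> 5 * Y\<^sup>2" unfolding D_def Y2 by (simp add: power2_eq_square)
  qed (use D Y0 alpha in auto)
  \<comment> \<open>Exponent count: 2 (\<alpha> + 3) from D, minus 4 and 1 from the denominators, is
    2 \<alpha> + 1.\<close>
  also have "(5 * Y\<^sup>2) powr (\<alpha> + 3) / Y ^ 4 * (8 * pi / Y) = 8 * pi * 5 powr (\<alpha> + 3) * Y powr (2 * \<alpha> + 1)"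
  proof -
    have "(Y\<^sup>2) powr (\<alpha> + 3) = Y powr (2 * \<alpha> + 1) * Y powr 5"
      using Y0 by (simp add: powr_powr powr_numeral[symmetric] del: powr_numeral flip: powr_add) (simp add: algebra_simps)
    also have "Y powr 5 = Y ^ 4 * Y" using Y0 by (simp add: numeral_eq_Suc)
    finally show ?thesis using Y0 by (simp add: powr_mult)
  qed
  also have "K\<^sup>2 * (8 * pi * 5 powr (\<alpha> + 3) * Y powr (2 * \<alpha> + 1)) \<le> K\<^sup>2 * (8 * pi * 5 powr (\<alpha> + 3) * \<bar>l\<bar> powr (2 * \<alpha> + 1))"
    using Y0 alpha unfolding lY by (intro mult_left_mono powr_mono2) auto
  finally show ?thesis unfolding K_def by (simp only: mult.assoc)
qed

lemma opdam_density_high: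
  obtains C where "C \<ge> 0" "\<And>k l. \<bar>l\<bar> \<ge> 1 \<Longrightarrow> norm (opdam_density \<alpha> \<beta> k l) \<le> \<bar>k\<bar> * (C * \<bar>l\<bar> powr (2 * \<alpha> + 1))"
proof -
  define E where "E = (Gamma (2 + \<rho> / 2) * Gamma (2 + (\<alpha> - \<beta> + 1) / 2))\<^sup>2 * (8 * pi * 5 powr (\<alpha> + 3))"
  define d where "d = 8 * pi * (Gamma (\<alpha> + 1) * 2 powr \<rho>)\<^sup>2"
  have d: "d > 0" unfolding d_def using Gamma_real_pos[of "\<alpha> + 1"] alpha1
    by (intro mult_pos_pos zero_less_power) auto
  have E: "E \<ge> 0" by (simp add: E_def)
  have "norm (opdam_density \<alpha> \<beta> k l) \<le> \<bar>k\<bar> * ((1 + \<rho>) * E / d * \<bar>l\<bar> powr (2 * \<alpha> + 1))" if l: "\<bar>l\<bar> \<ge> 1" for k l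
  proof -
    have "norm (1 - of_real \<rho> / (\<i> * of_real l)) \<le> norm (1::complex) + norm (of_real \<rho> / (\<i> * of_real l))"
      by (rule norm_triangle_ineq4)
    also have "\<dots> = 1 + \<rho> / \<bar>l\<bar>" using rho_pos by (simp add: norm_divide norm_mult)
    also have "\<rho> / \<bar>l\<bar> \<le> \<rho> / 1" using l rho_pos by (intro divide_left_mono) auto
    finally have 1: "norm (1 - of_real \<rho> / (\<i> * of_real l)) \<le> 1 + \<rho>" by simp
    have "norm (opdam_density \<alpha> \<beta> k l) = \<bar>k\<bar> * (norm (1 - of_real \<rho> / (\<i> * of_real l))
     * ((c_num l)\<^sup>2 / (norm (Gamma (\<i> * of_real l)))\<^sup>2 / d))"
      unfolding norm_opdam_density d_def by (simp add: mult_ac)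
    also have "\<dots> \<le> \<bar>k\<bar> * ((1 + \<rho>) * (E * \<bar>l\<bar> powr (2 * \<alpha> + 1) / d))"
      using c_num_sq_div_le[OF l] d rho_pos unfolding E_def[symmetric]
      by (intro mult_left_mono mult_mono 1 divide_right_mono) auto
    finally show ?thesis by (simp add: mult_ac)
  qed
  moreover have "(1 + \<rho>) * E / d \<ge> 0" using E d rho_pos by simp
  ultimately show ?thesis using that by blast
qed

text \<open>Near 0 the factor 1 - \<rho> / (i l) blows up like 1 / |l|, but 1 / |Gamma(i l)|^2
  vanishes like l^2. Writing the latter through \<open>rGamma\<close> at 1 + i l exhibits the zero
  and leaves a continuous function on [-1, 1].\<close>

lemma opdam_density_low:
  obtains C where "C \<ge> 0" "\<And>k l. \<bar>l\<bar> \<le> 1 \<Longrightarrow> norm (opdam_density \<alpha> \<beta> k l) \<le> \<bar>k\<bar> * C"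
proof -
  define d where "d = 8 * pi * (Gamma (\<alpha> + 1) * 2 powr \<rho>)\<^sup>2"
  have d: "d > 0" unfolding d_def using Gamma_real_pos[of "\<alpha> + 1"] alpha1
    by (intro mult_pos_pos zero_less_power) auto
  let ?H = "\<lambda>l. (c_num l * norm (rGamma (1 + \<i> * complex_of_real l)))\<^sup>2"
  have ni: "Complex s y \<notin> \<int>\<^sub>\<le>\<^sub>0" if "s > 0" for s y
    using that by (auto simp: complex_eq_iff elim!: nonpos_Ints_cases)
  have contG: "continuous_on A (\<lambda>l. Gamma (Complex s (l / 2)))" if "s > 0" for s A
  proof (rule continuous_on_compose2[OF continuous_on_Gamma[of "UNIV - \<int>\<^sub>\<le>\<^sub>0"]])
    show "continuous_on A (\<lambda>l. Complex s (l / 2))" unfolding Complex_eq by (intro continuous_intros) auto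
  qed (use ni[OF that] in auto)
  have cont: "continuous_on {-1..1} ?H"
    unfolding c_num_def using rho_pos alpha_beta
    by (intro continuous_intros contG continuous_on_compose2[OF continuous_on_rGamma[of UNIV]]) auto
  have "compact (?H ` {-1..1})" by (intro compact_continuous_image cont) auto
  then have "bounded (?H ` {-1..1})" by (rule compact_imp_bounded)
  then obtain B where "\<forall>h \<in> ?H ` {-1..1}. norm h \<le> B" unfolding bounded_iff by blast
  then have B: "?H l \<le> B" if "\<bar>l\<bar> \<le> 1" for l
    using that by (force simp: abs_le_iff)
  have B0: "B \<ge> 0" using order_trans[OF zero_le_power2 B[of 0]] by simp
  have "norm (opdam_density \<alpha> \<beta> k l) \<le> \<bar>k\<bar> * ((1 + \<rho>) * B / d)" if l: "\<bar>l\<bar> \<le> 1" for k l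
  proof (cases "l = 0")
    case True
    \<comment> \<open>Here \<open>Gamma 0 = 0\<close>, hence c = 0 and the density is 0, by the
      conventions for poles and for division by 0.\<close>
    then show ?thesis using B0 d rho_pos by (simp add: opdam_density_def jacobi_c_def)
  next
    case False
    have "norm (1 - of_real \<rho> / (\<i> * of_real l)) \<le> norm (1::complex) + norm (of_real \<rho> / (\<i> * of_real l))"
      by (rule norm_triangle_ineq4)
    also have "\<dots> = 1 + \<rho> / \<bar>l\<bar>" using rho_pos by (simp add: norm_divide norm_mult)
    finally have "l\<^sup>2 * norm (1 - of_real \<rho> / (\<i> * of_real l)) \<le> l\<^sup>2 * (1 + \<rho> / \<bar>l\<bar>)" by (intro mult_left_mono) auto
    also have "l\<^sup>2 * (1 + \<rho> / \<bar>l\<bar>) = \<bar>l\<bar> * (\<bar>l\<bar> + \<rho>)"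
      using False by (simp add: field_simps power2_eq_square)
    also have "\<dots> \<le> 1 * (1 + \<rho>)" using l rho_pos by (intro mult_mono) auto
    finally have 1: "l\<^sup>2 * norm (1 - of_real \<rho> / (\<i> * of_real l)) \<le> 1 + \<rho>" by simp
    have "rGamma (\<i> * of_real l) = \<i> * of_real l * rGamma (1 + \<i> * complex_of_real l)"
      using rGamma_plus1[of "\<i> * complex_of_real l"] by (simp add: add.commute)
    then have "(norm (rGamma (\<i> * of_real l)))\<^sup>2 = l\<^sup>2 * (norm (rGamma (1 + \<i> * complex_of_real l)))\<^sup>2"
      by (simp add: norm_mult power_mult_distrib)
    then have r: "1 / (norm (Gamma (\<i> * of_real l)))\<^sup>2 = l\<^sup>2 * (norm (rGamma (1 + \<i> * complex_of_real l)))\<^sup>2"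
      by (simp add: rGamma_inverse_Gamma norm_inverse power_inverse divide_inverse)
    have "norm (opdam_density \<alpha> \<beta> k l) = \<bar>k\<bar> * (norm (1 - of_real \<rho> / (\<i> * of_real l))
     * ((c_num l)\<^sup>2 * (1 / (norm (Gamma (\<i> * of_real l)))\<^sup>2) / d))"
      unfolding norm_opdam_density d_def by (simp add: mult_ac)
    also have "\<dots> = \<bar>k\<bar> * ((l\<^sup>2 * norm (1 - of_real \<rho> / (\<i> * of_real l))) * ?H l / d)"
      unfolding r by (simp add: power_mult_distrib mult_ac)
    also have "\<dots> \<le> \<bar>k\<bar> * ((1 + \<rho>) * B / d)"
      using d rho_pos by (intro mult_left_mono divide_right_mono mult_mono 1 B l) auto
    finally show ?thesis .
  qed
  moreover have "(1 + \<rho>) * B / d \<ge> 0" using B0 d rho_pos by simp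
  ultimately show ?thesis using that by blast
qed

end

section \<open>The high-frequency \<open>L2\<close> estimate\<close>

lemma ennreal_sum3_sq_le: "(x + y + z)\<^sup>2 \<le> 3 * (x\<^sup>2 + y\<^sup>2 + z\<^sup>2)" for x y z :: ennreal
proof (cases x; cases y; cases z)
  fix a b c :: real
  assume *: "x = ennreal a" "y = ennreal b" "z = ennreal c" "0 \<le> a" "0 \<le> b" "0 \<le> c"
  have "(a + b + c)\<^sup>2 \<le> 3 * (a\<^sup>2 + b\<^sup>2 + c\<^sup>2)"
    using sum_squares_bound[of a b] sum_squares_bound[of b c] sum_squares_bound[of a c]
    by (simp add: power2_eq_square algebra_simps)
  then have "ennreal ((a + b + c)\<^sup>2) \<le> ennreal (3 * (a\<^sup>2 + b\<^sup>2 + c\<^sup>2))" by (rule ennreal_leI)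
  also have "\<dots> = ennreal 3 * ennreal (a\<^sup>2 + b\<^sup>2 + c\<^sup>2)" by (rule ennreal_mult) auto
  also have "ennreal ((a + b + c)\<^sup>2) = (x + y + z)\<^sup>2" using * by (simp add: ennreal_power flip: ennreal_plus)
  also have "ennreal (a\<^sup>2 + b\<^sup>2 + c\<^sup>2) = x\<^sup>2 + y\<^sup>2 + z\<^sup>2" using * by (simp add: ennreal_power)
  finally show ?thesis by simp
qed (auto simp: power2_eq_square)

lemma nn_integral_fold:
  fixes g :: "real \<Rightarrow> ennreal"
  assumes [measurable]: "g \<in> borel_measurable borel"
  shows "(\<integral>\<^sup>+x. g x \<partial>lborel) = (\<integral>\<^sup>+x. (g x + g (- x)) * indicator {0<..} x \<partial>lborel)"
proof -
  have "(\<integral>\<^sup>+x. g x \<partial>lborel) = (\<integral>\<^sup>+x. g x * indicator {0<..} x + g x * indicator {..<0} x \<partial>lborel)"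
    using AE_lborel_singleton[of "0::real"]
    by (intro nn_integral_cong_AE) (auto elim!: eventually_mono simp: indicator_def)
  also have "\<dots> = (\<integral>\<^sup>+x. g x * indicator {0<..} x \<partial>lborel) + (\<integral>\<^sup>+x. g x * indicator {..<0} x \<partial>lborel)"
    by (rule nn_integral_add) auto
  also have "(\<integral>\<^sup>+x. g x * indicator {..<0} x \<partial>lborel) = ennreal \<bar>-1\<bar> * (\<integral>\<^sup>+x. g (0 + (-1) * x) * indicator {..<0} (0 + (-1) * x) \<partial>lborel)"
    by (rule nn_integral_real_affine) auto
  also have "\<dots> = (\<integral>\<^sup>+x. g (- x) * indicator {0<..} x \<partial>lborel)"
    by (auto intro!: nn_integral_cong simp: indicator_def)
  also have "(\<integral>\<^sup>+x. g x * indicator {0<..} x \<partial>lborel) + (\<integral>\<^sup>+x. g (- x) * indicator {0<..} x \<partial>lborel) = (\<integral>\<^sup>+x. g x * indicator {0<..} x + g (- x) * indicator {0<..} x \<partial>lborel)"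
    by (rule nn_integral_add[symmetric]) auto
  also have "\<dots> = (\<integral>\<^sup>+x. (g x + g (- x)) * indicator {0<..} x \<partial>lborel)"
    by (simp add: distrib_right)
  finally show ?thesis .
qed

lemma integral_fold:
  fixes g :: "real \<Rightarrow> complex"
  assumes g: "integrable lborel g"
  shows "(LINT x|lborel. g x) = (LINT x|lborel. indicator {0<..} x * (g x + g (- x)))"
proof -
  have [measurable]: "g \<in> borel_measurable borel" using g by auto
  have gm: "integrable lborel (\<lambda>x. g (- x))"
    using lborel_integrable_real_affine[OF g, of "-1" 0] by simp
  have i: "integrable lborel (\<lambda>x. indicator A x * g x)" if "A \<in> sets borel" for A
    using integrable_mult_indicator[of A lborel g] that g by (simp add: indicator_scaleR_eq_if scaleR_conv_of_real of_real_indicator)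
  have im: "integrable lborel (\<lambda>x. indicator A x * g (- x))" if "A \<in> sets borel" for A
    using integrable_mult_indicator[of A lborel "\<lambda>x. g (- x)"] that gm by (simp add: scaleR_conv_of_real of_real_indicator)
  have "(LINT x|lborel. g x) = (LINT x|lborel. indicator {0<..} x * g x + indicator {..<0} x * g x)"
    using AE_lborel_singleton[of "0::real"]
    by (intro integral_cong_AE) (auto elim!: eventually_mono simp: indicator_def)
  also have "\<dots> = (LINT x|lborel. indicator {0<..} x * g x) + (LINT x|lborel. indicator {..<0} x * g x)"
    by (intro Bochner_Integration.integral_add i) auto
  also have "(LINT x|lborel. indicator {..<0} x * g x) = \<bar>-1\<bar> *\<^sub>R (LINT x|lborel. indicator {..<0} (0 + (-1) * x) * g (0 + (-1) * x))"
    by (rule lborel_integral_real_affine) simp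
  also have "\<dots> = (LINT x|lborel. indicator {0<..} x * g (- x))"
    by (auto intro!: Bochner_Integration.integral_cong simp: indicator_def)
  also have "(LINT x|lborel. indicator {0<..} x * g x) + (LINT x|lborel. indicator {0<..} x * g (- x))
    = (LINT x|lborel. indicator {0<..} x * g x + indicator {0<..} x * g (- x))"
    by (intro Bochner_Integration.integral_add[symmetric] i im) auto
  finally show ?thesis by (simp add: distrib_left)
qed

section \<open>The \<open>L2\<close> bound for the normalized functions and for the
  transform\<close>

context jacobi_params
begin

lemma w_measurable[measurable]: "w \<in> borel_measurable borel"
proof -
  have [measurable]: "(sinh :: real \<Rightarrow> real) \<in> borel_measurable borel" "(cosh :: real \<Rightarrow> real) \<in> borel_measurable borel"
    by (intro borel_measurable_continuous_onI continuous_intros)+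
  show ?thesis unfolding w_def[abs_def] by measurable
qed

lemma phi_measurable[measurable]: "\<phi> l \<in> borel_measurable borel" and phi'_measurable[measurable]: "\<phi>' l \<in> borel_measurable borel"
  by (intro borel_measurable_continuous_onI cont_phi cont_phi')+

lemma u_measurable[measurable]: "u l \<in> borel_measurable borel"
  unfolding u_def[abs_def] by measurable

text \<open>The integral of h against u is a combination of two Fourier transforms, treated by
  Plancherel, and an error with kernel 2 / (1 + l x), treated by Schur's test. The constants of the
  asymptotics are chosen separately for each l; the measurable majorant \<open>Maj\<close> lets
  later integrals over l be split and reflected all the same.\<close>

lemma u_L2:
  fixes h :: "real \<Rightarrow> complex"
  assumes h: "integrable lborel h" and h0: "\<And>x. x \<le> 0 \<Longrightarrow> h x = 0"
  obtains Maj where "Maj \<in> borel_measurable borel"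
    "\<And>l. l \<ge> 1 \<Longrightarrow> ennreal ((norm (LINT x|lborel. h x * u l x))\<^sup>2 * l powr (2 * \<alpha> + 1)) \<le> Maj l"
    "(\<integral>\<^sup>+l. Maj l * indicator {0<..} l \<partial>lborel)
      \<le> ennreal (3 * asymp_const\<^sup>2 * (4 * pi + 4 * pi\<^sup>2)) * (\<integral>\<^sup>+x. ennreal ((norm (h x))\<^sup>2) \<partial>lborel)"
proof -
  let ?a = asymp_const
  have a: "?a > 0" by (rule asymp_const_pos)
  have [measurable]: "h \<in> borel_measurable borel" using h by auto
  define E where "E l = (\<integral>\<^sup>+x. ennreal (norm (h x)) * ennreal (2 / (1 + l * x)) * indicator {0<..} x \<partial>lborel)" for l
  have hc: "integrable lborel (\<lambda>x. h x * cis (t * x))" for t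
    by (rule Bochner_Integration.integrable_bound[OF h]) (auto simp: norm_mult)
  have point: "ennreal ((norm (LINT x|lborel. h x * u l x))\<^sup>2 * l powr (2 * \<alpha> + 1)) \<le>
      3 * ((ennreal ?a * ennreal (norm (ft h l)))\<^sup>2 + (ennreal ?a * ennreal (norm (ft h (- l))))\<^sup>2 + (ennreal ?a * E l)\<^sup>2)"
    if l: "l \<ge> 1" for l
  proof -
    obtain c d where cd: "norm c \<le> ?a" "norm d \<le> ?a"
      "\<And>x. x > 0 \<Longrightarrow> norm (of_real (l powr (\<alpha> + 1 / 2)) * u l x - (c * cis (l * x) + d * cis (- (l * x)))) \<le> ?a * min 1 (1 / (l * x))"
      using u_asymptotics[OF l] by blast
    let ?p = "complex_of_real (l powr (\<alpha> + 1 / 2))"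
    let ?m = "\<lambda>x. c * cis (l * x) + d * cis (- (l * x))"
    let ?r = "\<lambda>x. h x * (?p * u l x - ?m x)"
    have rb: "norm (?r x) \<le> ?a * (norm (h x) * (2 / (1 + l * x) * indicator {0<..} x))" for x
    proof (cases "x > 0")
      case True
      have lx: "l * x > 0" using l True by simp
      \<comment> \<open>Replaces the minimum of the asymptotics by the kernel of
        \<open>hardy_kernel_L2\<close>.\<close>
      have "min 1 (1 / (l * x)) \<le> 2 / (1 + l * x)"
        using lx by (cases "l * x \<le> 1") (auto simp: min_def field_simps)
      then have "norm (?p * u l x - ?m x) \<le> ?a * (2 / (1 + l * x))"
        using cd(3)[OF True] a by (meson mult_left_mono less_imp_le order_trans)
      then have "norm (h x) * norm (?p * u l x - ?m x) \<le> norm (h x) * (?a * (2 / (1 + l * x)))" by (rule mult_left_mono) simp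
      then show ?thesis using True by (simp add: norm_mult mult_ac)
    qed (simp add: h0)
    have int_r: "integrable lborel ?r"
    proof (rule Bochner_Integration.integrable_bound[of _ "\<lambda>x. 2 * ?a * norm (h x)"])
      show "integrable lborel (\<lambda>x. 2 * ?a * norm (h x))" using h by simp
      show "AE x in lborel. norm (?r x) \<le> norm (2 * ?a * norm (h x))"
      proof (rule AE_I2)
        fix x
        have "2 / (1 + l * x) * indicator {0<..} x \<le> (2::real)"
          using l by (auto simp: indicator_def divide_le_eq mult_nonneg_nonneg add_pos_nonneg)
        then have "?a * (norm (h x) * (2 / (1 + l * x) * indicator {0<..} x)) \<le> ?a * (norm (h x) * 2)"
          using a by (intro mult_left_mono) auto
        then show "norm (?r x) \<le> norm (2 * ?a * norm (h x))" using rb[of x] a by simp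
      qed
    qed measurable
    have "?p * (LINT x|lborel. h x * u l x) = (LINT x|lborel. ?p * (h x * u l x))" by simp
    also have "\<dots> = (LINT x|lborel. (c * (h x * cis (l * x)) + d * (h x * cis ((- l) * x))) + ?r x)"
      by (intro Bochner_Integration.integral_cong) (auto simp: algebra_simps)
    also have "\<dots> = (c * ft h l + d * ft h (- l)) + (LINT x|lborel. ?r x)"
      unfolding ft_def using int_r hc[of l] hc[of "- l"]
      by (subst Bochner_Integration.integral_add) auto
    finally have eq: "?p * (LINT x|lborel. h x * u l x) = (c * ft h l + d * ft h (- l)) + (LINT x|lborel. ?r x)" .
    have rE: "ennreal (norm (LINT x|lborel. ?r x)) \<le> ennreal ?a * E l"
    proof -
      have "ennreal (norm (LINT x|lborel. ?r x)) \<le> (\<integral>\<^sup>+x. norm (?r x) \<partial>lborel)" by (rule norm_integral_le_nn_integral)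
      also have "\<dots> \<le> (\<integral>\<^sup>+x. ennreal ?a * (ennreal (norm (h x)) * ennreal (2 / (1 + l * x)) * indicator {0<..} x) \<partial>lborel)"
      proof (intro nn_integral_mono)
        fix x
        have "ennreal (norm (?r x)) \<le> ennreal (?a * (norm (h x) * (2 / (1 + l * x) * indicator {0<..} x)))"
          by (rule ennreal_leI[OF rb])
        also have "\<dots> = ennreal ?a * (ennreal (norm (h x)) * ennreal (2 / (1 + l * x)) * indicator {0<..} x)"
        proof (cases "x > 0")
          case True
          then have "2 / (1 + l * x) \<ge> 0" using l by simp
          moreover have "ennreal (?a * (norm (h x) * k)) = ennreal ?a * (ennreal (norm (h x)) * ennreal k)" if "k \<ge> 0" for k
            using a that by (simp add: ennreal_mult)
          ultimately show ?thesis using True by (simp only: indicator_simps greaterThan_iff mult_1_right)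
        qed simp
        finally show "ennreal (norm (?r x)) \<le> ennreal ?a * (ennreal (norm (h x)) * ennreal (2 / (1 + l * x)) * indicator {0<..} x)" .
      qed
      also have "\<dots> = ennreal ?a * E l" unfolding E_def by (rule nn_integral_cmult) measurable
      finally show ?thesis .
    qed
    have "norm (?p * (LINT x|lborel. h x * u l x)) \<le> ?a * norm (ft h l) + ?a * norm (ft h (- l)) + norm (LINT x|lborel. ?r x)"
      unfolding eq
      by (intro order_trans[OF norm_triangle_ineq] add_mono order.refl)
         (auto simp: norm_mult cd intro!: mult_right_mono)
    then have "ennreal (norm (?p * (LINT x|lborel. h x * u l x))) \<le> ennreal (?a * norm (ft h l) + ?a * norm (ft h (- l)) + norm (LINT x|lborel. ?r x))"
      by (rule ennreal_leI)
    also have "\<dots> = ennreal ?a * ennreal (norm (ft h l)) + ennreal ?a * ennreal (norm (ft h (- l))) + ennreal (norm (LINT x|lborel. ?r x))"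
      using a by (simp add: ennreal_mult)
    also have "\<dots> \<le> ennreal ?a * ennreal (norm (ft h l)) + ennreal ?a * ennreal (norm (ft h (- l))) + ennreal ?a * E l"
      by (intro add_left_mono rE)
    finally have "(ennreal (norm (?p * (LINT x|lborel. h x * u l x))))\<^sup>2 \<le> (ennreal ?a * ennreal (norm (ft h l)) + ennreal ?a * ennreal (norm (ft h (- l))) + ennreal ?a * E l)\<^sup>2"
      by (rule power_mono) simp
    also have "\<dots> \<le> 3 * ((ennreal ?a * ennreal (norm (ft h l)))\<^sup>2 + (ennreal ?a * ennreal (norm (ft h (- l))))\<^sup>2 + (ennreal ?a * E l)\<^sup>2)"
      by (rule ennreal_sum3_sq_le)
    also have "(ennreal (norm (?p * (LINT x|lborel. h x * u l x))))\<^sup>2 = ennreal ((norm (LINT x|lborel. h x * u l x))\<^sup>2 * l powr (2 * \<alpha> + 1))"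
    proof -
      have "(l powr (\<alpha> + 1 / 2))\<^sup>2 = l powr (2 * \<alpha> + 1)"
        unfolding power2_eq_square powr_add[symmetric] by (rule arg_cong[where f = "\<lambda>e. l powr e"]) simp
      then show ?thesis by (simp add: ennreal_power norm_mult power_mult_distrib mult.commute)
    qed
    finally show ?thesis .
  qed
  have Em[measurable]: "E \<in> borel_measurable borel" unfolding E_def[abs_def] by measurable
  define Maj where "Maj l = 3 * ((ennreal ?a * ennreal (norm (ft h l)))\<^sup>2 + (ennreal ?a * ennreal (norm (ft h (- l))))\<^sup>2 + (ennreal ?a * E l)\<^sup>2)" for l
  have "(\<integral>\<^sup>+l. Maj l * indicator {0<..} l \<partial>lborel)
    \<le> (\<integral>\<^sup>+l. ennreal (3 * ?a\<^sup>2) * ennreal ((norm (ft h l))\<^sup>2) + ennreal (3 * ?a\<^sup>2) * ennreal ((norm (ft h (- l)))\<^sup>2) + ennreal (3 * ?a\<^sup>2) * ((E l)\<^sup>2 * indicator {0<..} l) \<partial>lborel)"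
  proof (intro nn_integral_mono)
    fix l :: real
    have A: "3 * (ennreal ?a * X)\<^sup>2 = ennreal (3 * ?a\<^sup>2) * X\<^sup>2" for X
      using a by (simp add: power_mult_distrib ennreal_mult ennreal_power mult.assoc)
    show "Maj l * indicator {0<..} l \<le>
      ennreal (3 * ?a\<^sup>2) * ennreal ((norm (ft h l))\<^sup>2) + ennreal (3 * ?a\<^sup>2) * ennreal ((norm (ft h (- l)))\<^sup>2) + ennreal (3 * ?a\<^sup>2) * ((E l)\<^sup>2 * indicator {0<..} l)"
      by (cases "l > 0") (auto simp: Maj_def distrib_left A ennreal_power)
  qed
  also have "\<dots> = ennreal (3 * ?a\<^sup>2) * (\<integral>\<^sup>+l. ennreal ((norm (ft h l))\<^sup>2) \<partial>lborel) + ennreal (3 * ?a\<^sup>2) * (\<integral>\<^sup>+l. ennreal ((norm (ft h (- l)))\<^sup>2) \<partial>lborel)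
     + ennreal (3 * ?a\<^sup>2) * (\<integral>\<^sup>+l. (E l)\<^sup>2 * indicator {0<..} l \<partial>lborel)"
    by (simp add: nn_integral_add nn_integral_cmult)
  also have "(\<integral>\<^sup>+l. ennreal ((norm (ft h (- l)))\<^sup>2) \<partial>lborel) = (\<integral>\<^sup>+l. ennreal ((norm (ft h l))\<^sup>2) \<partial>lborel)"
    using nn_integral_real_affine[of "\<lambda>l. ennreal ((norm (ft h l))\<^sup>2)" "-1" 0] by simp
  also have "ennreal (3 * ?a\<^sup>2) * (\<integral>\<^sup>+l. ennreal ((norm (ft h l))\<^sup>2) \<partial>lborel) + ennreal (3 * ?a\<^sup>2) * (\<integral>\<^sup>+l. ennreal ((norm (ft h l))\<^sup>2) \<partial>lborel)
     + ennreal (3 * ?a\<^sup>2) * (\<integral>\<^sup>+l. (E l)\<^sup>2 * indicator {0<..} l \<partial>lborel)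
    \<le> ennreal (3 * ?a\<^sup>2) * (ennreal (2 * pi) * (\<integral>\<^sup>+x. ennreal ((norm (h x))\<^sup>2) \<partial>lborel)) + ennreal (3 * ?a\<^sup>2) * (ennreal (2 * pi) * (\<integral>\<^sup>+x. ennreal ((norm (h x))\<^sup>2) \<partial>lborel))
     + ennreal (3 * ?a\<^sup>2) * (ennreal (4 * pi\<^sup>2) * (\<integral>\<^sup>+x. ennreal ((norm (h x))\<^sup>2) \<partial>lborel))"
  proof (intro add_mono mult_left_mono plancherel_le h)
    have "(\<integral>\<^sup>+l. (E l)\<^sup>2 * indicator {0<..} l \<partial>lborel) \<le> ennreal (4 * pi\<^sup>2) * (\<integral>\<^sup>+x. (ennreal (norm (h x)))\<^sup>2 * indicator {0<..} x \<partial>lborel)"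
      unfolding E_def by (rule hardy_kernel_L2) measurable
    also have "\<dots> \<le> ennreal (4 * pi\<^sup>2) * (\<integral>\<^sup>+x. ennreal ((norm (h x))\<^sup>2) \<partial>lborel)"
      by (intro mult_left_mono nn_integral_mono) (auto simp: ennreal_power indicator_def)
    finally show "(\<integral>\<^sup>+l. (E l)\<^sup>2 * indicator {0<..} l \<partial>lborel) \<le> ennreal (4 * pi\<^sup>2) * (\<integral>\<^sup>+x. ennreal ((norm (h x))\<^sup>2) \<partial>lborel)" .
  qed auto
  \<comment> \<open>The constant collects 3 from the square of a sum of three terms, twice 2 pi from
    Plancherel at l and - l, and 4 pi^2 from Schur's test.\<close>
  also have "\<dots> = ennreal (3 * asymp_const\<^sup>2 * (4 * pi + 4 * pi\<^sup>2)) * (\<integral>\<^sup>+x. ennreal ((norm (h x))\<^sup>2) \<partial>lborel)"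
  proof -
    have "ennreal A * (ennreal B * I) + ennreal A * (ennreal B * I) + ennreal A * (ennreal D * I)
      = ennreal (A * B + A * B + A * D) * I" if "A \<ge> 0" "B \<ge> 0" "D \<ge> 0" for A B D I
      using that by (simp only: ennreal_plus ennreal_mult mult_nonneg_nonneg add_nonneg_nonneg distrib_right mult.assoc)
    from this[of "3 * ?a\<^sup>2" "2 * pi" "4 * pi\<^sup>2"]
    have "ennreal (3 * ?a\<^sup>2) * (ennreal (2 * pi) * I) + ennreal (3 * ?a\<^sup>2) * (ennreal (2 * pi) * I) + ennreal (3 * ?a\<^sup>2) * (ennreal (4 * pi\<^sup>2) * I)
      = ennreal (3 * ?a\<^sup>2 * (2 * pi) + 3 * ?a\<^sup>2 * (2 * pi) + 3 * ?a\<^sup>2 * (4 * pi\<^sup>2)) * I" for I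
      by simp
    also have "3 * ?a\<^sup>2 * (2 * pi) + 3 * ?a\<^sup>2 * (2 * pi) + 3 * ?a\<^sup>2 * (4 * pi\<^sup>2) = 3 * ?a\<^sup>2 * (4 * pi + 4 * pi\<^sup>2)"
      by (simp add: algebra_simps)
    finally show ?thesis .
  qed
  finally have 2: "(\<integral>\<^sup>+l. Maj l * indicator {0<..} l \<partial>lborel)
      \<le> ennreal (3 * asymp_const\<^sup>2 * (4 * pi + 4 * pi\<^sup>2)) * (\<integral>\<^sup>+x. ennreal ((norm (h x))\<^sup>2) \<partial>lborel)" .
  show ?thesis
  proof (rule that[OF _ _ 2])
    show "Maj \<in> borel_measurable borel" unfolding Maj_def[abs_def] by measurable
    show "ennreal ((norm (LINT x|lborel. h x * u l x))\<^sup>2 * l powr (2 * \<alpha> + 1)) \<le> Maj l" if "l \<ge> 1" for l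
      unfolding Maj_def by (rule point[OF that])
  qed
qed

lemma w_sq_nonneg: "x \<ge> 0 \<Longrightarrow> jacobi_weight \<alpha> \<beta> x = (w x)\<^sup>2"
  using w_sq[of x] by (cases "x = 0") (simp add: w_def jacobi_weight_def, simp)

lemma jacobi_mu_eq: "jacobi_mu \<alpha> \<beta> = density lborel (\<lambda>x. ennreal ((w \<bar>x\<bar>)\<^sup>2))"
  unfolding jacobi_mu_def by (simp add: w_sq_nonneg)

lemma sets_jacobi_mu[measurable_cong]: "sets (jacobi_mu \<alpha> \<beta>) = sets borel"
  by (simp add: jacobi_mu_eq)

lemma nn_integral_jacobi_mu:
  assumes [measurable]: "f \<in> borel_measurable borel"
  shows "(\<integral>\<^sup>+x. f x \<partial>jacobi_mu \<alpha> \<beta>) = (\<integral>\<^sup>+x. ennreal ((w \<bar>x\<bar>)\<^sup>2) * f x \<partial>lborel)"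
  unfolding jacobi_mu_eq by (rule nn_integral_density) measurable

lemma integral_jacobi_mu:
  fixes f :: "real \<Rightarrow> complex"
  assumes [measurable]: "f \<in> borel_measurable borel"
  shows "(LINT x|jacobi_mu \<alpha> \<beta>. f x) = (LINT x|lborel. of_real ((w \<bar>x\<bar>)\<^sup>2) * f x)"
  unfolding jacobi_mu_eq by (subst integral_density) (auto simp: scaleR_conv_of_real)

lemma integrable_jacobi_mu:
  fixes f :: "real \<Rightarrow> complex"
  assumes [measurable]: "f \<in> borel_measurable borel"
  shows "integrable (jacobi_mu \<alpha> \<beta>) f \<longleftrightarrow> integrable lborel (\<lambda>x. of_real ((w \<bar>x\<bar>)\<^sup>2) * f x)"
  unfolding jacobi_mu_eq by (subst integrable_density) (auto simp: scaleR_conv_of_real)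

lemma opdam_G_reflect:
  assumes "l \<noteq> - \<i> * of_real \<rho>"
  shows "opdam_G \<alpha> \<beta> l (- x) = \<phi> l x + \<phi>' l x / (of_real \<rho> - \<i> * l)"
  unfolding opdam_G_params[OF assms] by (simp add: jacobi_fun_even jacobi_fun'_odd)

lemma opdam_G_measurable:
  assumes "l \<noteq> - \<i> * of_real \<rho>"
  shows "opdam_G \<alpha> \<beta> l \<in> borel_measurable borel"
  unfolding opdam_G_params[OF assms, abs_def] by measurable

lemma u_abs: "u \<bar>l\<bar> x = u l x"
  by (cases "l \<ge> 0") (auto simp: u_def jacobi_fun_uminus)

text \<open>Folding the integral to x > 0 pairs the even part of f with \<phi> and the odd part with
  \<phi>', a shifted Jacobi function. The factor (\<rho>^2 + l^2) / (2 (\<alpha> + 1) (\<rho> - i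
  l)) in front of the latter is of size |l|; its square turns the weight of exponent 2 \<alpha> + 1
  into the one belonging to \<alpha> + 1. Lebesgue integrability of w f on both half-lines is what
  Plancherel's inequality asks for.\<close>

lemma opdam_L2_bounded_support:
  obtains C where "C > 0"
    "\<And>f. f \<in> borel_measurable borel \<Longrightarrow> (\<And>l::real. integrable (jacobi_mu \<alpha> \<beta>) (\<lambda>x. f x * opdam_G \<alpha> \<beta> (of_real l) (- x))) \<Longrightarrow>
      integrable lborel (\<lambda>x. indicator {0<..} x * of_real (w x) * f x) \<Longrightarrow>
      integrable lborel (\<lambda>x. indicator {0<..} x * of_real (w x) * f (- x)) \<Longrightarrow>
      (\<integral>\<^sup>+l. ennreal ((norm (cherednik_opdam \<alpha> \<beta> f (of_real l)))\<^sup>2 * \<bar>l\<bar> powr (2 * \<alpha> + 1)) * indicator {l. \<bar>l\<bar> \<ge> 1} l \<partial>lborel)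
        \<le> ennreal C * (\<integral>\<^sup>+x. ennreal ((norm (f x))\<^sup>2) \<partial>jacobi_mu \<alpha> \<beta>)"
proof -
  interpret S: jacobi_params "\<alpha> + 1" "\<beta> + 1"
    using beta alpha alpha_beta by unfold_locales auto
  define C1 where "C1 = 3 * asymp_const\<^sup>2 * (4 * pi + 4 * pi\<^sup>2)"
  define C2 where "C2 = 3 * S.asymp_const\<^sup>2 * (4 * pi + 4 * pi\<^sup>2)"
  \<comment> \<open>Chosen so that the factor in front of the odd part has squared modulus at most m
    l^2 for |l| \<ge> 1.\<close>
  define m where "m = (1 + \<rho>\<^sup>2) / (4 * (\<alpha> + 1)\<^sup>2)"
  have m: "m \<ge> 0" by (simp add: m_def)
  have C12: "C1 > 0" "C2 > 0" using asymp_const_pos S.asymp_const_pos by (auto simp: C1_def C2_def intro!: mult_pos_pos add_pos_pos)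
  \<comment> \<open>The 8 is 2 * 2 * 2: the square of a sum of two terms, the two signs of l, and
    the square of f(x) \<plusminus> f(- x).\<close>
  define C where "C = 8 * C1 + 8 * m * C2"
  have C: "C > 0" using C12 m by (simp add: C_def add_pos_nonneg)
  have "(\<integral>\<^sup>+l. ennreal ((norm (cherednik_opdam \<alpha> \<beta> f (of_real l)))\<^sup>2 * \<bar>l\<bar> powr (2 * \<alpha> + 1)) * indicator {l. \<bar>l\<bar> \<ge> 1} l \<partial>lborel)
        \<le> ennreal C * (\<integral>\<^sup>+x. ennreal ((norm (f x))\<^sup>2) \<partial>jacobi_mu \<alpha> \<beta>)"
    if f[measurable]: "f \<in> borel_measurable borel" and int: "\<And>l::real. integrable (jacobi_mu \<alpha> \<beta>) (\<lambda>x. f x * opdam_G \<alpha> \<beta> (of_real l) (- x))"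
      and ip: "integrable lborel (\<lambda>x. indicator {0<..} x * of_real (w x) * f x)" and im: "integrable lborel (\<lambda>x. indicator {0<..} x * of_real (w x) * f (- x))" for f
  proof -
    define he where "he x = indicator {0<..} x * of_real (w x) * (f x + f (- x))" for x
    define ho where "ho x = indicator {0<..} x * of_real (w x) * (f x - f (- x))" for x
    have he: "integrable lborel he" and ho: "integrable lborel ho"
      unfolding he_def[abs_def] ho_def[abs_def] distrib_left right_diff_distrib using ip im by auto
    have [measurable]: "he \<in> borel_measurable borel" "ho \<in> borel_measurable borel" using he ho by auto
    have he0: "he x = 0" and ho0: "ho x = 0" if "x \<le> 0" for x using that by (auto simp: he_def ho_def)
    obtain M1 where M1[measurable]: "M1 \<in> borel_measurable borel"
      and M1b: "\<And>l. l \<ge> 1 \<Longrightarrow> ennreal ((norm (LINT x|lborel. he x * u l x))\<^sup>2 * l powr (2 * \<alpha> + 1)) \<le> M1 l"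
      and M1i: "(\<integral>\<^sup>+l. M1 l * indicator {0<..} l \<partial>lborel) \<le> ennreal C1 * (\<integral>\<^sup>+x. ennreal ((norm (he x))\<^sup>2) \<partial>lborel)"
      using u_L2[OF he he0] unfolding C1_def by blast
    obtain M2 where M2[measurable]: "M2 \<in> borel_measurable borel"
      and M2b: "\<And>l. l \<ge> 1 \<Longrightarrow> ennreal ((norm (LINT x|lborel. ho x * S.u l x))\<^sup>2 * l powr (2 * (\<alpha> + 1) + 1)) \<le> M2 l"
      and M2i: "(\<integral>\<^sup>+l. M2 l * indicator {0<..} l \<partial>lborel) \<le> ennreal C2 * (\<integral>\<^sup>+x. ennreal ((norm (ho x))\<^sup>2) \<partial>lborel)"
      using S.u_L2[OF ho ho0] unfolding C2_def by blast
    have split: "cherednik_opdam \<alpha> \<beta> f (of_real l) = (LINT x|lborel. he x * u \<bar>l\<bar> x)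
        - (of_real (\<rho>\<^sup>2 + l\<^sup>2) / (2 * of_real (\<alpha> + 1) * (of_real \<rho> - \<i> * of_real l))) * (LINT x|lborel. ho x * S.u \<bar>l\<bar> x)"
      if l: "\<bar>l\<bar> \<ge> 1" for l
    proof -
      define d where "d = complex_of_real \<rho> - \<i> * of_real l"
      have d0: "d \<noteq> 0" using rho_pos by (simp add: d_def complex_eq_iff)
      let ?G = "opdam_G \<alpha> \<beta> (of_real l)"
      let ?k = "of_real (\<rho>\<^sup>2 + l\<^sup>2) / (2 * of_real (\<alpha> + 1) * d)"
      have [measurable]: "?G \<in> borel_measurable borel" by (rule opdam_G_measurable[OF of_real_ne_special])
      have I: "integrable lborel (\<lambda>x. of_real ((w \<bar>x\<bar>)\<^sup>2) * (f x * ?G (- x)))"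
        using int[of l] by (subst (asm) integrable_jacobi_mu) auto
      have bnd: "integrable lborel (\<lambda>x. h x * U x)" if h: "integrable lborel h" "\<And>x. x \<le> 0 \<Longrightarrow> h x = 0"
        and U[measurable]: "U \<in> borel_measurable borel" and UB: "\<And>x. x > 0 \<Longrightarrow> norm (U x) \<le> B" for h U :: "real \<Rightarrow> complex" and B
      proof (rule Bochner_Integration.integrable_bound[of _ "\<lambda>x. B * norm (h x)"])
        have [measurable]: "h \<in> borel_measurable borel" using h by auto
        show "(\<lambda>x. h x * U x) \<in> borel_measurable lborel" by measurable
        have B0: "B \<ge> 0" using order_trans[OF norm_ge_zero UB[of 1]] by simp
        show "AE x in lborel. norm (h x * U x) \<le> norm (B * norm (h x))"
        proof (rule AE_I2)
          fix x
          show "norm (h x * U x) \<le> norm (B * norm (h x))"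
            using UB[of x] h(2)[of x] B0 by (cases "x > 0") (auto simp: norm_mult mult.commute[of "norm (h x)"] intro!: mult_right_mono)
        qed
      qed (use h in simp)
      have Ie: "integrable lborel (\<lambda>x. he x * u \<bar>l\<bar> x)" by (rule bnd[OF he he0 _ u_bound_all[OF l]]) auto
      have Io: "integrable lborel (\<lambda>x. ho x * S.u \<bar>l\<bar> x)" by (rule bnd[OF ho ho0 _ S.u_bound_all[OF l]]) auto
      have "cherednik_opdam \<alpha> \<beta> f (of_real l) = (LINT x|lborel. of_real ((w \<bar>x\<bar>)\<^sup>2) * (f x * ?G (- x)))"
        unfolding cherednik_opdam_def by (rule integral_jacobi_mu) measurable
      also have "\<dots> = (LINT x|lborel. indicator {0<..} x * (of_real ((w \<bar>x\<bar>)\<^sup>2) * (f x * ?G (- x)) + of_real ((w \<bar>- x\<bar>)\<^sup>2) * (f (- x) * ?G (- (- x)))))"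
        by (rule integral_fold[OF I])
      also have "\<dots> = (LINT x|lborel. he x * u \<bar>l\<bar> x - ?k * (ho x * S.u \<bar>l\<bar> x))"
      proof (intro Bochner_Integration.integral_cong refl)
        fix x :: real
        show "indicator {0<..} x * (of_real ((w \<bar>x\<bar>)\<^sup>2) * (f x * ?G (- x)) + of_real ((w \<bar>- x\<bar>)\<^sup>2) * (f (- x) * ?G (- (- x)))) = he x * u \<bar>l\<bar> x - ?k * (ho x * S.u \<bar>l\<bar> x)"
        proof (cases "x > 0")
          case True
          \<comment> \<open>The square root of the shifted weight contains precisely the factor sinh
            x cosh x that occurs in \<open>\<phi>'\<close> beside the shifted Jacobi
            function.\<close>
          have e1: "S.w x = w x * (sinh x * cosh x)"
          proof -
            have "sinh x powr (\<alpha> + 1 + 1 / 2) = sinh x powr (\<alpha> + 1 / 2) * sinh x" "cosh x powr (\<beta> + 1 + 1 / 2) = cosh x powr (\<beta> + 1 / 2) * cosh x"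
              using powr_add[of "sinh x" "\<alpha> + 1 / 2" 1] powr_add[of "cosh x" "\<beta> + 1 / 2" 1] True by (simp_all add: algebra_simps)
            then show ?thesis by (simp add: S.w_def w_def)
          qed
          define a where "a = complex_of_real (\<alpha> + 1)"
          define s where "s = complex_of_real (sinh x)"
          define c where "c = complex_of_real (cosh x)"
          define W where "W = complex_of_real (w x)"
          define K where "K = complex_of_real (\<rho>\<^sup>2 + l\<^sup>2)"
          define p where "p = \<phi> (of_real l) x"
          define p1 where "p1 = jacobi_fun (\<alpha> + 1) (\<beta> + 1) (of_real l) x"
          have a0: "a \<noteq> 0" unfolding a_def of_real_eq_0_iff using alpha by simp
          have p': "\<phi>' (of_real l) x = - (2 * s * c / (4 * a)) * K * p1"
            unfolding jacobi_fun'_def a_def s_def c_def K_def p1_def sinh_double by simp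
          have U: "u \<bar>l\<bar> x = W * p" "S.u \<bar>l\<bar> x = W * (s * c) * p1"
            unfolding u_abs S.u_abs by (simp_all add: u_def S.u_def p_def p1_def e1 W_def s_def c_def)
          have g: "?G (- x) = p - s * c / (2 * a) * K * p1 / d" "?G (- (- x)) = p + s * c / (2 * a) * K * p1 / d"
            unfolding opdam_G_reflect[OF of_real_ne_special] d_def[symmetric]
            by (simp_all add: p' jacobi_fun_even jacobi_fun'_odd p_def[symmetric])
          have wx: "complex_of_real ((w \<bar>x\<bar>)\<^sup>2) = W * W" "complex_of_real ((w \<bar>- x\<bar>)\<^sup>2) = W * W"
            using True by (simp_all add: W_def power2_eq_square)
          show ?thesis using True d0 a0 unfolding he_def ho_def U g wx K_def[symmetric] a_def[symmetric] W_def[symmetric]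
            by (simp add: field_simps)
        qed (simp add: he_def ho_def)
      qed
      also have "\<dots> = (LINT x|lborel. he x * u \<bar>l\<bar> x) - ?k * (LINT x|lborel. ho x * S.u \<bar>l\<bar> x)"
        using Ie Io by (subst Bochner_Integration.integral_diff) auto
      finally show ?thesis unfolding d_def .
    qed
    have point: "ennreal ((norm (cherednik_opdam \<alpha> \<beta> f (of_real l)))\<^sup>2 * \<bar>l\<bar> powr (2 * \<alpha> + 1)) \<le> 2 * M1 \<bar>l\<bar> + ennreal (2 * m) * M2 \<bar>l\<bar>"
      if l: "\<bar>l\<bar> \<ge> 1" for l
    proof -
      let ?A = "LINT x|lborel. he x * u \<bar>l\<bar> x" and ?B = "LINT x|lborel. ho x * S.u \<bar>l\<bar> x"
      let ?k = "of_real (\<rho>\<^sup>2 + l\<^sup>2) / (2 * of_real (\<alpha> + 1) * (of_real \<rho> - \<i> * of_real l)) :: complex"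
      have nk: "(norm ?k)\<^sup>2 \<le> m * l\<^sup>2"
      proof -
        have pp: "\<rho>\<^sup>2 + l\<^sup>2 > 0" using rho_pos by (simp add: add_pos_nonneg)
        have "(norm (complex_of_real \<rho> - \<i> * of_real l))\<^sup>2 = \<rho>\<^sup>2 + l\<^sup>2" by (simp add: cmod_power2)
        moreover have "(norm (2 * complex_of_real (\<alpha> + 1)))\<^sup>2 = 4 * (\<alpha> + 1)\<^sup>2"
          unfolding norm_mult norm_of_real by (simp add: power_mult_distrib)
        ultimately have "(norm ?k)\<^sup>2 = (\<rho>\<^sup>2 + l\<^sup>2)\<^sup>2 / (4 * (\<alpha> + 1)\<^sup>2 * (\<rho>\<^sup>2 + l\<^sup>2))"
          unfolding norm_divide norm_mult[of "2 * complex_of_real (\<alpha> + 1)"] power_divide power_mult_distrib norm_of_real by simp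
        also have "\<dots> = (\<rho>\<^sup>2 + l\<^sup>2) / (4 * (\<alpha> + 1)\<^sup>2)" using pp by (simp add: power2_eq_square)
        also have "\<dots> \<le> ((1 + \<rho>\<^sup>2) * l\<^sup>2) / (4 * (\<alpha> + 1)\<^sup>2)"
        proof (intro divide_right_mono)
          have "1 \<le> l\<^sup>2" using power_mono[OF l, of 2] by simp
          then have "\<rho>\<^sup>2 * 1 \<le> \<rho>\<^sup>2 * l\<^sup>2" by (intro mult_left_mono) auto
          then show "\<rho>\<^sup>2 + l\<^sup>2 \<le> (1 + \<rho>\<^sup>2) * l\<^sup>2" by (simp add: algebra_simps)
        qed auto
        finally show ?thesis by (simp add: m_def)
      qed
      have "(norm (?A - ?k * ?B))\<^sup>2 \<le> (norm ?A + norm (?k * ?B))\<^sup>2" by (intro power_mono norm_triangle_ineq4) auto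
      also have "\<dots> \<le> 2 * (norm ?A)\<^sup>2 + 2 * (norm (?k * ?B))\<^sup>2"
        using sum_squares_bound[of "norm ?A" "norm (?k * ?B)"] by (simp add: power2_sum)
      also have "(norm (?k * ?B))\<^sup>2 \<le> m * l\<^sup>2 * (norm ?B)\<^sup>2"
        unfolding norm_mult[of ?k] power_mult_distrib by (intro mult_right_mono nk) auto
      finally have "(norm (cherednik_opdam \<alpha> \<beta> f (of_real l)))\<^sup>2 \<le> 2 * (norm ?A)\<^sup>2 + 2 * (m * l\<^sup>2 * (norm ?B)\<^sup>2)"
        unfolding split[OF l] by simp
      then have "(norm (cherednik_opdam \<alpha> \<beta> f (of_real l)))\<^sup>2 * \<bar>l\<bar> powr (2 * \<alpha> + 1) \<le> (2 * (norm ?A)\<^sup>2 + 2 * (m * l\<^sup>2 * (norm ?B)\<^sup>2)) * \<bar>l\<bar> powr (2 * \<alpha> + 1)"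
        by (intro mult_right_mono) auto
      also have "\<dots> = 2 * ((norm ?A)\<^sup>2 * \<bar>l\<bar> powr (2 * \<alpha> + 1)) + 2 * m * ((norm ?B)\<^sup>2 * \<bar>l\<bar> powr (2 * (\<alpha> + 1) + 1))"
      proof -
        have "\<bar>l\<bar> powr (2 * (\<alpha> + 1) + 1) = \<bar>l\<bar> powr (2 * \<alpha> + 1) * l\<^sup>2"
          using powr_add[of "\<bar>l\<bar>" "2 * \<alpha> + 1" 2] l by (simp add: algebra_simps)
        then show ?thesis by (simp add: algebra_simps)
      qed
      finally have "ennreal ((norm (cherednik_opdam \<alpha> \<beta> f (of_real l)))\<^sup>2 * \<bar>l\<bar> powr (2 * \<alpha> + 1)) \<le> ennreal (2 * ((norm ?A)\<^sup>2 * \<bar>l\<bar> powr (2 * \<alpha> + 1)) + 2 * m * ((norm ?B)\<^sup>2 * \<bar>l\<bar> powr (2 * (\<alpha> + 1) + 1)))"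
        by (rule ennreal_leI)
      also have "\<dots> = ennreal 2 * ennreal ((norm ?A)\<^sup>2 * \<bar>l\<bar> powr (2 * \<alpha> + 1)) + ennreal (2 * m) * ennreal ((norm ?B)\<^sup>2 * \<bar>l\<bar> powr (2 * (\<alpha> + 1) + 1))"
        using m by (subst ennreal_plus) (auto simp only: ennreal_mult zero_le_mult_iff, auto simp: ennreal_mult)
      also have "\<dots> \<le> ennreal 2 * M1 \<bar>l\<bar> + ennreal (2 * m) * M2 \<bar>l\<bar>"
        by (intro add_mono mult_left_mono M1b M2b l) auto
      finally show ?thesis by simp
    qed
    define J where "J = (\<integral>\<^sup>+x. ennreal ((norm (f x))\<^sup>2) \<partial>jacobi_mu \<alpha> \<beta>)"
    have J: "(\<integral>\<^sup>+x. ennreal ((norm (h x))\<^sup>2) \<partial>lborel) \<le> 2 * J"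
      if h: "\<And>x. norm (h x) \<le> indicator {0<..} x * w x * (norm (f x) + norm (f (- x)))" for h :: "real \<Rightarrow> complex"
    proof -
      have "(\<integral>\<^sup>+x. ennreal ((norm (h x))\<^sup>2) \<partial>lborel) \<le> (\<integral>\<^sup>+x. 2 * ((ennreal ((w \<bar>x\<bar>)\<^sup>2) * ennreal ((norm (f x))\<^sup>2) + ennreal ((w \<bar>- x\<bar>)\<^sup>2) * ennreal ((norm (f (- x)))\<^sup>2)) * indicator {0<..} x) \<partial>lborel)"
      proof (intro nn_integral_mono)
        fix x
        show "ennreal ((norm (h x))\<^sup>2) \<le> 2 * ((ennreal ((w \<bar>x\<bar>)\<^sup>2) * ennreal ((norm (f x))\<^sup>2) + ennreal ((w \<bar>- x\<bar>)\<^sup>2) * ennreal ((norm (f (- x)))\<^sup>2)) * indicator {0<..} x)"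
        proof (cases "x > 0")
          case True
          have "(norm (h x))\<^sup>2 \<le> (w x * (norm (f x) + norm (f (- x))))\<^sup>2"
            using h[of x] True by (intro power_mono) auto
          also have "\<dots> \<le> 2 * ((w x)\<^sup>2 * (norm (f x))\<^sup>2 + (w x)\<^sup>2 * (norm (f (- x)))\<^sup>2)"
          proof -
            have "(norm (f x) + norm (f (- x)))\<^sup>2 \<le> 2 * ((norm (f x))\<^sup>2 + (norm (f (- x)))\<^sup>2)"
              using sum_squares_bound[of "norm (f x)" "norm (f (- x))"] by (simp add: power2_sum)
            then have "(w x)\<^sup>2 * (norm (f x) + norm (f (- x)))\<^sup>2 \<le> (w x)\<^sup>2 * (2 * ((norm (f x))\<^sup>2 + (norm (f (- x)))\<^sup>2))"
              by (rule mult_left_mono) simp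
            then show ?thesis unfolding power_mult_distrib[of "w x"] by (simp add: distrib_left mult.left_commute)
          qed
          finally have "ennreal ((norm (h x))\<^sup>2) \<le> ennreal (2 * ((w x)\<^sup>2 * (norm (f x))\<^sup>2 + (w x)\<^sup>2 * (norm (f (- x)))\<^sup>2))"
            by (rule ennreal_leI)
          also have "\<dots> = ennreal 2 * (ennreal ((w x)\<^sup>2) * ennreal ((norm (f x))\<^sup>2) + ennreal ((w x)\<^sup>2) * ennreal ((norm (f (- x)))\<^sup>2))"
            by (subst ennreal_mult) (simp_all add: ennreal_mult)
          finally show ?thesis using True by simp
        next
          case False
          then have "h x = 0" using h[of x] by simp
          then show ?thesis by simp
        qed
      qed
      also have "\<dots> = 2 * (\<integral>\<^sup>+x. (ennreal ((w \<bar>x\<bar>)\<^sup>2) * ennreal ((norm (f x))\<^sup>2) + ennreal ((w \<bar>- x\<bar>)\<^sup>2) * ennreal ((norm (f (- x)))\<^sup>2)) * indicator {0<..} x \<partial>lborel)"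
        by (rule nn_integral_cmult) measurable
      also have "(\<integral>\<^sup>+x. (ennreal ((w \<bar>x\<bar>)\<^sup>2) * ennreal ((norm (f x))\<^sup>2) + ennreal ((w \<bar>- x\<bar>)\<^sup>2) * ennreal ((norm (f (- x)))\<^sup>2)) * indicator {0<..} x \<partial>lborel) = (\<integral>\<^sup>+x. ennreal ((w \<bar>x\<bar>)\<^sup>2) * ennreal ((norm (f x))\<^sup>2) \<partial>lborel)"
        by (rule nn_integral_fold[symmetric]) measurable
      also have "\<dots> = J" unfolding J_def by (rule nn_integral_jacobi_mu[symmetric]) measurable
      finally show ?thesis .
    qed
    have hb: "norm (he x) \<le> indicator {0<..} x * w x * (norm (f x) + norm (f (- x)))" "norm (ho x) \<le> indicator {0<..} x * w x * (norm (f x) + norm (f (- x)))" for x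
      using w_pos[of x] by (auto simp: he_def ho_def norm_mult indicator_def intro!: mult_left_mono norm_triangle_ineq norm_triangle_ineq4)
    have "(\<integral>\<^sup>+l. ennreal ((norm (cherednik_opdam \<alpha> \<beta> f (of_real l)))\<^sup>2 * \<bar>l\<bar> powr (2 * \<alpha> + 1)) * indicator {l. \<bar>l\<bar> \<ge> 1} l \<partial>lborel)
       \<le> (\<integral>\<^sup>+l. 2 * M1 \<bar>l\<bar> + ennreal (2 * m) * M2 \<bar>l\<bar> \<partial>lborel)"
      using point by (intro nn_integral_mono) (auto simp: indicator_def)
    also have "\<dots> = (\<integral>\<^sup>+l. ((2 * M1 \<bar>l\<bar> + ennreal (2 * m) * M2 \<bar>l\<bar>) + (2 * M1 \<bar>- l\<bar> + ennreal (2 * m) * M2 \<bar>- l\<bar>)) * indicator {0<..} l \<partial>lborel)"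
      by (rule nn_integral_fold) measurable
    also have "\<dots> = (\<integral>\<^sup>+l. 4 * (M1 l * indicator {0<..} l) + ennreal (4 * m) * (M2 l * indicator {0<..} l) \<partial>lborel)"
    proof (intro nn_integral_cong)
      fix l :: real
      have e: "2 * a + ennreal (2 * m) * b + (2 * a + ennreal (2 * m) * b) = 4 * a + ennreal (4 * m) * b" for a b
      proof -
        have "2 * a + ennreal (2 * m) * b + (2 * a + ennreal (2 * m) * b) = (2 + 2) * a + (ennreal (2 * m) + ennreal (2 * m)) * b"
          unfolding distrib_right by (simp only: ac_simps)
        also have "ennreal (2 * m) + ennreal (2 * m) = ennreal (4 * m)" using m by (simp flip: ennreal_plus)
        finally show ?thesis by simp
      qed
      show "((2 * M1 \<bar>l\<bar> + ennreal (2 * m) * M2 \<bar>l\<bar>) + (2 * M1 \<bar>- l\<bar> + ennreal (2 * m) * M2 \<bar>- l\<bar>)) * indicator {0<..} l = 4 * (M1 l * indicator {0<..} l) + ennreal (4 * m) * (M2 l * indicator {0<..} l)"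
        by (cases "l > 0") (simp_all only: e abs_minus_cancel indicator_simps greaterThan_iff mult_1_right abs_of_pos, simp)
    qed
    also have "\<dots> = 4 * (\<integral>\<^sup>+l. M1 l * indicator {0<..} l \<partial>lborel) + ennreal (4 * m) * (\<integral>\<^sup>+l. M2 l * indicator {0<..} l \<partial>lborel)"
      by (simp add: nn_integral_add nn_integral_cmult)
    also have "\<dots> \<le> 4 * (ennreal C1 * (2 * J)) + ennreal (4 * m) * (ennreal C2 * (2 * J))"
      by (intro add_mono mult_left_mono order_trans[OF M1i] order_trans[OF M2i] J hb) auto
    also have "\<dots> = ennreal C * J"
    proof -
      have "ennreal 4 * (ennreal a * (ennreal 2 * b)) + ennreal (4 * k) * (ennreal c * (ennreal 2 * b)) = ennreal (8 * a + 8 * k * c) * b"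
        if "a \<ge> 0" "k \<ge> 0" "c \<ge> 0" for a k c b
      proof -
        have "ennreal 4 * (ennreal a * (ennreal 2 * b)) = (ennreal 4 * (ennreal a * ennreal 2)) * b" by (simp only: mult.assoc)
        also have "ennreal 4 * (ennreal a * ennreal 2) = ennreal (8 * a)" using that by (simp flip: ennreal_mult del: ennreal_numeral)
        finally have 1: "ennreal 4 * (ennreal a * (ennreal 2 * b)) = ennreal (8 * a) * b" .
        have "ennreal (4 * k) * (ennreal c * (ennreal 2 * b)) = (ennreal (4 * k) * (ennreal c * ennreal 2)) * b" by (simp only: mult.assoc)
        also have "ennreal (4 * k) * (ennreal c * ennreal 2) = ennreal (8 * k * c)" using that by (simp flip: ennreal_mult del: ennreal_numeral)
        finally have 2: "ennreal (4 * k) * (ennreal c * (ennreal 2 * b)) = ennreal (8 * k * c) * b" .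
        show ?thesis unfolding 1 2 distrib_right[symmetric] using that by (subst ennreal_plus) auto
      qed
      from this[of C1 m C2 J] C12 m show ?thesis unfolding C_def by simp
    qed
    finally show ?thesis unfolding J_def .
  qed
  with C show ?thesis using that by blast
qed

end

section \<open>The strip: integrability, holomorphy, Hoelder\<close>

lemma Lp_norm_real:
  assumes "1 \<le> p"
  shows "Lp_norm (ennreal p) M f = (let I = (\<integral>\<^sup>+x. ennreal (norm (f x) powr p) \<partial>M)
    in if I = \<infinity> then \<infinity> else ennreal (enn2real I powr (1 / p)))"
proof -
  have "enn2real (ennreal p) = p" using assms by simp
  then show ?thesis unfolding Lp_norm_def by (simp only:) simp
qed

lemma Lp_norm_real_eq:
  assumes "1 \<le> p" "(\<integral>\<^sup>+x. ennreal (norm (f x) powr p) \<partial>M) = ennreal I" "I \<ge> 0"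
  shows "Lp_norm (ennreal p) M f = ennreal (I powr (1 / p))"
  unfolding Lp_norm_real[OF assms(1)] assms(2) using assms(3) by simp

lemma Lp_space_realE:
  assumes "f \<in> Lp_space (ennreal p) M" "1 \<le> p"
  obtains I where "I \<ge> 0" "(\<integral>\<^sup>+x. ennreal (norm (f x) powr p) \<partial>M) = ennreal I"
    "Lp_norm (ennreal p) M f = ennreal (I powr (1 / p))" "f \<in> borel_measurable M"
proof -
  have "(\<integral>\<^sup>+x. ennreal (norm (f x) powr p) \<partial>M) \<noteq> \<infinity>"
    using assms unfolding Lp_space_def Lp_norm_real[OF assms(2)] by (auto simp: Let_def split: if_splits)
  then obtain I where "I \<ge> 0" "(\<integral>\<^sup>+x. ennreal (norm (f x) powr p) \<partial>M) = ennreal I"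
    by (cases "\<integral>\<^sup>+x. ennreal (norm (f x) powr p) \<partial>M") auto
  with Lp_norm_real_eq[OF assms(2) this(2,1)] show ?thesis
    using that assms(1) by (auto simp: Lp_space_def)
qed

lemma Lp_space_realI:
  assumes "1 \<le> p" "f \<in> borel_measurable M" "(\<integral>\<^sup>+x. ennreal (norm (f x) powr p) \<partial>M) < \<infinity>"
  shows "f \<in> Lp_space (ennreal p) M"
  using assms by (simp add: Lp_space_def Lp_norm_real Let_def)

lemma Lp_norm_mono:
  assumes "q = \<infinity> \<or> (\<exists>r\<ge>1. q = ennreal r)" "g \<in> borel_measurable M" "h \<in> borel_measurable M"
    and le: "\<And>x. norm (g x) \<le> norm (h x)"
  shows "Lp_norm q M g \<le> Lp_norm q M h"
proof (cases "q = \<infinity>")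
  case True
  then show ?thesis using assms unfolding Lp_norm_def by (auto intro!: esssup_mono)
next
  case False
  then obtain r where r: "r \<ge> 1" "q = ennreal r" using assms by blast
  have le': "(\<integral>\<^sup>+x. ennreal (norm (g x) powr r) \<partial>M) \<le> (\<integral>\<^sup>+x. ennreal (norm (h x) powr r) \<partial>M)"
    using r le by (intro nn_integral_mono ennreal_leI powr_mono2) auto
  show ?thesis
  proof (cases "(\<integral>\<^sup>+x. ennreal (norm (h x) powr r) \<partial>M) = \<infinity>")
    case False
    then show ?thesis using le' r unfolding r(2) Lp_norm_real[OF r(1)] Let_def
      by (auto intro!: ennreal_leI powr_mono2 enn2real_mono simp: less_top top_unique)
  qed (simp add: r(2) Lp_norm_real[OF r(1)])
qed

lemma Lp_space_mono:
  assumes "q = \<infinity> \<or> (\<exists>r\<ge>1. q = ennreal r)" "g \<in> borel_measurable M" "h \<in> Lp_space q M"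
    and le: "\<And>x. norm (g x) \<le> norm (h x)"
  shows "g \<in> Lp_space q M"
  using assms Lp_norm_mono[OF assms(1,2) _ le] unfolding Lp_space_def by (auto intro: le_less_trans)

definition conj_exp :: "real \<Rightarrow> ennreal" where
  "conj_exp p = (if p = 1 then \<infinity> else ennreal (p / (p - 1)))"

lemma conj_exp_cases: "1 \<le> p \<Longrightarrow> conj_exp p = \<infinity> \<or> (\<exists>r\<ge>1. conj_exp p = ennreal r)"
  unfolding conj_exp_def by (cases "p = 1") (auto intro!: exI[of _ "p / (p - 1)"] simp: le_divide_eq)

lemma Lp_Hoelder:
  assumes p: "1 \<le> p" and f: "f \<in> Lp_space (ennreal p) M" and g: "g \<in> Lp_space (conj_exp p) M"
  shows "(\<integral>\<^sup>+x. ennreal (norm (f x) * norm (g x)) \<partial>M) \<le> Lp_norm (ennreal p) M f * Lp_norm (conj_exp p) M g"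
proof -
  obtain I where I: "I \<ge> 0" "(\<integral>\<^sup>+x. ennreal (norm (f x) powr p) \<partial>M) = ennreal I"
    "Lp_norm (ennreal p) M f = ennreal (I powr (1 / p))" "f \<in> borel_measurable M"
    by (rule Lp_space_realE[OF f p])
  note [measurable] = I(4)
  have [measurable]: "g \<in> borel_measurable M" using g by (simp add: Lp_space_def)
  show ?thesis
  proof (cases "p = 1")
    case True
    let ?S = "esssup M (\<lambda>x. ennreal (norm (g x)))"
    have "AE x in M. ennreal (norm (g x)) \<le> ?S" by (rule esssup_AE)
    then have "AE x in M. ennreal (norm (f x) * norm (g x)) \<le> ennreal (norm (f x)) * ?S"
      by eventually_elim (auto simp: ennreal_mult intro: mult_left_mono)
    then have "(\<integral>\<^sup>+x. ennreal (norm (f x) * norm (g x)) \<partial>M) \<le> (\<integral>\<^sup>+x. ennreal (norm (f x)) * ?S \<partial>M)"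
      by (rule nn_integral_mono_AE)
    also have "\<dots> = (\<integral>\<^sup>+x. ennreal (norm (f x)) \<partial>M) * ?S" by (rule nn_integral_multc) simp
    also have "(\<integral>\<^sup>+x. ennreal (norm (f x)) \<partial>M) = Lp_norm (ennreal p) M f"
      using I True by simp
    finally show ?thesis using True by (simp add: conj_exp_def Lp_norm_def)
  next
    case False
    then have p1: "p > 1" using p by simp
    define r where "r = p / (p - 1)"
    have r: "r > 1" "1 / p + 1 / r = 1" "conj_exp p = ennreal r"
      using p1 by (auto simp: r_def conj_exp_def field_simps)
    obtain J where J: "J \<ge> 0" "(\<integral>\<^sup>+x. ennreal (norm (g x) powr r) \<partial>M) = ennreal J"
      "Lp_norm (ennreal r) M g = ennreal (J powr (1 / r))" "g \<in> borel_measurable M"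
      using g r by (auto elim: Lp_space_realE)
    have "(\<integral>\<^sup>+x. ennreal (norm (f x) * norm (g x)) \<partial>M) \<le> ennreal (I powr (1 / p) * J powr (1 / r))"
      by (rule nn_integral_Hoelder[OF _ _ _ _ p1 r(1,2) I(2,1) J(2,1)]) auto
    then show ?thesis unfolding r(3) I(3) J(3) by (simp add: ennreal_mult)
  qed
qed

text \<open>Cauchy's estimate turns the domination of F by B into a domination of its difference
  quotients by 3 B / r, so dominated convergence differentiates under the integral.\<close>

lemma holomorphic_on_lebesgue_integral:
  fixes F :: "'a \<Rightarrow> complex \<Rightarrow> complex"
  assumes S: "open S" and hol: "\<And>x. F x holomorphic_on S"
    and meas: "\<And>l. l \<in> S \<Longrightarrow> (\<lambda>x. F x l) \<in> borel_measurable M"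
    and dom: "\<And>l0. l0 \<in> S \<Longrightarrow> \<exists>r>0. \<exists>B. ball l0 r \<subseteq> S \<and> integrable M B \<and> (\<forall>x. \<forall>l\<in>ball l0 r. norm (F x l) \<le> B x)"
  shows "(\<lambda>l. LINT x|M. F x l) holomorphic_on S"
  unfolding holomorphic_on_open[OF S]
proof
  fix l0 assume l0: "l0 \<in> S"
  obtain r B where r: "r > 0" and sub: "ball l0 r \<subseteq> S" and B: "integrable M B"
    and bnd: "\<And>x l. l \<in> ball l0 r \<Longrightarrow> norm (F x l) \<le> B x"
    using dom[OF l0] by blast
  \<comment> \<open>Closed discs of radius r / 3 about points of \<open>?U\<close> stay within
    \<open>ball l0 r\<close>, where B dominates.\<close>
  let ?U = "ball l0 (r / 3)"
  have int: "integrable M (\<lambda>x. F x l)" if "l \<in> ball l0 r" for l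
    by (rule Bochner_Integration.integrable_bound[OF B meas])
       (use that sub bnd in \<open>auto intro!: AE_I2 order_trans[OF bnd abs_ge_self]\<close>)
  have der: "norm (deriv (F x) z) \<le> 3 * B x / r" if z: "z \<in> ?U" for x z
  proof -
    have c: "cball z (r / 3) \<subseteq> ball l0 r"
    proof
      fix y assume "y \<in> cball z (r / 3)"
      then show "y \<in> ball l0 r" using z r dist_triangle[of l0 y z] by (auto simp: dist_commute)
    qed
    have h: "F x holomorphic_on cball z (r / 3)" using hol[of x] c sub by (blast intro: holomorphic_on_subset)
    have "norm ((deriv ^^ 1) (F x) z) \<le> fact 1 * B x / (r / 3) ^ 1"
    proof (rule Cauchy_inequality)
      show "F x holomorphic_on ball z (r / 3)" using h by (rule holomorphic_on_subset) auto
      show "continuous_on (cball z (r / 3)) (F x)" using h by (rule holomorphic_on_imp_continuous_on)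
      fix y assume "norm (z - y) = r / 3"
      then have "y \<in> cball z (r / 3)" by (simp add: dist_norm)
      then show "norm (F x y) \<le> B x" using c bnd by blast
    qed (use r in simp)
    then show ?thesis by (simp add: mult.commute)
  qed
  have lip: "norm (F x l - F x l0) \<le> 3 * B x / r * norm (l - l0)" if l: "l \<in> ?U" for x l
  proof (rule field_differentiable_bound[where S = ?U and f' = "deriv (F x)"])
    fix z assume z: "z \<in> ?U"
    have "z \<in> S" using z r sub by (auto intro: subsetD[OF sub])
    then show "(F x has_field_derivative deriv (F x) z) (at z within ?U)"
      using holomorphic_derivI[OF hol S] by blast
  qed (use der l r in auto)
  have "((\<lambda>l. ((LINT x|M. F x l) - (LINT x|M. F x l0)) / (l - l0)) \<longlongrightarrow> (LINT x|M. deriv (F x) l0)) (at l0 within ?U)"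
    \<comment> \<open>Dominated convergence is a statement on sequences, so the limit is tested
      along them.\<close>
    unfolding tendsto_at_iff_sequentially
  proof (intro allI impI)
    fix X assume X: "\<forall>i. X i \<in> ?U - {l0}" and lim: "X \<longlonglongrightarrow> l0"
    have Xr: "X i \<in> ball l0 r" "X i \<in> S" "X i \<noteq> l0" "X i \<in> ?U" for i
    proof -
      show "X i \<noteq> l0" "X i \<in> ?U" using X by auto
      then show "X i \<in> ball l0 r" using r by auto
      then show "X i \<in> S" using sub by blast
    qed
    have l0r: "l0 \<in> ball l0 r" using r by simp
    have conv: "(\<lambda>i. (F x (X i) - F x l0) / (X i - l0)) \<longlonglongrightarrow> deriv (F x) l0" for x
    proof -
      have "((\<lambda>l. (F x l - F x l0) / (l - l0)) \<longlongrightarrow> deriv (F x) l0) (at l0)"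
        using holomorphic_derivI[OF hol S l0, of x UNIV] unfolding has_field_derivative_iff by simp
      moreover have "filterlim X (at l0) sequentially"
        using lim Xr(3) by (simp add: filterlim_at)
      ultimately show ?thesis by (rule filterlim_compose)
    qed
    have "(\<lambda>i. LINT x|M. (F x (X i) - F x l0) / (X i - l0)) \<longlonglongrightarrow> (LINT x|M. deriv (F x) l0)"
    proof (rule integral_dominated_convergence[where w = "\<lambda>x. 3 * B x / r"])
      show m: "(\<lambda>x. (F x (X i) - F x l0) / (X i - l0)) \<in> borel_measurable M" for i
        using meas[OF Xr(2)[of i]] meas[OF l0] by measurable
      show "(\<lambda>x. deriv (F x) l0) \<in> borel_measurable M"
        by (rule borel_measurable_LIMSEQ_metric[OF m conv])
      show "AE x in M. norm ((F x (X i) - F x l0) / (X i - l0)) \<le> 3 * B x / r" for i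
        using lip[OF Xr(4)[of i]] Xr(3)[of i] by (auto simp: norm_divide divide_le_eq)
    qed (use B conv in auto)
    moreover have "(LINT x|M. (F x (X i) - F x l0) / (X i - l0)) = ((LINT x|M. F x (X i)) - (LINT x|M. F x l0)) / (X i - l0)" for i
      using int[OF Xr(1)[of i]] int[OF l0r] by simp
    ultimately show "((\<lambda>l. ((LINT x|M. F x l) - (LINT x|M. F x l0)) / (l - l0)) \<circ> X) \<longlonglongrightarrow> (LINT x|M. deriv (F x) l0)"
      by (simp only: o_def)
  qed
  then have "((\<lambda>l. LINT x|M. F x l) has_field_derivative (LINT x|M. deriv (F x) l0)) (at l0)"
    unfolding has_field_derivative_iff using r by (simp add: at_within_open[of l0 ?U])
  then show "\<exists>f'. ((\<lambda>l. LINT x|M. F x l) has_field_derivative f') (at l0)" by blast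
qed

section \<open>The transform on the strip\<close>

context jacobi_params
begin

abbreviation "\<mu> \<equiv> jacobi_mu \<alpha> \<beta>"
abbreviation "G \<equiv> opdam_G \<alpha> \<beta>"
abbreviation "H \<equiv> cherednik_opdam \<alpha> \<beta>"

lemma w_le_exp:
  assumes "x \<ge> 0"
  shows "(w x)\<^sup>2 \<le> exp (2 * \<rho> * x)"
proof -
  have "sinh x \<le> exp x" "cosh x \<le> exp x" "sinh x \<ge> 0"
    using assms unfolding sinh_field_def cosh_field_def by (auto simp: field_simps intro: order_trans[of _ 0])
  then have "w x \<le> exp x powr (\<alpha> + 1 / 2) * exp x powr (\<beta> + 1 / 2)"
    unfolding w_def using alpha beta by (intro mult_mono powr_mono2) auto
  also have "\<dots> = exp (\<rho> * x)"
    unfolding powr_add[symmetric] by (simp add: powr_def jacobi_rho_def algebra_simps)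
  finally have "(w x)\<^sup>2 \<le> (exp (\<rho> * x))\<^sup>2" by (intro power_mono) (auto simp: w_def)
  then show ?thesis by (simp flip: exp_double) (simp add: mult.assoc)
qed

lemma nn_integral_exp_finite:
  assumes "\<delta> > 0"
  shows "(\<integral>\<^sup>+x. ennreal (exp (- \<delta> * \<bar>x\<bar>)) \<partial>lborel) < \<infinity>"
proof -
  have "(\<integral>\<^sup>+x. ennreal (exp (- \<delta> * x)) * indicator {0<..} x \<partial>lborel) = ennreal (0 - (- 1 / \<delta>))"
  proof (rule nn_integral_FTC_Ioi[where F = "\<lambda>x. - exp (- \<delta> * x) / \<delta>"])
    have "((\<lambda>x. - exp (- \<delta> * x) / \<delta>) \<longlongrightarrow> - exp (- \<delta> * 0) / \<delta>) (at_right 0)"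
      using assms by (intro tendsto_intros) auto
    then show "((\<lambda>x. - exp (- \<delta> * x) / \<delta>) \<longlongrightarrow> - 1 / \<delta>) (at_right 0)" by simp
    show "((\<lambda>x. - exp (- \<delta> * x) / \<delta>) \<longlongrightarrow> 0) at_top" using assms by real_asymp
  qed (use assms in \<open>auto intro!: derivative_eq_intros continuous_intros\<close>)
  then have 1: "(\<integral>\<^sup>+x. ennreal (exp (- \<delta> * x)) * indicator {0<..} x \<partial>lborel) = ennreal (1 / \<delta>)" by simp
  have "(\<integral>\<^sup>+x. ennreal (exp (- \<delta> * \<bar>x\<bar>)) \<partial>lborel) = (\<integral>\<^sup>+x. (ennreal (exp (- \<delta> * \<bar>x\<bar>)) + ennreal (exp (- \<delta> * \<bar>- x\<bar>))) * indicator {0<..} x \<partial>lborel)"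
    by (rule nn_integral_fold) measurable
  also have "\<dots> = (\<integral>\<^sup>+x. 2 * (ennreal (exp (- \<delta> * x)) * indicator {0<..} x) \<partial>lborel)"
    by (intro nn_integral_cong) (auto simp: indicator_def mult_2)
  also have "\<dots> = 2 * ennreal (1 / \<delta>)" using 1 by (simp add: nn_integral_cmult)
  finally show ?thesis by (simp add: ennreal_mult_less_top)
qed

lemma norm_of_real_exp: "C \<ge> 0 \<Longrightarrow> norm (complex_of_real (C * exp (- s * \<bar>x\<bar>))) = C * exp (- s * \<bar>x\<bar>)"
  unfolding norm_of_real by simp

text \<open>The weight is at most exp (2 \<rho> |x|), so the q-th power is integrable once s q > 2
  \<rho>; with 1/q = 1 - 1/p this is the threshold on s. For p = 1 it reads s > 0, and the function
  is bounded.\<close>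

lemma exp_in_Lp:
  assumes p: "1 \<le> p" and s: "s > 2 * \<rho> * (1 - 1 / p)" and C: "C \<ge> 0"
  shows "(\<lambda>x. complex_of_real (C * exp (- s * \<bar>x\<bar>))) \<in> Lp_space (conj_exp p) \<mu>"
proof (cases "p = 1")
  case True
  have s0: "s > 0" using s True by simp
  have "esssup \<mu> (\<lambda>x. ennreal (norm (complex_of_real (C * exp (- s * \<bar>x\<bar>))))) \<le> ennreal C"
  proof (rule esssup_I)
    show "AE x in \<mu>. ennreal (norm (complex_of_real (C * exp (- s * \<bar>x\<bar>)))) \<le> ennreal C"
    proof (rule AE_I2, rule ennreal_leI)
      fix x
      have "exp (- s * \<bar>x\<bar>) \<le> 1" using s0 by simp
      then show "norm (complex_of_real (C * exp (- s * \<bar>x\<bar>))) \<le> C"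
        unfolding norm_of_real abs_mult using C by (simp add: mult_left_le)
    qed
  qed measurable
  then show ?thesis using True unfolding Lp_space_def conj_exp_def Lp_norm_def
    by (auto intro: le_less_trans)
next
  case False
  then have p1: "p > 1" using p by simp
  define r where "r = p / (p - 1)"
  have r: "r > 1" "conj_exp p = ennreal r" using p1 by (auto simp: r_def conj_exp_def field_simps)
  have "(1 - 1 / p) * r = 1" using p1 by (simp add: r_def field_simps)
  then have "2 * \<rho> * (1 - 1 / p) * r = 2 * \<rho>" by (simp only: mult.assoc mult_1_right)
  then have d: "s * r - 2 * \<rho> > 0" using mult_strict_right_mono[OF s, of r] r(1) by linarith
  have "(\<integral>\<^sup>+x. ennreal (norm (complex_of_real (C * exp (- s * \<bar>x\<bar>))) powr r) \<partial>\<mu>) =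
      (\<integral>\<^sup>+x. ennreal ((w \<bar>x\<bar>)\<^sup>2) * ennreal (norm (complex_of_real (C * exp (- s * \<bar>x\<bar>))) powr r) \<partial>lborel)"
    by (rule nn_integral_jacobi_mu) measurable
  also have "\<dots> \<le> (\<integral>\<^sup>+x. ennreal (C powr r) * ennreal (exp (- (s * r - 2 * \<rho>) * \<bar>x\<bar>)) \<partial>lborel)"
  proof (intro nn_integral_mono)
    fix x :: real
    have "norm (complex_of_real (C * exp (- s * \<bar>x\<bar>))) powr r = C powr r * exp (- s * r * \<bar>x\<bar>)"
      unfolding norm_of_real abs_mult using C by (simp add: powr_mult) (simp add: powr_def mult_ac)
    then have "(w \<bar>x\<bar>)\<^sup>2 * norm (complex_of_real (C * exp (- s * \<bar>x\<bar>))) powr r \<le> exp (2 * \<rho> * \<bar>x\<bar>) * (C powr r * exp (- s * r * \<bar>x\<bar>))"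
      using w_le_exp[of "\<bar>x\<bar>"] by (simp add: mult_right_mono)
    also have "\<dots> = C powr r * (exp (2 * \<rho> * \<bar>x\<bar>) * exp (- s * r * \<bar>x\<bar>))" by simp
    also have "exp (2 * \<rho> * \<bar>x\<bar>) * exp (- s * r * \<bar>x\<bar>) = exp (- (s * r - 2 * \<rho>) * \<bar>x\<bar>)"
      unfolding exp_add[symmetric] by (rule arg_cong[of _ _ exp]) (simp add: algebra_simps)
    finally have "(w \<bar>x\<bar>)\<^sup>2 * norm (complex_of_real (C * exp (- s * \<bar>x\<bar>))) powr r \<le> C powr r * exp (- (s * r - 2 * \<rho>) * \<bar>x\<bar>)" .
    then show "ennreal ((w \<bar>x\<bar>)\<^sup>2) * ennreal (norm (complex_of_real (C * exp (- s * \<bar>x\<bar>))) powr r) \<le> ennreal (C powr r) * ennreal (exp (- (s * r - 2 * \<rho>) * \<bar>x\<bar>))"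
      by (simp only: ennreal_mult'[symmetric] ennreal_mult''[symmetric] zero_le_power2 powr_ge_zero) (simp only: ennreal_leI)
  qed
  also have "\<dots> = ennreal (C powr r) * (\<integral>\<^sup>+x. ennreal (exp (- (s * r - 2 * \<rho>) * \<bar>x\<bar>)) \<partial>lborel)"
    by (rule nn_integral_cmult) measurable
  also have "\<dots> < \<infinity>" using nn_integral_exp_finite[OF d] by (simp add: ennreal_mult_less_top)
  finally show ?thesis using r by (auto intro!: Lp_space_realI simp: measurable_cong_sets[OF sets_jacobi_mu refl])
qed

text \<open>The width of the strip is exactly what the decay needs: |Im l| < (2/p - 1) \<rho> says
  that \<rho> - |Im l| exceeds the threshold 2 \<rho> (1 - 1/p) of \<open>exp_in_Lp\<close>.\<close>

lemma opdam_G_exp_bound: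
  assumes p: "1 \<le> p" and \<eta>: "\<eta> < (2 / p - 1) * \<rho>" and L: "\<Lambda> \<ge> 0"
  obtains C s where "C \<ge> 0" "s > 2 * \<rho> * (1 - 1 / p)"
    "\<And>l x. norm l \<le> \<Lambda> \<Longrightarrow> \<bar>Im l\<bar> \<le> \<eta> \<Longrightarrow> norm (G l x) \<le> C * exp (- s * \<bar>x\<bar>)"
proof -
  \<comment> \<open>Half of the gap to the edge of the strip: one half is given up in
    \<open>phi_exp_bound\<close>, the other keeps s above the threshold. The full gap also bounds
    |\<rho> - i l| from below.\<close>
  define \<delta> where "\<delta> = ((2 / p - 1) * \<rho> - \<eta>) / 2"
  have \<delta>: "\<delta> > 0" using \<eta> by (simp add: \<delta>_def)
  define s where "s = 2 * \<rho> * (1 - 1 / p) + \<delta>"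
  obtain C0 where C0: "C0 > 0" "\<And>l x. norm l \<le> \<Lambda> \<Longrightarrow> x \<ge> 0 \<Longrightarrow> norm (\<phi> l x) + norm (\<phi>' l x) \<le> C0 * exp ((\<bar>Im l\<bar> - \<rho> + \<delta>) * x)"
    using phi_exp_bound[OF \<delta> L] by blast
  define k where "k = 1 + 1 / (2 * \<delta>)"
  have k: "k \<ge> 0" using \<delta> by (simp add: k_def)
  have "(2 / p - 1) * \<rho> \<le> 1 * \<rho>" using p rho_pos by (intro mult_right_mono) (auto simp: divide_le_eq)
  then have rd: "2 * \<delta> \<le> \<rho> - \<eta>" by (simp add: \<delta>_def)
  have es: "\<eta> - \<rho> + \<delta> = - s"
    unfolding s_def \<delta>_def by (simp add: field_simps)
  have "norm (G l x) \<le> (k * C0) * exp (- s * \<bar>x\<bar>)" if l: "norm l \<le> \<Lambda>" "\<bar>Im l\<bar> \<le> \<eta>" for l x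
  proof -
    let ?d = "of_real \<rho> - \<i> * l"
    have "2 * \<delta> \<le> Re ?d" using rd l by simp
    also have "Re ?d \<le> norm ?d" by (rule complex_Re_le_cmod)
    finally have d: "2 * \<delta> \<le> norm ?d" .
    then have "?d \<noteq> 0" using \<delta> by auto
    then have ne: "l \<noteq> - \<i> * of_real \<rho>" by auto
    have ab: "norm (\<phi> l x) = norm (\<phi> l \<bar>x\<bar>)" "norm (\<phi>' l x) = norm (\<phi>' l \<bar>x\<bar>)"
      by (cases "x \<ge> 0"; simp add: jacobi_fun_even jacobi_fun'_odd)+
    have "norm (G l x) \<le> norm (\<phi> l x) + norm (\<phi>' l x) / norm ?d"
      unfolding opdam_G_params[OF ne] using norm_triangle_ineq4[of "\<phi> l x" "\<phi>' l x / ?d"] by (simp add: norm_divide)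
    also have "\<dots> \<le> norm (\<phi> l x) + norm (\<phi>' l x) / (2 * \<delta>)"
      using d \<delta> by (intro add_left_mono divide_left_mono mult_pos_pos) auto
    also have "\<dots> \<le> k * (norm (\<phi> l \<bar>x\<bar>) + norm (\<phi>' l \<bar>x\<bar>))"
      using \<delta> unfolding ab k_def by (simp add: field_simps)
    also have "\<dots> \<le> k * (C0 * exp ((\<bar>Im l\<bar> - \<rho> + \<delta>) * \<bar>x\<bar>))"
      using C0(2)[OF l(1), of "\<bar>x\<bar>"] k by (intro mult_left_mono) auto
    also have "\<dots> \<le> k * (C0 * exp (- s * \<bar>x\<bar>))"
      using C0(1) k l(2) unfolding es[symmetric] by (intro mult_left_mono iffD2[OF exp_le_cancel_iff] mult_right_mono) auto
    finally show ?thesis by simp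
  qed
  moreover have "k * C0 \<ge> 0" using k C0(1) by simp
  moreover have "s > 2 * \<rho> * (1 - 1 / p)" using \<delta> by (simp add: s_def)
  ultimately show ?thesis using that by blast
qed

text \<open>The exceptional point has imaginary part - \<rho>, while the strip is open and of
  half-width at most \<rho>. On the strip \<open>opdam_G\<close> is therefore always given by the
  generic formula.\<close>

lemma strip_ne:
  assumes "1 \<le> p" "l \<in> opdam_strip \<alpha> \<beta> p"
  shows "l \<noteq> - \<i> * of_real \<rho>"
proof
  assume "l = - \<i> * of_real \<rho>"
  moreover have "(2 / p - 1) * \<rho> \<le> 1 * \<rho>" using assms(1) rho_pos by (intro mult_right_mono) (auto simp: divide_le_eq)
  ultimately show False using assms(2) rho_pos by (simp add: opdam_strip_def)
qed

lemma real_in_strip: "1 \<le> p \<Longrightarrow> p < 2 \<Longrightarrow> of_real l \<in> opdam_strip \<alpha> \<beta> p"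
  using rho_pos by (simp add: opdam_strip_def)

lemma open_strip: "open (opdam_strip \<alpha> \<beta> p)"
  unfolding opdam_strip_def by (intro open_Collect_less continuous_intros)

lemma opdam_G_measurable_mu:
  assumes "1 \<le> p" "l \<in> opdam_strip \<alpha> \<beta> p"
  shows "G l \<in> borel_measurable \<mu>"
  using opdam_G_measurable[OF strip_ne[OF assms]] by (simp add: measurable_cong_sets[OF sets_jacobi_mu refl])

lemma opdam_G_in_Lp:
  assumes p: "1 \<le> p" and l: "l \<in> opdam_strip \<alpha> \<beta> p"
  shows "G l \<in> Lp_space (conj_exp p) \<mu>"
proof -
  have \<eta>: "\<bar>Im l\<bar> < (2 / p - 1) * \<rho>" using l by (simp add: opdam_strip_def)
  obtain C s where C: "C \<ge> 0" "s > 2 * \<rho> * (1 - 1 / p)"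
    "\<And>m x. norm m \<le> norm l \<Longrightarrow> \<bar>Im m\<bar> \<le> \<bar>Im l\<bar> \<Longrightarrow> norm (G m x) \<le> C * exp (- s * \<bar>x\<bar>)"
    using opdam_G_exp_bound[OF p \<eta> norm_ge_zero[of l]] by blast
  show ?thesis
    by (rule Lp_space_mono[OF conj_exp_cases[OF p] opdam_G_measurable_mu[OF p l] exp_in_Lp[OF p C(2,1)]], unfold norm_of_real_exp[OF C(1)])
       (rule C(3); simp)
qed

lemma Lp_exp_integrable:
  assumes p: "1 \<le> p" and f: "f \<in> Lp_space (ennreal p) \<mu>" and s: "s > 2 * \<rho> * (1 - 1 / p)" and C: "C \<ge> 0"
  shows "integrable \<mu> (\<lambda>x. norm (f x) * (C * exp (- s * \<bar>x\<bar>)))"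
    "(\<integral>\<^sup>+x. ennreal (norm (f x) * (C * exp (- s * \<bar>x\<bar>))) \<partial>\<mu>) \<le> Lp_norm (ennreal p) \<mu> f * Lp_norm (conj_exp p) \<mu> (\<lambda>x. complex_of_real (C * exp (- s * \<bar>x\<bar>)))"
proof -
  have [measurable]: "f \<in> borel_measurable \<mu>" using f by (simp add: Lp_space_def)
  show 1: "(\<integral>\<^sup>+x. ennreal (norm (f x) * (C * exp (- s * \<bar>x\<bar>))) \<partial>\<mu>) \<le> Lp_norm (ennreal p) \<mu> f * Lp_norm (conj_exp p) \<mu> (\<lambda>x. complex_of_real (C * exp (- s * \<bar>x\<bar>)))"
    using Lp_Hoelder[OF p f exp_in_Lp[OF p s C]] unfolding norm_of_real_exp[OF C] .
  have "Lp_norm (ennreal p) \<mu> f < \<infinity>" "Lp_norm (conj_exp p) \<mu> (\<lambda>x. complex_of_real (C * exp (- s * \<bar>x\<bar>))) < \<infinity>"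
    using f exp_in_Lp[OF p s C] by (auto simp: Lp_space_def)
  then have "(\<integral>\<^sup>+x. ennreal (norm (f x) * (C * exp (- s * \<bar>x\<bar>))) \<partial>\<mu>) < \<infinity>"
    using 1 by (auto intro: le_less_trans simp: ennreal_mult_less_top)
  then show "integrable \<mu> (\<lambda>x. norm (f x) * (C * exp (- s * \<bar>x\<bar>)))"
    using C by (intro integrableI_bounded) (auto simp: abs_mult)
qed

lemma opdam_integrable:
  assumes p: "1 \<le> p" and f: "f \<in> Lp_space (ennreal p) \<mu>" and l: "l \<in> opdam_strip \<alpha> \<beta> p"
  shows "integrable \<mu> (\<lambda>x. f x * G l (- x))"
proof -
  have [measurable]: "f \<in> borel_measurable \<mu>" "G l \<in> borel_measurable borel"
    using f opdam_G_measurable[OF strip_ne[OF p l]] by (auto simp: Lp_space_def)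
  have \<eta>: "\<bar>Im l\<bar> < (2 / p - 1) * \<rho>" using l by (simp add: opdam_strip_def)
  obtain C s where C: "C \<ge> 0" "s > 2 * \<rho> * (1 - 1 / p)"
    "\<And>m x. norm m \<le> norm l \<Longrightarrow> \<bar>Im m\<bar> \<le> \<bar>Im l\<bar> \<Longrightarrow> norm (G m x) \<le> C * exp (- s * \<bar>x\<bar>)"
    using opdam_G_exp_bound[OF p \<eta> norm_ge_zero[of l]] by blast
  show ?thesis
  proof (rule Bochner_Integration.integrable_bound[OF Lp_exp_integrable(1)[OF p f C(2,1)]])
    show "AE x in \<mu>. norm (f x * G l (- x)) \<le> norm (norm (f x) * (C * exp (- s * \<bar>x\<bar>)))"
    proof (rule AE_I2)
      fix x
      have "norm (f x) * norm (G l (- x)) \<le> norm (f x) * (C * exp (- s * \<bar>x\<bar>))"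
        using C(3)[of l "- x"] by (intro mult_left_mono) auto
      then show "norm (f x * G l (- x)) \<le> norm (norm (f x) * (C * exp (- s * \<bar>x\<bar>)))"
        using C(1) by (simp add: norm_mult abs_mult)
    qed
  qed measurable
qed

lemma opdam_holomorphic:
  assumes p: "1 \<le> p" and f: "f \<in> Lp_space (ennreal p) \<mu>"
  shows "H f holomorphic_on opdam_strip \<alpha> \<beta> p"
  unfolding cherednik_opdam_def
proof (rule holomorphic_on_lebesgue_integral[OF open_strip])
  have fm[measurable]: "f \<in> borel_measurable \<mu>" using f by (auto simp: Lp_space_def)
  fix x
  have "(\<lambda>l. f x * (\<phi> l x + \<phi>' l x / (of_real \<rho> - \<i> * l))) holomorphic_on opdam_strip \<alpha> \<beta> p"
  proof (intro holomorphic_intros)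
    show "(\<lambda>l. \<phi> l x) holomorphic_on opdam_strip \<alpha> \<beta> p" "(\<lambda>l. \<phi>' l x) holomorphic_on opdam_strip \<alpha> \<beta> p"
      by (rule holomorphic_on_subset[OF jacobi_fun_holomorphic[OF alpha1] subset_UNIV],
          rule holomorphic_on_subset[OF jacobi_fun'_holomorphic[OF alpha1] subset_UNIV])
    fix l assume "l \<in> opdam_strip \<alpha> \<beta> p"
    from strip_ne[OF p this] show "of_real \<rho> - \<i> * l \<noteq> 0"
      by (auto simp: complex_eq_iff)
  qed
  then show "(\<lambda>l. f x * G l (- x)) holomorphic_on opdam_strip \<alpha> \<beta> p"
    by (rule holomorphic_transform) (subst opdam_G_reflect[OF strip_ne[OF p]], assumption, rule refl)
next
  have [measurable]: "f \<in> borel_measurable \<mu>" using f by (auto simp: Lp_space_def)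
  fix l assume l: "l \<in> opdam_strip \<alpha> \<beta> p"
  have [measurable]: "G l \<in> borel_measurable borel" using opdam_G_measurable[OF strip_ne[OF p l]] .
  show "(\<lambda>x. f x * G l (- x)) \<in> borel_measurable \<mu>" by measurable
  obtain \<eta> where \<eta>: "\<bar>Im l\<bar> < \<eta>" "\<eta> < (2 / p - 1) * \<rho>"
    using l dense by (force simp: opdam_strip_def)
  define r where "r = \<eta> - \<bar>Im l\<bar>"
  have r: "r > 0" using \<eta> by (simp add: r_def)
  have L0: "norm l + r \<ge> 0" using r by (simp add: add_nonneg_nonneg)
  obtain C s where C: "C \<ge> 0" "s > 2 * \<rho> * (1 - 1 / p)"
    "\<And>m x. norm m \<le> norm l + r \<Longrightarrow> \<bar>Im m\<bar> \<le> \<eta> \<Longrightarrow> norm (G m x) \<le> C * exp (- s * \<bar>x\<bar>)"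
    using opdam_G_exp_bound[OF p \<eta>(2) L0] by blast
  have ball: "norm m \<le> norm l + r" "\<bar>Im m\<bar> \<le> \<eta>" if "m \<in> ball l r" for m
  proof -
    have d: "norm (m - l) < r" using that by (simp add: dist_norm norm_minus_commute)
    show "norm m \<le> norm l + r" using norm_triangle_sub[of m l] d by simp
    have "\<bar>Im m - Im l\<bar> \<le> norm (m - l)" using abs_Im_le_cmod[of "m - l"] by simp
    then show "\<bar>Im m\<bar> \<le> \<eta>" using d unfolding r_def by linarith
  qed
  show "\<exists>r>0. \<exists>B. ball l r \<subseteq> opdam_strip \<alpha> \<beta> p \<and> integrable \<mu> B \<and> (\<forall>x. \<forall>m\<in>ball l r. norm (f x * G m (- x)) \<le> B x)"
  proof (intro exI conjI allI ballI)
    show "r > 0" by (rule r)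
    show "ball l r \<subseteq> opdam_strip \<alpha> \<beta> p" using ball(2) \<eta>(2) by (force simp: opdam_strip_def)
    show "integrable \<mu> (\<lambda>x. norm (f x) * (C * exp (- s * \<bar>x\<bar>)))" by (rule Lp_exp_integrable(1)[OF p f C(2,1)])
    fix x m assume "m \<in> ball l r"
    then show "norm (f x * G m (- x)) \<le> norm (f x) * (C * exp (- s * \<bar>x\<bar>))"
      using C(3)[OF ball, of m "- x"] by (simp add: norm_mult mult_left_mono)
  qed
qed

lemma opdam_real_measurable:
  assumes p: "1 \<le> p" "p < 2" and f: "f \<in> Lp_space (ennreal p) \<mu>"
  shows "(\<lambda>l. H f (complex_of_real l)) \<in> borel_measurable borel"
proof (rule borel_measurable_continuous_onI)
  show "continuous_on UNIV (\<lambda>l. H f (complex_of_real l))"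
    by (rule continuous_on_compose2[OF holomorphic_on_imp_continuous_on[OF opdam_holomorphic[OF p(1) f]]])
       (use real_in_strip p in \<open>auto intro!: continuous_intros\<close>)
qed

lemma nn_integral_mu_reflect:
  assumes [measurable]: "g \<in> borel_measurable borel"
  shows "(\<integral>\<^sup>+x. g (- x) \<partial>\<mu>) = (\<integral>\<^sup>+x. g x \<partial>\<mu>)"
  using nn_integral_real_affine[of "\<lambda>x. ennreal ((w \<bar>x\<bar>)\<^sup>2) * g x" "-1" 0]
  by (simp add: nn_integral_jacobi_mu)

lemma borel_measurable_mu: "borel_measurable \<mu> = borel_measurable borel"
  by (rule measurable_cong_sets[OF sets_jacobi_mu refl])

text \<open>The transform integrates against G(- x). Invariance of \<mu> under reflection moves the
  sign to f, whose norm it does not change, and leaves the norm of G itself.\<close>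

lemma opdam_Hoelder:
  assumes p: "1 \<le> p" and f: "f \<in> Lp_space (ennreal p) \<mu>" and l: "l \<in> opdam_strip \<alpha> \<beta> p"
  shows "ennreal (norm (H f l)) \<le> Lp_norm (ennreal p) \<mu> f * Lp_norm (conj_exp p) \<mu> (G l)"
proof -
  have [measurable]: "f \<in> borel_measurable borel" "G l \<in> borel_measurable borel"
    using f opdam_G_measurable[OF strip_ne[OF p l]] by (auto simp: Lp_space_def borel_measurable_mu)
  have e: "(\<integral>\<^sup>+x. ennreal (norm (f (- x)) powr p) \<partial>\<mu>) = (\<integral>\<^sup>+x. ennreal (norm (f x) powr p) \<partial>\<mu>)"
    by (rule nn_integral_mu_reflect[of "\<lambda>x. ennreal (norm (f x) powr p)"]) measurable
  have n: "Lp_norm (ennreal p) \<mu> (\<lambda>x. f (- x)) = Lp_norm (ennreal p) \<mu> f"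
    unfolding Lp_norm_real[OF p] e ..
  have f': "(\<lambda>x. f (- x)) \<in> Lp_space (ennreal p) \<mu>"
    using f n unfolding Lp_space_def by (simp add: borel_measurable_mu)
  have "ennreal (norm (H f l)) \<le> (\<integral>\<^sup>+x. norm (f x * G l (- x)) \<partial>\<mu>)"
    unfolding cherednik_opdam_def by (rule norm_integral_le_nn_integral)
  also have "\<dots> = (\<integral>\<^sup>+x. ennreal (norm (f (- x)) * norm (G l x)) \<partial>\<mu>)"
    using nn_integral_mu_reflect[of "\<lambda>x. ennreal (norm (f x * G l (- x)))"] by (simp add: norm_mult)
  also have "\<dots> \<le> Lp_norm (ennreal p) \<mu> (\<lambda>x. f (- x)) * Lp_norm (conj_exp p) \<mu> (G l)"
    by (rule Lp_Hoelder[OF p f' opdam_G_in_Lp[OF p l]])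
  finally show ?thesis unfolding n .
qed

text \<open>Compactly supported truncations are needed because the estimates for \<open>u\<close> require integrability
  with respect to Lebesgue measure.\<close>

lemma opdam_L2:
  assumes p: "1 \<le> p" "p < 2"
  obtains C where "C > 0" "\<And>f. f \<in> Lp_space (ennreal p) \<mu> \<Longrightarrow>
    (\<integral>\<^sup>+l. ennreal ((norm (H f (complex_of_real l)))\<^sup>2 * \<bar>l\<bar> powr (2 * \<alpha> + 1)) * indicator {l. \<bar>l\<bar> \<ge> 1} l \<partial>lborel)
      \<le> ennreal C * (\<integral>\<^sup>+x. ennreal ((norm (f x))\<^sup>2) \<partial>\<mu>)"
proof -
  obtain C where C: "C > 0" and bs: "\<And>f. f \<in> borel_measurable borel \<Longrightarrow> (\<And>l::real. integrable \<mu> (\<lambda>x. f x * G (of_real l) (- x))) \<Longrightarrow>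
      integrable lborel (\<lambda>x. indicator {0<..} x * of_real (w x) * f x) \<Longrightarrow>
      integrable lborel (\<lambda>x. indicator {0<..} x * of_real (w x) * f (- x)) \<Longrightarrow>
      (\<integral>\<^sup>+l. ennreal ((norm (H f (of_real l)))\<^sup>2 * \<bar>l\<bar> powr (2 * \<alpha> + 1)) * indicator {l. \<bar>l\<bar> \<ge> 1} l \<partial>lborel)
        \<le> ennreal C * (\<integral>\<^sup>+x. ennreal ((norm (f x))\<^sup>2) \<partial>\<mu>)"
    using opdam_L2_bounded_support by blast
  have "(\<integral>\<^sup>+l. ennreal ((norm (H f (complex_of_real l)))\<^sup>2 * \<bar>l\<bar> powr (2 * \<alpha> + 1)) * indicator {l. \<bar>l\<bar> \<ge> 1} l \<partial>lborel)
      \<le> ennreal C * (\<integral>\<^sup>+x. ennreal ((norm (f x))\<^sup>2) \<partial>\<mu>)" if f: "f \<in> Lp_space (ennreal p) \<mu>" for f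
  proof (cases "(\<integral>\<^sup>+x. ennreal ((norm (f x))\<^sup>2) \<partial>\<mu>) = \<infinity>")
    case True
    then show ?thesis using C by (simp add: ennreal_mult_top)
  next
    case False
    have [measurable]: "f \<in> borel_measurable borel" using f by (simp add: Lp_space_def borel_measurable_mu)
    define t where "t n x = indicator {- real n..real n} x * f x" for n x
    have t[measurable]: "t n \<in> borel_measurable borel" for n unfolding t_def[abs_def] by measurable
    have tle: "norm (t n x) \<le> norm (f x)" for n x by (simp add: t_def indicator_def)
    have tp: "t n \<in> Lp_space (ennreal p) \<mu>" for n
      by (rule Lp_space_mono[OF _ _ f tle]) (use p in \<open>auto simp: borel_measurable_mu\<close>)
    have fin: "(\<integral>\<^sup>+x. ennreal ((w \<bar>x\<bar>)\<^sup>2) * ennreal ((norm (g x))\<^sup>2) \<partial>lborel) < \<infinity>" if "g = f \<or> g = (\<lambda>x. f (- x))" for g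
    proof -
      have [measurable]: "g \<in> borel_measurable borel" using that by auto
      have "(\<integral>\<^sup>+x. ennreal ((w \<bar>x\<bar>)\<^sup>2) * ennreal ((norm (g x))\<^sup>2) \<partial>lborel) = (\<integral>\<^sup>+x. ennreal ((norm (g x))\<^sup>2) \<partial>\<mu>)"
        by (rule nn_integral_jacobi_mu[symmetric]) measurable
      also have "\<dots> = (\<integral>\<^sup>+x. ennreal ((norm (f x))\<^sup>2) \<partial>\<mu>)"
        using that nn_integral_mu_reflect[of "\<lambda>x. ennreal ((norm (f x))\<^sup>2)"] by auto
      finally show ?thesis using False by (simp add: less_top)
    qed
    have int_h: "integrable lborel (\<lambda>x. indicator {0<..} x * of_real (w x) * (indicator {- real n..real n} x * g x))" if g: "g = f \<or> g = (\<lambda>x. f (- x))" for g n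
    proof (rule integrableI_bounded)
      have [measurable]: "g \<in> borel_measurable borel" using that by auto
      show "(\<lambda>x. indicator {0<..} x * of_real (w x) * (indicator {- real n..real n} x * g x)) \<in> borel_measurable lborel" by measurable
      have "(\<integral>\<^sup>+x. ennreal (norm (indicator {0<..} x * complex_of_real (w x) * (indicator {- real n..real n} x * g x))) \<partial>lborel)
        \<le> (\<integral>\<^sup>+x. indicator {- real n..real n} x + ennreal ((w \<bar>x\<bar>)\<^sup>2) * ennreal ((norm (g x))\<^sup>2) \<partial>lborel)"
      proof (intro nn_integral_mono)
        fix x
        show "ennreal (norm (indicator {0<..} x * complex_of_real (w x) * (indicator {- real n..real n} x * g x))) \<le> indicator {- real n..real n} x + ennreal ((w \<bar>x\<bar>)\<^sup>2) * ennreal ((norm (g x))\<^sup>2)"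
        proof (cases "x > 0 \<and> x \<in> {- real n..real n}")
          case True
          \<comment> \<open>On the bounded interval the elementary a \<le> 1 + a^2 turns square
            integrability with respect to \<mu> into Lebesgue integrability of w g.\<close>
          have "w x * norm (g x) \<le> 1 + (w x * norm (g x))\<^sup>2"
          proof -
            have "a \<le> 1 + a\<^sup>2" for a :: real
              using sum_squares_bound[of 1 a] zero_le_power2[of a] unfolding one_power2 mult_1_right by linarith
            then show ?thesis .
          qed
          then have "ennreal (w x * norm (g x)) \<le> ennreal (1 + (w x)\<^sup>2 * (norm (g x))\<^sup>2)"
            by (intro ennreal_leI) (simp add: power_mult_distrib)
          also have "\<dots> = 1 + ennreal ((w x)\<^sup>2) * ennreal ((norm (g x))\<^sup>2)" by (simp add: ennreal_mult)
          finally show ?thesis using True w_pos[of x] by (auto simp: norm_mult)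
        next
          case False
          then have "indicator {0<..} x * complex_of_real (w x) * (indicator {- real n..real n} x * g x) = 0"
            by (auto simp: indicator_def)
          then show ?thesis by (simp only: norm_zero ennreal_0 zero_le)
        qed
      qed
      also have "\<dots> = (\<integral>\<^sup>+x. indicator {- real n..real n} x \<partial>lborel) + (\<integral>\<^sup>+x. ennreal ((w \<bar>x\<bar>)\<^sup>2) * ennreal ((norm (g x))\<^sup>2) \<partial>lborel)"
        by (rule nn_integral_add) auto
      also have "\<dots> < \<infinity>" using fin[OF g] by simp
      finally show "(\<integral>\<^sup>+x. ennreal (norm (indicator {0<..} x * complex_of_real (w x) * (indicator {- real n..real n} x * g x))) \<partial>lborel) < \<infinity>" .
    qed
    show ?thesis
    proof (rule nn_integral_le_of_tendsto)
      fix n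
      have [measurable]: "(\<lambda>l. H (t n) (complex_of_real l)) \<in> borel_measurable borel" by (rule opdam_real_measurable[OF p tp])
      show "(\<lambda>l. ennreal ((norm (H (t n) (complex_of_real l)))\<^sup>2 * \<bar>l\<bar> powr (2 * \<alpha> + 1)) * indicator {l. \<bar>l\<bar> \<ge> 1} l) \<in> borel_measurable lborel"
        by measurable
      have "(\<integral>\<^sup>+l. ennreal ((norm (H (t n) (of_real l)))\<^sup>2 * \<bar>l\<bar> powr (2 * \<alpha> + 1)) * indicator {l. \<bar>l\<bar> \<ge> 1} l \<partial>lborel)
        \<le> ennreal C * (\<integral>\<^sup>+x. ennreal ((norm (t n x))\<^sup>2) \<partial>\<mu>)"
      proof (rule bs[OF t])
        show "integrable \<mu> (\<lambda>x. t n x * G (of_real l) (- x))" for l by (rule opdam_integrable[OF p(1) tp real_in_strip[OF p]])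
        show "integrable lborel (\<lambda>x. indicator {0<..} x * of_real (w x) * t n x)"
          unfolding t_def by (rule int_h) simp
        have "indicator {- real n..real n} (- x) = (indicator {- real n..real n} x :: complex)" for x
          by (auto simp: indicator_def)
        then show "integrable lborel (\<lambda>x. indicator {0<..} x * of_real (w x) * t n (- x))"
          unfolding t_def using int_h[of "\<lambda>x. f (- x)" n] by simp
      qed
      also have "\<dots> \<le> ennreal C * (\<integral>\<^sup>+x. ennreal ((norm (f x))\<^sup>2) \<partial>\<mu>)"
        by (intro mult_left_mono nn_integral_mono ennreal_leI power_mono tle) auto
      finally show "(\<integral>\<^sup>+l. ennreal ((norm (H (t n) (of_real l)))\<^sup>2 * \<bar>l\<bar> powr (2 * \<alpha> + 1)) * indicator {l. \<bar>l\<bar> \<ge> 1} l \<partial>lborel) \<le> \<dots>" .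
    next
      fix l :: real
      have fG: "integrable \<mu> (\<lambda>x. f x * G (of_real l) (- x))" by (rule opdam_integrable[OF p(1) f real_in_strip[OF p]])
      have "(\<lambda>n. H (t n) (of_real l)) \<longlonglongrightarrow> H f (of_real l)"
        unfolding cherednik_opdam_def
      proof (rule integral_dominated_convergence[where w = "\<lambda>x. norm (f x * G (of_real l) (- x))"])
        show "(\<lambda>x. t n x * G (of_real l) (- x)) \<in> borel_measurable \<mu>" for n
          by (rule borel_measurable_integrable[OF opdam_integrable[OF p(1) tp real_in_strip[OF p]]])
        show "AE x in \<mu>. (\<lambda>n. t n x * G (of_real l) (- x)) \<longlonglongrightarrow> f x * G (of_real l) (- x)"
        proof (rule AE_I2)
          fix x
          have "\<forall>\<^sub>F n in sequentially. t n x * G (of_real l) (- x) = f x * G (of_real l) (- x)"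
            using eventually_ge_at_top[of "nat \<lceil>\<bar>x\<bar>\<rceil>"]
          proof eventually_elim
            case (elim n)
            then have "\<bar>x\<bar> \<le> real n" by linarith
            then show ?case by (simp add: t_def abs_le_iff)
          qed
          then show "(\<lambda>n. t n x * G (of_real l) (- x)) \<longlonglongrightarrow> f x * G (of_real l) (- x)"
            by (rule tendsto_eventually)
        qed
        show "AE x in \<mu>. norm (t n x * G (of_real l) (- x)) \<le> norm (f x * G (of_real l) (- x))" for n
          using tle by (auto simp: norm_mult intro!: mult_right_mono)
      qed (use fG in auto)
      then have "(\<lambda>n. ennreal ((norm (H (t n) (of_real l)))\<^sup>2 * \<bar>l\<bar> powr (2 * \<alpha> + 1))) \<longlonglongrightarrow> ennreal ((norm (H f (of_real l)))\<^sup>2 * \<bar>l\<bar> powr (2 * \<alpha> + 1))"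
        by (intro tendsto_ennrealI tendsto_intros)
      then show "(\<lambda>n. ennreal ((norm (H (t n) (of_real l)))\<^sup>2 * \<bar>l\<bar> powr (2 * \<alpha> + 1)) * indicator {l. \<bar>l\<bar> \<ge> 1} l) \<longlonglongrightarrow> ennreal ((norm (H f (of_real l)))\<^sup>2 * \<bar>l\<bar> powr (2 * \<alpha> + 1)) * indicator {l. \<bar>l\<bar> \<ge> 1} l"
        by (cases "\<bar>l\<bar> \<ge> 1") auto
    qed
  qed
  with C show ?thesis using that by blast
qed

end

section \<open>Interpolation\<close>

context jacobi_params
begin

lemma sigma_finite_mu: "sigma_finite_measure \<mu>"
  unfolding jacobi_mu_eq by (subst sigma_finite_measure.sigma_finite_iff_density_finite[OF sigma_finite_lborel]) auto

text \<open>Stands in for |nu| on |l| \<ge> 1, where by \<open>opdam_density_high\<close> it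
  dominates |nu| up to a constant. Interpolation is run on it because the \<open>L2\<close> bound is
  proved for exactly this power.\<close>

definition high_measure :: "real measure" where
  "high_measure = density lborel (\<lambda>l. ennreal (\<bar>l\<bar> powr (2 * \<alpha> + 1)) * indicator {l. \<bar>l\<bar> \<ge> 1} l)"

lemma sigma_finite_high: "sigma_finite_measure high_measure"
  unfolding high_measure_def
  by (subst sigma_finite_measure.sigma_finite_iff_density_finite[OF sigma_finite_lborel]) (auto simp: indicator_def)

lemma nn_integral_high:
  assumes [measurable]: "g \<in> borel_measurable borel"
  shows "(\<integral>\<^sup>+l. g l \<partial>high_measure) = (\<integral>\<^sup>+l. ennreal (\<bar>l\<bar> powr (2 * \<alpha> + 1)) * indicator {l. \<bar>l\<bar> \<ge> 1} l * g l \<partial>lborel)"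
  unfolding high_measure_def by (rule nn_integral_density) measurable

lemma borel_measurable_high: "borel_measurable high_measure = borel_measurable borel"
  unfolding high_measure_def by (rule measurable_cong_sets) auto

text \<open>Covers functions of norm 0, which \<open>marcinkiewicz\<close> with its hypothesis
  \<Phi> > 0 leaves out.\<close>

lemma opdam_zero:
  assumes p: "1 \<le> p" and f: "f \<in> Lp_space (ennreal p) \<mu>" and 0: "Lp_norm (ennreal p) \<mu> f = 0" and l: "l \<in> opdam_strip \<alpha> \<beta> p"
  shows "H f l = 0"
  using opdam_Hoelder[OF p f l] unfolding 0 by simp

text \<open>Truncating f keeps it in the same Lp space, so the transform of the truncation has all
  the properties shown so far. Here I is the p-th power of the norm, and q - 1 = q / p gives the
  bound the right homogeneity.\<close>

lemma opdam_high_Lq: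
  assumes p: "1 < p" "p < 2"
  obtains C where "C \<ge> 0" "\<And>f I. f \<in> Lp_space (ennreal p) \<mu> \<Longrightarrow> I > 0 \<Longrightarrow>
    (\<integral>\<^sup>+x. ennreal (norm (f x) powr p) \<partial>\<mu>) = ennreal I \<Longrightarrow>
    (\<integral>\<^sup>+l. ennreal (norm (H f (complex_of_real l)) powr (p / (p - 1))) \<partial>high_measure) \<le> ennreal (C * I powr (p / (p - 1) - 1))"
proof -
  have p': "1 \<le> p" using p by simp
  obtain B where B: "B > 0" and L2: "\<And>f. f \<in> Lp_space (ennreal p) \<mu> \<Longrightarrow>
    (\<integral>\<^sup>+l. ennreal ((norm (H f (complex_of_real l)))\<^sup>2 * \<bar>l\<bar> powr (2 * \<alpha> + 1)) * indicator {l. \<bar>l\<bar> \<ge> 1} l \<partial>lborel)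
      \<le> ennreal B * (\<integral>\<^sup>+x. ennreal ((norm (f x))\<^sup>2) \<partial>\<mu>)"
    using opdam_L2[OF p' p(2)] by blast
  define q where "q = p / (p - 1)"
  have q2: "q > 2" using p unfolding q_def by (simp add: less_divide_eq)
  \<comment> \<open>In \<open>2 * 2\<close> the first factor comes from
    \<open>marcinkiewicz\<close>; the second is its constant A, supplied by |G| \<le> 2 at real
    frequencies.\<close>
  have main: "(\<integral>\<^sup>+l. ennreal (norm (H f (complex_of_real l)) powr q) \<partial>high_measure) \<le> ennreal (4 * q * B * (2 * 2) powr (q - 2) / (q - 2) * I powr (q - 1))"
    if f: "f \<in> Lp_space (ennreal p) \<mu>" and I: "I > 0" "(\<integral>\<^sup>+x. ennreal (norm (f x) powr p) \<partial>\<mu>) = ennreal I" for f I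
  proof -
    have fm[measurable]: "f \<in> borel_measurable borel" using f by (simp add: Lp_space_def borel_measurable_mu)
    define t where "t s x = indicator {x. norm (f x) \<le> s} x * f x" for s x
    have tm[measurable]: "t s \<in> borel_measurable borel" for s unfolding t_def[abs_def] by measurable
    have tle: "norm (t s x) \<le> norm (f x)" for s x by (simp add: t_def indicator_def)
    have tp: "t s \<in> Lp_space (ennreal p) \<mu>" for s
      by (rule Lp_space_mono[OF _ _ f tle]) (use p' in \<open>auto simp: borel_measurable_mu\<close>)
    show ?thesis
    proof (rule marcinkiewicz[OF sigma_finite_mu sigma_finite_high, where f = f and G = "\<lambda>s l. H (t s) (complex_of_real l)" and p = p])
      show "f \<in> borel_measurable \<mu>" by (simp add: borel_measurable_mu)
      show "(\<lambda>l. H f (complex_of_real l)) \<in> borel_measurable high_measure"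
        unfolding borel_measurable_high by (rule opdam_real_measurable[OF p' p(2) f])
      show "(\<lambda>l. H (t s) (complex_of_real l)) \<in> borel_measurable high_measure" for s
        unfolding borel_measurable_high by (rule opdam_real_measurable[OF p' p(2) tp])
      show "q = p / (p - 1)" by (simp add: q_def)
    next
      fix s l :: real assume "s > 0"
      have i: "integrable \<mu> (\<lambda>x. f x * G (of_real l) (- x))" "integrable \<mu> (\<lambda>x. t s x * G (of_real l) (- x))"
        using opdam_integrable[OF p' f real_in_strip[OF p' p(2)]] opdam_integrable[OF p' tp real_in_strip[OF p' p(2)]] by auto
      have "H f (of_real l) - H (t s) (of_real l) = (LINT x|\<mu>. f x * G (of_real l) (- x) - t s x * G (of_real l) (- x))"
        unfolding cherednik_opdam_def by (rule Bochner_Integration.integral_diff[OF i, symmetric])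
      then have "ennreal (norm (H f (of_real l) - H (t s) (of_real l))) \<le> (\<integral>\<^sup>+x. norm (f x * G (of_real l) (- x) - t s x * G (of_real l) (- x)) \<partial>\<mu>)"
        using norm_integral_le_nn_integral by simp
      also have "\<dots> \<le> (\<integral>\<^sup>+x. ennreal 2 * (ennreal (norm (f x)) * indicator {x. norm (f x) > s} x) \<partial>\<mu>)"
      proof (intro nn_integral_mono)
        fix x
        have "norm (f x) * norm (G (of_real l) (- x)) \<le> 2 * norm (f x)"
          using mult_left_mono[OF opdam_G_real_le[of l "- x"], of "norm (f x)"] by (simp add: mult.commute)
        then have "ennreal (norm (f x * G (of_real l) (- x))) \<le> ennreal 2 * ennreal (norm (f x))"
          by (subst ennreal_mult[symmetric]) (auto simp: norm_mult intro!: ennreal_leI)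
        then show "ennreal (norm (f x * G (of_real l) (- x) - t s x * G (of_real l) (- x))) \<le> ennreal 2 * (ennreal (norm (f x)) * indicator {x. norm (f x) > s} x)"
          by (cases "norm (f x) > s") (auto simp: t_def)
      qed
      also have "\<dots> = ennreal 2 * (\<integral>\<^sup>+x. ennreal (norm (f x)) * indicator {x. norm (f x) > s} x \<partial>\<mu>)"
        by (rule nn_integral_cmult) (simp add: borel_measurable_mu)
      finally show "ennreal (norm (H f (of_real l) - H (t s) (of_real l))) \<le> ennreal 2 * (\<integral>\<^sup>+x. ennreal (norm (f x)) * indicator {x. norm (f x) > s} x \<partial>\<mu>)" .
    next
      fix s :: real
      have [measurable]: "(\<lambda>l. H (t s) (complex_of_real l)) \<in> borel_measurable borel" by (rule opdam_real_measurable[OF p' p(2) tp])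
      have "(\<integral>\<^sup>+l. ennreal ((norm (H (t s) (complex_of_real l)))\<^sup>2) \<partial>high_measure)
        = (\<integral>\<^sup>+l. ennreal (\<bar>l\<bar> powr (2 * \<alpha> + 1)) * indicator {l. \<bar>l\<bar> \<ge> 1} l * ennreal ((norm (H (t s) (complex_of_real l)))\<^sup>2) \<partial>lborel)"
        by (rule nn_integral_high) measurable
      also have "\<dots> = (\<integral>\<^sup>+l. ennreal ((norm (H (t s) (complex_of_real l)))\<^sup>2 * \<bar>l\<bar> powr (2 * \<alpha> + 1)) * indicator {l. \<bar>l\<bar> \<ge> 1} l \<partial>lborel)"
        by (intro nn_integral_cong) (auto simp: ennreal_mult indicator_def mult.commute)
      also have "\<dots> \<le> ennreal B * (\<integral>\<^sup>+x. ennreal ((norm (t s x))\<^sup>2) \<partial>\<mu>)" by (rule L2[OF tp])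
      also have "(\<integral>\<^sup>+x. ennreal ((norm (t s x))\<^sup>2) \<partial>\<mu>) = (\<integral>\<^sup>+x. ennreal ((norm (f x))\<^sup>2) * indicator {x. norm (f x) \<le> s} x \<partial>\<mu>)"
        by (intro nn_integral_cong) (auto simp: t_def indicator_def)
      finally show "(\<integral>\<^sup>+l. ennreal ((norm (H (t s) (complex_of_real l)))\<^sup>2) \<partial>high_measure)
        \<le> ennreal B * (\<integral>\<^sup>+x. ennreal ((norm (f x))\<^sup>2) * indicator {x. norm (f x) \<le> s} x \<partial>\<mu>)" .
    qed (use p B I in auto)
  qed
  have "4 * q * B * (2 * 2) powr (q - 2) / (q - 2) \<ge> 0" using q2 B by simp
  with main show ?thesis using that unfolding q_def by blast
qed

text \<open>For |l| \<le> 1 a single exponential dominates all the functions G, and its norm is the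
  constant. This supplies the uniformity in l that the bound by the norm of each G does not
  display.\<close>

lemma opdam_low_bound:
  assumes p: "1 \<le> p" "p < 2"
  obtains C where "C \<ge> 0" "\<And>f l. f \<in> Lp_space (ennreal p) \<mu> \<Longrightarrow> \<bar>l\<bar> \<le> 1 \<Longrightarrow>
    ennreal (norm (H f (complex_of_real l))) \<le> Lp_norm (ennreal p) \<mu> f * ennreal C"
proof -
  have "0 < (2 / p - 1) * \<rho>" using p rho_pos by (simp add: less_divide_eq)
  then obtain C s where C: "C \<ge> 0" "s > 2 * \<rho> * (1 - 1 / p)"
    "\<And>m x. norm m \<le> 1 \<Longrightarrow> \<bar>Im m\<bar> \<le> 0 \<Longrightarrow> norm (G m x) \<le> C * exp (- s * \<bar>x\<bar>)"
    using opdam_G_exp_bound[OF p(1), of 0 1] by auto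
  let ?e = "\<lambda>x. complex_of_real (C * exp (- s * \<bar>x\<bar>))"
  have e: "?e \<in> Lp_space (conj_exp p) \<mu>" by (rule exp_in_Lp[OF p(1) C(2,1)])
  then have "Lp_norm (conj_exp p) \<mu> ?e < \<infinity>" by (simp add: Lp_space_def)
  then obtain K where K: "K \<ge> 0" "Lp_norm (conj_exp p) \<mu> ?e = ennreal K"
    by (cases "Lp_norm (conj_exp p) \<mu> ?e") auto
  have "ennreal (norm (H f (complex_of_real l))) \<le> Lp_norm (ennreal p) \<mu> f * ennreal K"
    if f: "f \<in> Lp_space (ennreal p) \<mu>" and l: "\<bar>l\<bar> \<le> 1" for f l
  proof -
    have str: "of_real l \<in> opdam_strip \<alpha> \<beta> p" by (rule real_in_strip[OF p])
    have "Lp_norm (conj_exp p) \<mu> (G (of_real l)) \<le> Lp_norm (conj_exp p) \<mu> ?e"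
    proof (rule Lp_norm_mono[OF conj_exp_cases[OF p(1)] opdam_G_measurable_mu[OF p(1) str]])
      show "?e \<in> borel_measurable \<mu>" using e by (simp add: Lp_space_def)
      show "norm (G (of_real l) x) \<le> norm (?e x)" for x
        unfolding norm_of_real_exp[OF C(1)] by (rule C(3)) (use l in auto)
    qed
    then have "Lp_norm (ennreal p) \<mu> f * Lp_norm (conj_exp p) \<mu> (G (of_real l)) \<le> Lp_norm (ennreal p) \<mu> f * ennreal K"
      unfolding K by (rule mult_left_mono) simp
    then show ?thesis using opdam_Hoelder[OF p(1) f str] by (rule order_trans[rotated])
  qed
  with K(1) show ?thesis using that by blast
qed

text \<open>Gamma has poles, so its measurability is taken from the reciprocal of the entire
  function \<open>rGamma\<close>.\<close>

lemma opdam_density_measurable: "(\<lambda>l. ennreal (norm (opdam_density \<alpha> \<beta> k l))) \<in> borel_measurable borel"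
proof -
  have "(Gamma :: complex \<Rightarrow> complex) = (\<lambda>z. inverse (rGamma z))" by (simp add: fun_eq_iff rGamma_inverse_Gamma)
  moreover have "(rGamma :: complex \<Rightarrow> complex) \<in> borel_measurable borel"
    by (intro borel_measurable_continuous_onI continuous_intros)
  ultimately have [measurable]: "(Gamma :: complex \<Rightarrow> complex) \<in> borel_measurable borel"
    by (metis borel_measurable_inverse)
  have [measurable]: "(\<lambda>l. Complex s (l / 2)) \<in> borel_measurable borel" for s
    unfolding Complex_eq by measurable
  show ?thesis unfolding norm_opdam_density c_num_def by measurable
qed

lemma opdam_Lq:
  assumes p: "1 < p" "p < 2"
  obtains C where "C \<ge> 0" "\<And>f I. f \<in> Lp_space (ennreal p) \<mu> \<Longrightarrow> I \<ge> 0 \<Longrightarrow>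
    (\<integral>\<^sup>+x. ennreal (norm (f x) powr p) \<partial>\<mu>) = ennreal I \<Longrightarrow>
    (\<integral>\<^sup>+l. ennreal (norm (H f (complex_of_real l)) powr (p / (p - 1))) \<partial>opdam_nu_abs \<alpha> \<beta>) \<le> ennreal (C * I powr (p / (p - 1) - 1))"
proof -
  have p': "1 \<le> p" using p by simp
  define q where "q = p / (p - 1)"
  \<comment> \<open>The normalizing constant enters as this linear factor and is absorbed into
    \<open>C\<close>.\<close>
  define k where "k = \<bar>opdam_kappa \<alpha> \<beta>\<bar>"
  have k: "k \<ge> 0" by (simp add: k_def)
  have q: "q > 2" "1 / p * q = q - 1" using p unfolding q_def by (simp_all add: less_divide_eq field_simps)
  obtain C1 where C1: "C1 \<ge> 0" "\<And>f I. f \<in> Lp_space (ennreal p) \<mu> \<Longrightarrow> I > 0 \<Longrightarrow>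
    (\<integral>\<^sup>+x. ennreal (norm (f x) powr p) \<partial>\<mu>) = ennreal I \<Longrightarrow>
    (\<integral>\<^sup>+l. ennreal (norm (H f (complex_of_real l)) powr q) \<partial>high_measure) \<le> ennreal (C1 * I powr (q - 1))"
    using opdam_high_Lq[OF p] unfolding q_def by blast
  obtain C2 where C2: "C2 \<ge> 0" "\<And>f l. f \<in> Lp_space (ennreal p) \<mu> \<Longrightarrow> \<bar>l\<bar> \<le> 1 \<Longrightarrow>
    ennreal (norm (H f (complex_of_real l))) \<le> Lp_norm (ennreal p) \<mu> f * ennreal C2"
    using opdam_low_bound[OF p' p(2)] by blast
  obtain D1 where D1: "D1 \<ge> 0" "\<And>k l. \<bar>l\<bar> \<ge> 1 \<Longrightarrow> norm (opdam_density \<alpha> \<beta> k l) \<le> \<bar>k\<bar> * (D1 * \<bar>l\<bar> powr (2 * \<alpha> + 1))"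
    using opdam_density_high by blast
  obtain D2 where D2: "D2 \<ge> 0" "\<And>k l. \<bar>l\<bar> \<le> 1 \<Longrightarrow> norm (opdam_density \<alpha> \<beta> k l) \<le> \<bar>k\<bar> * D2"
    using opdam_density_low by blast
  define C where "C = k * D2 * C2 powr q * 2 + k * D1 * C1"
  have C: "C \<ge> 0" using k D1 D2 C1 by (simp add: C_def)
  have "(\<integral>\<^sup>+l. ennreal (norm (H f (complex_of_real l)) powr q) \<partial>opdam_nu_abs \<alpha> \<beta>) \<le> ennreal (C * I powr (q - 1))"
    if f: "f \<in> Lp_space (ennreal p) \<mu>" and I: "I \<ge> 0" "(\<integral>\<^sup>+x. ennreal (norm (f x) powr p) \<partial>\<mu>) = ennreal I" for f I
  proof -
    have n: "Lp_norm (ennreal p) \<mu> f = ennreal (I powr (1 / p))" by (rule Lp_norm_real_eq[OF p' I(2,1)])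
    have Hm[measurable]: "(\<lambda>l. H f (complex_of_real l)) \<in> borel_measurable borel" by (rule opdam_real_measurable[OF p' p(2) f])
    let ?h = "\<lambda>l. ennreal (norm (H f (complex_of_real l)) powr q)"
    show ?thesis
    proof (cases "I = 0")
      case True
      then have "H f (complex_of_real l) = 0" for l
        using n p by (intro opdam_zero[OF p' f _ real_in_strip[OF p' p(2)]]) simp
      then show ?thesis by simp
    next
      case False
      then have I0: "I > 0" using I by simp
      note [measurable] = opdam_density_measurable
      have "(\<integral>\<^sup>+l. ?h l \<partial>opdam_nu_abs \<alpha> \<beta>) = (\<integral>\<^sup>+l. ennreal (norm (opdam_density \<alpha> \<beta> (opdam_kappa \<alpha> \<beta>) l)) * ?h l \<partial>lborel)"
        unfolding opdam_nu_abs_def by (rule nn_integral_density) measurable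
      \<comment> \<open>High frequencies are compared with \<open>high_measure\<close>; on the low
        range the integrand is bounded and the interval has length 2. The ranges overlap at |l| = 1,
        which is harmless in an upper bound.\<close>
      also have "\<dots> \<le> (\<integral>\<^sup>+l. ennreal (k * D2 * (C2 powr q * I powr (q - 1))) * indicator {-1..1} l
          + ennreal (k * D1) * (ennreal (\<bar>l\<bar> powr (2 * \<alpha> + 1)) * indicator {l. \<bar>l\<bar> \<ge> 1} l * ?h l) \<partial>lborel)"
      proof (intro nn_integral_mono)
        fix l :: real
        let ?d = "norm (opdam_density \<alpha> \<beta> (opdam_kappa \<alpha> \<beta>) l)"
        show "ennreal ?d * ?h l \<le> ennreal (k * D2 * (C2 powr q * I powr (q - 1))) * indicator {-1..1} l
          + ennreal (k * D1) * (ennreal (\<bar>l\<bar> powr (2 * \<alpha> + 1)) * indicator {l. \<bar>l\<bar> \<ge> 1} l * ?h l)"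
        proof (cases "\<bar>l\<bar> \<ge> 1")
          case True
          have "ennreal ?d \<le> ennreal (k * (D1 * \<bar>l\<bar> powr (2 * \<alpha> + 1)))"
            using D1(2)[OF True] unfolding k_def by (rule ennreal_leI)
          also have "\<dots> = ennreal (k * D1) * ennreal (\<bar>l\<bar> powr (2 * \<alpha> + 1))"
            using k D1 by (simp add: mult.assoc flip: ennreal_mult')
          finally have "ennreal ?d * ?h l \<le> ennreal (k * D1) * ennreal (\<bar>l\<bar> powr (2 * \<alpha> + 1)) * ?h l"
            by (rule mult_right_mono) simp
          then show ?thesis using True by (simp add: mult.assoc add_increasing)
        next
          case False
          then have l1: "\<bar>l\<bar> \<le> 1" by simp
          have "ennreal (norm (H f (complex_of_real l))) \<le> ennreal (I powr (1 / p) * C2)"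
            using C2(2)[OF f l1] unfolding n ennreal_mult[OF powr_ge_zero C2(1)] .
          then have "norm (H f (complex_of_real l)) \<le> I powr (1 / p) * C2"
            using C2(1) by (subst (asm) ennreal_le_iff) auto
          then have "norm (H f (complex_of_real l)) powr q \<le> (I powr (1 / p) * C2) powr q"
            using q by (intro powr_mono2) auto
          also have "\<dots> = C2 powr q * I powr (q - 1)"
            using C2(1) q(2) by (simp add: powr_mult powr_powr mult.commute)
          finally have "?d * norm (H f (complex_of_real l)) powr q \<le> k * D2 * (C2 powr q * I powr (q - 1))"
            using D2(2)[OF l1, of "opdam_kappa \<alpha> \<beta>"] k D2(1) unfolding k_def by (intro mult_mono) auto
          then have "ennreal ?d * ?h l \<le> ennreal (k * D2 * (C2 powr q * I powr (q - 1)))"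
            by (subst ennreal_mult[symmetric]) (auto intro: ennreal_leI)
          then show ?thesis using l1 by (simp add: abs_le_iff add_increasing2)
        qed
      qed
      also have "\<dots> = ennreal (k * D2 * (C2 powr q * I powr (q - 1))) * emeasure lborel {-1..1::real}
          + ennreal (k * D1) * (\<integral>\<^sup>+l. ?h l \<partial>high_measure)"
        by (subst nn_integral_add) (auto simp: nn_integral_cmult nn_integral_high)
      also have "\<dots> \<le> ennreal (k * D2 * (C2 powr q * I powr (q - 1))) * ennreal 2 + ennreal (k * D1) * ennreal (C1 * I powr (q - 1))"
        using C1(2)[OF f I0 I(2)] by (intro add_mono mult_left_mono) auto
      also have "\<dots> = ennreal (C * I powr (q - 1))"
      proof -
        have "k * D2 * (C2 powr q * I powr (q - 1)) * 2 + k * D1 * (C1 * I powr (q - 1)) = C * I powr (q - 1)"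
          by (simp add: C_def algebra_simps)
        moreover have "k * D2 * (C2 powr q * I powr (q - 1)) \<ge> 0" "k * D1 \<ge> 0" "C1 * I powr (q - 1) \<ge> 0"
          using k D1 D2 C1 by auto
        ultimately show ?thesis by (metis ennreal_mult ennreal_plus mult_nonneg_nonneg zero_le_numeral)
      qed
      finally show ?thesis .
    qed
  qed
  with C show ?thesis using that unfolding q_def by blast
qed

text \<open>The endpoint p = 1 lies outside the interpolation and follows from |G| \<le> 2, with c =
  2. For p > 1 the q-th root is taken, where (q - 1) / q = 1 / p restores the norm of f.\<close>

lemma opdam_hausdorff_young:
  assumes p: "1 \<le> p" "p < 2"
  shows "\<exists>c\<ge>0. \<forall>f\<in>Lp_space (ennreal p) \<mu>.
      (\<lambda>l. H f (of_real l)) \<in> Lp_space (conj_exp p) (opdam_nu_abs \<alpha> \<beta>)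
    \<and> Lp_norm (conj_exp p) (opdam_nu_abs \<alpha> \<beta>) (\<lambda>l. H f (of_real l)) \<le> ennreal c * Lp_norm (ennreal p) \<mu> f"
proof -
  have bm: "borel_measurable (opdam_nu_abs \<alpha> \<beta>) = borel_measurable borel"
    unfolding opdam_nu_abs_def by (rule measurable_cong_sets) auto
  have "\<exists>c\<ge>0. \<forall>f\<in>Lp_space (ennreal p) \<mu>.
    Lp_norm (conj_exp p) (opdam_nu_abs \<alpha> \<beta>) (\<lambda>l. H f (of_real l)) \<le> ennreal c * Lp_norm (ennreal p) \<mu> f"
  proof (cases "p = 1")
    case True
    have "Lp_norm (conj_exp p) (opdam_nu_abs \<alpha> \<beta>) (\<lambda>l. H f (of_real l)) \<le> ennreal 2 * Lp_norm (ennreal p) \<mu> f"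
      if f: "f \<in> Lp_space (ennreal p) \<mu>" for f
    proof -
      obtain I where I: "I \<ge> 0" "(\<integral>\<^sup>+x. ennreal (norm (f x) powr p) \<partial>\<mu>) = ennreal I"
        "Lp_norm (ennreal p) \<mu> f = ennreal (I powr (1 / p))" "f \<in> borel_measurable \<mu>"
        by (rule Lp_space_realE[OF f p(1)])
      note [measurable] = I(4)
      have n: "Lp_norm (ennreal p) \<mu> f = (\<integral>\<^sup>+x. ennreal (norm (f x)) \<partial>\<mu>)" using I True by simp
      have "ennreal (norm (H f (of_real l))) \<le> ennreal 2 * Lp_norm (ennreal p) \<mu> f" for l
      proof -
        have "ennreal (norm (H f (of_real l))) \<le> (\<integral>\<^sup>+x. norm (f x * G (of_real l) (- x)) \<partial>\<mu>)"
          unfolding cherednik_opdam_def by (rule norm_integral_le_nn_integral)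
        also have "\<dots> \<le> (\<integral>\<^sup>+x. ennreal 2 * ennreal (norm (f x)) \<partial>\<mu>)"
        proof (intro nn_integral_mono)
          fix x
          have "norm (f x) * norm (G (of_real l) (- x)) \<le> norm (f x) * 2" by (intro mult_left_mono opdam_G_real_le) auto
          then show "ennreal (norm (f x * G (of_real l) (- x))) \<le> ennreal 2 * ennreal (norm (f x))"
            by (subst ennreal_mult[symmetric]) (auto simp: norm_mult mult.commute intro!: ennreal_leI)
        qed
        also have "\<dots> = ennreal 2 * (\<integral>\<^sup>+x. ennreal (norm (f x)) \<partial>\<mu>)" by (rule nn_integral_cmult) simp
        finally show ?thesis unfolding n .
      qed
      then have "esssup (opdam_nu_abs \<alpha> \<beta>) (\<lambda>l. ennreal (norm (H f (of_real l)))) \<le> ennreal 2 * Lp_norm (ennreal p) \<mu> f"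
        using opdam_real_measurable[OF p f] by (intro esssup_I) (auto simp: bm)
      then show ?thesis using True by (simp add: conj_exp_def Lp_norm_def)
    qed
    then show ?thesis by (intro exI[of _ 2]) simp
  next
    case False
    then have p1: "1 < p" using p by simp
    define q where "q = p / (p - 1)"
    have q: "q > 1" "conj_exp p = ennreal q" "(q - 1) * (1 / q) = 1 / p"
      using p1 by (auto simp: q_def conj_exp_def field_simps)
    obtain C where C: "C \<ge> 0" "\<And>f I. f \<in> Lp_space (ennreal p) \<mu> \<Longrightarrow> I \<ge> 0 \<Longrightarrow>
      (\<integral>\<^sup>+x. ennreal (norm (f x) powr p) \<partial>\<mu>) = ennreal I \<Longrightarrow>
      (\<integral>\<^sup>+l. ennreal (norm (H f (complex_of_real l)) powr q) \<partial>opdam_nu_abs \<alpha> \<beta>) \<le> ennreal (C * I powr (q - 1))"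
      using opdam_Lq[OF p1 p(2)] unfolding q_def by blast
    have "Lp_norm (conj_exp p) (opdam_nu_abs \<alpha> \<beta>) (\<lambda>l. H f (of_real l)) \<le> ennreal (C powr (1 / q)) * Lp_norm (ennreal p) \<mu> f"
      if f: "f \<in> Lp_space (ennreal p) \<mu>" for f
    proof -
      obtain I where I: "I \<ge> 0" "(\<integral>\<^sup>+x. ennreal (norm (f x) powr p) \<partial>\<mu>) = ennreal I"
        "Lp_norm (ennreal p) \<mu> f = ennreal (I powr (1 / p))" "f \<in> borel_measurable \<mu>"
        by (rule Lp_space_realE[OF f p(1)])
      let ?J = "\<integral>\<^sup>+l. ennreal (norm (H f (complex_of_real l)) powr q) \<partial>opdam_nu_abs \<alpha> \<beta>"
      have le: "?J \<le> ennreal (C * I powr (q - 1))" by (rule C(2)[OF f I(1,2)])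
      then obtain J where J: "J \<ge> 0" "?J = ennreal J" by (cases ?J) (auto simp: top_unique)
      have "J \<le> C * I powr (q - 1)" using le C(1) unfolding J(2) by (subst (asm) ennreal_le_iff) auto
      then have "J powr (1 / q) \<le> (C * I powr (q - 1)) powr (1 / q)" using q J by (intro powr_mono2) auto
      also have "\<dots> = C powr (1 / q) * I powr (1 / p)" using C(1) q(3) by (simp add: powr_mult powr_powr)
      finally have "ennreal (J powr (1 / q)) \<le> ennreal (C powr (1 / q)) * ennreal (I powr (1 / p))"
        by (subst ennreal_mult[symmetric]) (auto intro: ennreal_leI)
      moreover have "Lp_norm (conj_exp p) (opdam_nu_abs \<alpha> \<beta>) (\<lambda>l. H f (of_real l)) = ennreal (J powr (1 / q))"
        unfolding q(2) by (rule Lp_norm_real_eq[OF _ J(2,1)]) (use q in simp)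
      ultimately show ?thesis unfolding I(3) by simp
    qed
    then show ?thesis by (intro exI[of _ "C powr (1 / q)"]) simp
  qed
  then obtain c where c: "c \<ge> 0" "\<And>f. f \<in> Lp_space (ennreal p) \<mu> \<Longrightarrow>
    Lp_norm (conj_exp p) (opdam_nu_abs \<alpha> \<beta>) (\<lambda>l. H f (of_real l)) \<le> ennreal c * Lp_norm (ennreal p) \<mu> f"
    by blast
  have "(\<lambda>l. H f (of_real l)) \<in> Lp_space (conj_exp p) (opdam_nu_abs \<alpha> \<beta>)" if f: "f \<in> Lp_space (ennreal p) \<mu>" for f
  proof -
    have "Lp_norm (ennreal p) \<mu> f < \<infinity>" using f by (simp add: Lp_space_def)
    then have "ennreal c * Lp_norm (ennreal p) \<mu> f < \<infinity>" by (simp add: ennreal_mult_less_top)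
    then show ?thesis unfolding Lp_space_def
      using le_less_trans[OF c(2)[OF f]] opdam_real_measurable[OF p f] by (simp add: bm)
  qed
  with c show ?thesis by blast
qed

end

theorem lemma3p1:
  fixes \<alpha> \<beta> p :: real and q :: ennreal
  assumes "\<alpha> \<ge> \<beta>" and "\<beta> \<ge> - 1 / 2" and "\<alpha> \<noteq> - 1 / 2"
    and "1 \<le> p" and "p < 2"
    and "q = (if p = 1 then \<infinity> else ennreal (p / (p - 1)))"
  shows "(\<forall>l\<in>opdam_strip \<alpha> \<beta> p. opdam_G \<alpha> \<beta> l \<in> Lp_space q (jacobi_mu \<alpha> \<beta>))
    \<and> (\<forall>f\<in>Lp_space (ennreal p) (jacobi_mu \<alpha> \<beta>).
          (\<forall>l\<in>opdam_strip \<alpha> \<beta> p.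
             integrable (jacobi_mu \<alpha> \<beta>) (\<lambda>x. f x * opdam_G \<alpha> \<beta> l (- x)))
        \<and> cherednik_opdam \<alpha> \<beta> f holomorphic_on opdam_strip \<alpha> \<beta> p
        \<and> (\<forall>l\<in>opdam_strip \<alpha> \<beta> p.
             ennreal (cmod (cherednik_opdam \<alpha> \<beta> f l))
               \<le> Lp_norm (ennreal p) (jacobi_mu \<alpha> \<beta>) f
                  * Lp_norm q (jacobi_mu \<alpha> \<beta>) (opdam_G \<alpha> \<beta> l)))
    \<and> (\<exists>c\<ge>0. \<forall>f\<in>Lp_space (ennreal p) (jacobi_mu \<alpha> \<beta>).
          (\<lambda>l. cherednik_opdam \<alpha> \<beta> f (of_real l)) \<in> Lp_space q (opdam_nu_abs \<alpha> \<beta>)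
        \<and> Lp_norm q (opdam_nu_abs \<alpha> \<beta>) (\<lambda>l. cherednik_opdam \<alpha> \<beta> f (of_real l))
            \<le> ennreal c * Lp_norm (ennreal p) (jacobi_mu \<alpha> \<beta>) f)"
proof -
  interpret jacobi_params \<alpha> \<beta>
    using assms by unfold_locales auto
  have q: "q = conj_exp p" using assms(6) by (simp add: conj_exp_def)
  show ?thesis
    unfolding q using assms(4,5) opdam_G_in_Lp opdam_integrable opdam_holomorphic opdam_Hoelder
      opdam_hausdorff_young by auto
qed

end
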